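(* Let $\mathcal{M}_{2,3}^{\mathrm{big}}=\{[(\mathcal{E},\varphi)]\in\mathcal{M}_{2,3}\mid\mathcal{E}\simeq\mathcal{O}(\frac14)\oplus\mathcal{O}(-\frac14)\}$. There is a bijection $\mathbb{C}^2\simeq\mathcal{M}^{\mathrm{big}}_{2,3}$, $(w,\gamma)\mapsto[(\mathcal{E}_{w,\gamma},\varphi_{w,\gamma})]$, where for each $(w,\gamma)\in\mathbb{C}^2$ the representative $(\mathcal{E}_{w,\gamma},\varphi_{w,\gamma})$ is $$\mathcal{E}_{w,\gamma}=\mathcal{O}\left(\tfrac14\right)\oplus\mathcal{O}\left(-\tfrac14\right),\qquad\varphi_{w,\gamma}=\begin{pmatrix}\gamma&\frac{z^3-w^3}{z-w}\\ z-w&-\gamma\end{pmatrix}dz$$ (matrix in the basis of canonical sections of the two summands).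
   Context: Here $K=2$, $N=3$; $z$ is the standard coordinate on $\mathbb{C}\subset\mathbb{CP}^1$. Filtered bundles. A filtered rank $2$ bundle on $(\mathbb{CP}^1,\{\infty\})$ is a locally free $\mathcal{O}_{\mathbb{CP}^1}( *\{\infty\})$-module $\mathcal{E}$ of rank $2$ (where $\mathcal{O}_{\mathbb{CP}^1}( *\{\infty\})$ is the sheaf of meromorphic functions with poles only at $\infty$) with an increasing filtration by locally free $\mathcal{O}_{\mathbb{CP}^1}$-submodules $\mathcal{P}_\alpha\mathcal{E}$, $\alpha\in\mathbb{R}$, such that $\mathcal{P}_\alpha\mathcal{E}|_{\mathbb{C}}=\mathcal{E}|_{\mathbb{C}}$, $\mathcal{P}_\alpha\mathcal{E}=\bigcap_{\beta>\alpha}\mathcal{P}_\beta\mathcal{E}$, and near $\infty$, with $x=1/z$, $\mathcal{P}_{\alpha-1}\mathcal{E}=x\,\mathcal{P}_\alpha\mathcal{E}$ (similarly over a disc with a marked point, and for other ranks). For a section $s$ near $\infty$, its order is $\nu_\infty(s)=\inf\{\alpha: s\in\mathcal{P}_\alpha\mathcal{E}\}$. Direct sums and tensor products are filtered by $\mathcal{P}_\alpha(\mathcal{E}\oplus\mathcal{E}')=\mathcal{P}_\alpha\mathcal{E}\oplus\mathcal{P}_\alpha\mathcal{E}'$, $\mathcal{P}_\alpha(\mathcal{E}\otimes\mathcal{E}')=\sum_{\beta+\gamma=\alpha}\mathcal{P}_\beta\mathcal{E}\otimes\mathcal{P}_\gamma\mathcal{E}'$, and exterior powers as subbundles of tensor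 powers. A filtered $SL(2)$-bundle is a filtered rank $2$ bundle with a global section $\omega$ of $\wedge^2\mathcal{E}$ trivializing it on $\mathbb{C}$, with $\nu_\infty(\omega)=0$. A filtered $SL(2)$-Higgs bundle is a pair $(\mathcal{E},\varphi)$ with $\mathcal{E}$ a filtered $SL(2)$-bundle and $\varphi$ a traceless meromorphic section of $\operatorname{End}\mathcal{E}\otimes K_{\mathbb{CP}^1}$, holomorphic on $\mathbb{C}$. For $\alpha\in\mathbb{R}$, $\mathcal{O}(\alpha)$ is the filtered line bundle with underlying module $\mathcal{O}_{\mathbb{CP}^1}( *\{\infty\})$ and filtration by pole order at $\infty$ shifted by $-\alpha$; its canonical section is the element $1$, which trivializes it on $\mathbb{C}$ and has $\nu_\infty=-\alpha$. The category $\mathcal{C}_{2,3}$. Objects are filtered $SL(2)$-Higgs bundles $(\mathcal{E},\varphi)$ such that, for a disc $U$ around $\infty$ with coordinate $x=1/z$ and the ramified covering $\psi:\widetilde U\to U$, given in a coordinate $y$ on $\widetilde U$ by $x=y^{4}$, with $\psi^*\mathcal{E}$ given its natural filtration (for which $\nu_{y=0}(\psi^*s)=4\,\nu_\infty(s)$), there is a decomposition of filtered bundles $\psi^*\mathcal{E}=\mathcal{L}_1\oplus\mathcal{L}_2$ into filtered line bundles preserved by $\psi^*\varphi$, each $\mathcal{L}_r$ being equivalent to an ordinary line bundle with the standard filtration by pole order at $y=0$, and such that the restriction $\varphi_r$ of $\psi^*\varphi$ to $\mathcal{L}_r$ satisfies $(\varphi_r-d\mathfrak{a}_r)(\mathcal{P}_\alpha\mathcal{L}_r)\subset\mathcal{P}_{\alpha+1}\mathcal{L}_r\otimes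 K_{\widetilde U}$ for all $\alpha$, with $\mathfrak{a}_r=\frac25(-1)^ry^{-10}$. Equivalently: there is a trivialization $g:\psi^*\mathcal{E}\to\mathcal{O}_{\widetilde U}^{\oplus2}$, inducing the filtration from the standard pole-order filtration, with $g(\psi^*\varphi)g^{-1}=-4\operatorname{diag}(-1,1)\frac{dy}{y^{11}}+(\text{holomorphic in }y)$. Morphisms are isomorphisms of filtered bundles preserving the Higgs fields. $\mathcal{M}_{2,3}$ is the set of isomorphism classes of objects of $\mathcal{C}_{2,3}$. *)

theory Defs
  imports "HOL-Complex_Analysis.Complex_Analysis" "HOL-Algebra.Module"
begin

section \<open>The projective line and its structure sheaves\<close>

text \<open>
  \<open>Some z\<close> is the point with affine coordinate \<open>z\<close>, and \<open>None\<close> is the point at infinity, with local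
  coordinate \<open>x = 1/z\<close>. All sheaves live on open subsets of \<open>CP1\<close>. In particular a disc around \<open>0\<close>
  with coordinate \<open>y\<close> is regarded as a neighbourhood of infinity in \<open>CP1\<close>, with affine coordinate
  \<open>u = 1/y\<close>.
\<close>

abbreviation CP1 :: "complex option topology" where
  "CP1 \<equiv> Alexandroff_compactification euclidean"

abbreviation is_open :: "complex option set \<Rightarrow> complex option set \<Rightarrow> bool" where
  "is_open X U \<equiv> openin CP1 U \<and> U \<subseteq> X"

definition disc :: "real \<Rightarrow> complex option set" where
  "disc R = insert None (Some ` {u. R < norm u})"

definition restr :: "complex option set \<Rightarrow> (complex \<Rightarrow> complex) \<Rightarrow> complex \<Rightarrow> complex" where
  "restr V f = (\<lambda>z. if Some z \<in> V then f z else 0)"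

text \<open>The pole order at infinity is at most \<open>n\<close>: \<open>f(1/x) = g(x) x\<^sup>-\<^sup>n\<close> with \<open>g\<close> holomorphic at \<open>x = 0\<close>.\<close>

definition pole_order_le :: "int \<Rightarrow> (complex \<Rightarrow> complex) \<Rightarrow> bool" where
  "pole_order_le n f \<longleftrightarrow>
     (\<exists>g. g analytic_on {0} \<and> (\<forall>\<^sub>F x in at 0. f (inverse x) = g x * x powi (- n)))"

text \<open>
  Sections over \<open>U\<close> of the sheaf of meromorphic functions with poles only at infinity. A section is
  determined by its restriction to the affine part of \<open>U\<close>, and is represented by that restriction
  extended by zero.
\<close>

definition mero_ring :: "complex option set \<Rightarrow> (complex \<Rightarrow> complex) ring" where
  "mero_ring U =
     \<lparr>carrier = {f. f holomorphic_on {z. Some z \<in> U} \<and> (\<forall>z. Some z \<notin> U \<longrightarrow> f z = 0) \<and>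
                    (None \<in> U \<longrightarrow> (\<lambda>x. f (inverse x)) meromorphic_on {0})},
      mult = (\<lambda>f g z. f z * g z), one = restr U (\<lambda>_. 1),
      zero = (\<lambda>_. 0), add = (\<lambda>f g z. f z + g z)\<rparr>"

definition hol_ring :: "complex option set \<Rightarrow> (complex \<Rightarrow> complex) ring" where
  "hol_ring U = (mero_ring U)
     \<lparr>carrier := {f \<in> carrier (mero_ring U). None \<in> U \<longrightarrow> pole_order_le 0 f}\<rparr>"


section \<open>Filtered bundles\<close>

text \<open>
  Sections (a module over \<^term>\<open>mero_ring U\<close> for each open \<open>U\<close>), restriction maps, and the filtration:
  \<open>fil E \<alpha> U\<close> is the set of sections over \<open>U\<close> of the \<open>\<alpha>\<close>-th step.
\<close>

record 'a fbundle =
  sec :: "complex option set \<Rightarrow> (complex \<Rightarrow> complex, 'a) module"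
  res :: "complex option set \<Rightarrow> complex option set \<Rightarrow> 'a \<Rightarrow> 'a"
  fil :: "real \<Rightarrow> complex option set \<Rightarrow> 'a set"

abbreviation secs :: "'a fbundle \<Rightarrow> complex option set \<Rightarrow> 'a set" where
  "secs E U \<equiv> carrier (sec E U)"

definition linear_map ::
  "('r, 'k) ring_scheme \<Rightarrow> ('r, 'a, 'm) module_scheme \<Rightarrow> ('r, 'b, 'n) module_scheme \<Rightarrow> ('a \<Rightarrow> 'b) \<Rightarrow> bool" where
  "linear_map R M N h \<longleftrightarrow>
     h \<in> carrier M \<rightarrow> carrier N \<and>
     (\<forall>s\<in>carrier M. \<forall>t\<in>carrier M. h (s \<oplus>\<^bsub>M\<^esub> t) = h s \<oplus>\<^bsub>N\<^esub> h t) \<and>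
     (\<forall>f\<in>carrier R. \<forall>s\<in>carrier M. h (f \<odot>\<^bsub>M\<^esub> s) = f \<odot>\<^bsub>N\<^esub> h s)"

definition module_sheaf :: "complex option set \<Rightarrow> 'a fbundle \<Rightarrow> bool" where
  "module_sheaf X E \<longleftrightarrow>
     (\<forall>U. is_open X U \<longrightarrow> Module.module (mero_ring U) (sec E U)) \<and>
     (\<forall>U V. is_open X U \<longrightarrow> is_open U V \<longrightarrow>
        res E U V \<in> secs E U \<rightarrow> secs E V \<and>
        (\<forall>s\<in>secs E U. \<forall>t\<in>secs E U.
           res E U V (s \<oplus>\<^bsub>sec E U\<^esub> t) = res E U V s \<oplus>\<^bsub>sec E V\<^esub> res E U V t) \<and>
        (\<forall>f\<in>carrier (mero_ring U). \<forall>s\<in>secs E U.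
           res E U V (f \<odot>\<^bsub>sec E U\<^esub> s) = restr V f \<odot>\<^bsub>sec E V\<^esub> res E U V s)) \<and>
     (\<forall>U. is_open X U \<longrightarrow> (\<forall>s\<in>secs E U. res E U U s = s)) \<and>
     (\<forall>U V W. is_open X U \<longrightarrow> is_open U V \<longrightarrow> is_open V W \<longrightarrow>
        (\<forall>s\<in>secs E U. res E V W (res E U V s) = res E U W s)) \<and>
     (\<forall>\<U> s. (\<forall>U\<in>\<U>. is_open X U \<and> s U \<in> secs E U) \<longrightarrow>
        (\<forall>U\<in>\<U>. \<forall>V\<in>\<U>. res E U (U \<inter> V) (s U) = res E V (U \<inter> V) (s V)) \<longrightarrow>
        (\<exists>!t. t \<in> secs E (\<Union>\<U>) \<and> (\<forall>U\<in>\<U>. res E (\<Union>\<U>) U t = s U)))"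

text \<open>Subsheaves of modules over the sheaf of holomorphic functions.\<close>

definition hol_submodule ::
  "complex option set \<Rightarrow> 'a fbundle \<Rightarrow> (complex option set \<Rightarrow> 'a set) \<Rightarrow> bool" where
  "hol_submodule X E L \<longleftrightarrow>
     (\<forall>U. is_open X U \<longrightarrow> submodule (L U) (hol_ring U) (sec E U)) \<and>
     (\<forall>U V. is_open X U \<longrightarrow> is_open U V \<longrightarrow> res E U V \<in> L U \<rightarrow> L V) \<and>
     (\<forall>\<U>. (\<forall>U\<in>\<U>. is_open X U) \<longrightarrow>
        (\<forall>s\<in>secs E (\<Union>\<U>). (\<forall>U\<in>\<U>. res E (\<Union>\<U>) U s \<in> L U) \<longrightarrow> s \<in> L (\<Union>\<U>)))"

text \<open>
  \<open>e 0, \<dots>, e (n - 1)\<close> is a frame over \<open>U\<close> of the subsheaf \<open>L\<close> of \<open>E\<close>, regarded as a sheaf of modules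
  over the sheaf of rings \<open>R\<close> (either \<^const>\<open>mero_ring\<close> or \<^const>\<open>hol_ring\<close>); that is, it defines an
  isomorphism from \<open>R\<close> to the power \<open>n\<close> onto \<open>L\<close> over \<open>U\<close>.
\<close>

definition frame ::
  "(complex option set \<Rightarrow> (complex \<Rightarrow> complex) ring) \<Rightarrow> nat \<Rightarrow> 'a fbundle \<Rightarrow>
   (complex option set \<Rightarrow> 'a set) \<Rightarrow> complex option set \<Rightarrow> (nat \<Rightarrow> 'a) \<Rightarrow> bool" where
  "frame R n E L U e \<longleftrightarrow>
     openin CP1 U \<and> (\<forall>i<n. e i \<in> L U) \<and>
     (\<forall>V. is_open U V \<longrightarrow> (\<forall>s\<in>L V. \<exists>!c. c \<in> {..<n} \<rightarrow>\<^sub>E carrier (R V) \<and>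
        s = (\<Oplus>\<^bsub>sec E V\<^esub>i\<in>{..<n}. c i \<odot>\<^bsub>sec E V\<^esub> res E U V (e i))))"

definition locally_free ::
  "(complex option set \<Rightarrow> (complex \<Rightarrow> complex) ring) \<Rightarrow> nat \<Rightarrow> complex option set \<Rightarrow> 'a fbundle \<Rightarrow>
   (complex option set \<Rightarrow> 'a set) \<Rightarrow> bool" where
  "locally_free R n X E L \<longleftrightarrow> (\<forall>p\<in>X. \<exists>U e. is_open X U \<and> p \<in> U \<and> frame R n E L U e)"

definition filtered_bundle :: "complex option set \<Rightarrow> nat \<Rightarrow> 'a fbundle \<Rightarrow> bool" where
  "filtered_bundle X n E \<longleftrightarrow>
     module_sheaf X E \<and> locally_free mero_ring n X E (secs E) \<and>
     (\<forall>\<alpha>. hol_submodule X E (fil E \<alpha>) \<and> locally_free hol_ring n X E (fil E \<alpha>)) \<and>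
     (\<forall>\<alpha> \<beta> U. is_open X U \<longrightarrow> \<alpha> \<le> \<beta> \<longrightarrow> fil E \<alpha> U \<subseteq> fil E \<beta> U) \<and>
     (\<forall>\<alpha> U. is_open X U \<longrightarrow> None \<notin> U \<longrightarrow> fil E \<alpha> U = secs E U) \<and>
     (\<forall>\<alpha> U. is_open X U \<longrightarrow> fil E \<alpha> U = (\<Inter>\<beta>\<in>{\<alpha><..}. fil E \<beta> U)) \<and>
     (\<forall>\<alpha> U. is_open X U \<longrightarrow> None \<in> U \<longrightarrow> Some 0 \<notin> U \<longrightarrow>
        fil E (\<alpha> - 1) U = (\<lambda>s. restr U inverse \<odot>\<^bsub>sec E U\<^esub> s) ` fil E \<alpha> U)"

definition fb_iso_map ::
  "complex option set \<Rightarrow> 'a fbundle \<Rightarrow> 'b fbundle \<Rightarrow> (complex option set \<Rightarrow> 'a \<Rightarrow> 'b) \<Rightarrow> bool" where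
  "fb_iso_map X E F h \<longleftrightarrow>
     (\<forall>U. is_open X U \<longrightarrow>
        linear_map (mero_ring U) (sec E U) (sec F U) (h U) \<and>
        bij_betw (h U) (secs E U) (secs F U) \<and>
        (\<forall>\<alpha>. h U ` fil E \<alpha> U = fil F \<alpha> U)) \<and>
     (\<forall>U V. is_open X U \<longrightarrow> is_open U V \<longrightarrow>
        (\<forall>s\<in>secs E U. h V (res E U V s) = res F U V (h U s)))"

definition fb_iso :: "complex option set \<Rightarrow> 'a fbundle \<Rightarrow> 'b fbundle \<Rightarrow> bool" where
  "fb_iso X E F \<longleftrightarrow> (\<exists>h. fb_iso_map X E F h)"

definition line_bundle :: "real \<Rightarrow> (complex \<Rightarrow> complex) fbundle" where
  "line_bundle \<alpha> =
     \<lparr>sec = (\<lambda>U. ring.extend (mero_ring U) (module.fields (\<lambda>f g z. f z * g z))),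
      res = (\<lambda>U V. restr V),
      fil = (\<lambda>\<beta> U. {f \<in> carrier (mero_ring U). None \<in> U \<longrightarrow> pole_order_le \<lfloor>\<beta> + \<alpha>\<rfloor> f})\<rparr>"

text \<open>The fields \<open>mult\<close> and \<open>one\<close> of a module record are not used by \<^const>\<open>Module.module\<close>.\<close>

definition direct_sum :: "'a fbundle \<Rightarrow> 'b fbundle \<Rightarrow> ('a \<times> 'b) fbundle" where
  "direct_sum E F =
     \<lparr>sec = (\<lambda>U. \<lparr>carrier = secs E U \<times> secs F U, mult = undefined, one = undefined,
                  zero = (\<zero>\<^bsub>sec E U\<^esub>, \<zero>\<^bsub>sec F U\<^esub>),
                  add = (\<lambda>(s, t) (s', t'). (s \<oplus>\<^bsub>sec E U\<^esub> s', t \<oplus>\<^bsub>sec F U\<^esub> t')),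
                  smult = (\<lambda>f (s, t). (f \<odot>\<^bsub>sec E U\<^esub> s, f \<odot>\<^bsub>sec F U\<^esub> t))\<rparr>),
      res = (\<lambda>U V (s, t). (res E U V s, res F U V t)),
      fil = (\<lambda>\<alpha> U. fil E \<alpha> U \<times> fil F \<alpha> U)\<rparr>"

text \<open>The subbundle with sections \<open>S U\<close> and the induced filtration.\<close>

definition sub_fbundle :: "'a fbundle \<Rightarrow> (complex option set \<Rightarrow> 'a set) \<Rightarrow> 'a fbundle" where
  "sub_fbundle E S =
     \<lparr>sec = (\<lambda>U. (sec E U)\<lparr>carrier := S U\<rparr>), res = res E, fil = (\<lambda>\<alpha> U. fil E \<alpha> U \<inter> S U)\<rparr>"

text \<open>
  A filtered bundle (over a disc around infinity) that comes from an ordinary bundle \<open>L\<close> of rank \<open>n\<close>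
  with the filtration by pole order: \<open>s\<close> lies in step \<open>\<alpha>\<close> iff \<open>y\<close> to the power \<open>\<lfloor>\<alpha>\<rfloor>\<close> times \<open>s\<close> is
  a section of \<open>L\<close>, where \<open>y = 1/u\<close> and \<open>u\<close> is the affine coordinate.
\<close>

definition pole_order_filtration :: "complex option set \<Rightarrow> nat \<Rightarrow> 'a fbundle \<Rightarrow> bool" where
  "pole_order_filtration X n E \<longleftrightarrow>
     (\<exists>L. hol_submodule X E L \<and> locally_free hol_ring n X E L \<and>
        (\<forall>U. is_open X U \<longrightarrow> None \<notin> U \<longrightarrow> L U = secs E U) \<and>
        (\<forall>\<alpha> U. is_open X U \<longrightarrow> None \<in> U \<longrightarrow> Some 0 \<notin> U \<longrightarrow>
           fil E \<alpha> U = {s \<in> secs E U. restr U (\<lambda>u. inverse u powi \<lfloor>\<alpha>\<rfloor>) \<odot>\<^bsub>sec E U\<^esub> s \<in> L U}))"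


section \<open>Tensor square and determinant\<close>

text \<open>The coefficients of the section \<open>s\<close> over \<open>U\<close> in the frame \<open>e\<close> of \<open>E\<close> over \<open>U\<close>.\<close>

definition coeffs ::
  "nat \<Rightarrow> 'a fbundle \<Rightarrow> complex option set \<Rightarrow> (nat \<Rightarrow> 'a) \<Rightarrow> 'a \<Rightarrow> nat \<Rightarrow> complex \<Rightarrow> complex" where
  "coeffs n E U e s = (THE c. c \<in> {..<n} \<rightarrow>\<^sub>E carrier (mero_ring U) \<and>
     s = (\<Oplus>\<^bsub>sec E U\<^esub>i\<in>{..<n}. c i \<odot>\<^bsub>sec E U\<^esub> e i))"

abbreviation mero_frame ::
  "nat \<Rightarrow> 'a fbundle \<Rightarrow> complex option set \<Rightarrow> (nat \<Rightarrow> 'a) \<Rightarrow> bool" where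
  "mero_frame n E \<equiv> frame mero_ring n E (secs E)"

text \<open>
  A global section of the tensor square of a rank 2 bundle \<open>E\<close>, given by its coefficients
  \<open>\<tau> U e i j\<close> with respect to the local frames \<open>e i \<otimes> e j\<close>, for all frames \<open>e\<close> of \<open>E\<close> over all \<open>U\<close>.
  If \<open>e i = \<Sum>k. A k i * e' k\<close> then \<open>\<tau>' k l = \<Sum>i j. A k i * A l j * \<tau> i j\<close>.
\<close>

type_synonym 'a tensor =
  "complex option set \<Rightarrow> (nat \<Rightarrow> 'a) \<Rightarrow> nat \<Rightarrow> nat \<Rightarrow> complex \<Rightarrow> complex"

definition tensor_section :: "'a fbundle \<Rightarrow> 'a tensor \<Rightarrow> bool" where
  "tensor_section E \<tau> \<longleftrightarrow>
     (\<forall>U e. mero_frame 2 E U e \<longrightarrow> (\<forall>i<2. \<forall>j<2. \<tau> U e i j \<in> carrier (mero_ring U))) \<and>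
     (\<forall>U e V e'. mero_frame 2 E U e \<longrightarrow> mero_frame 2 E V e' \<longrightarrow> V \<subseteq> U \<longrightarrow>
        (\<forall>k<2. \<forall>l<2. \<forall>z. Some z \<in> V \<longrightarrow> \<tau> V e' k l z =
           (\<Sum>i<2. \<Sum>j<2. coeffs 2 E V e' (res E U V (e i)) k z *
                           coeffs 2 E V e' (res E U V (e j)) l z * \<tau> U e i j z)))"

text \<open>
  The germ of \<open>\<tau>\<close> at infinity lies in step \<open>\<alpha>\<close> of the filtration of the tensor square: near infinity
  \<open>\<tau>\<close> is a finite sum of tensors \<open>s l \<otimes> t l\<close> with \<open>s l\<close> in step \<open>\<beta> l\<close> and \<open>t l\<close> in step
  \<open>\<gamma> l\<close>, where \<open>\<beta> l + \<gamma> l = \<alpha>\<close>.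
\<close>

definition tensor_fil_inf :: "'a fbundle \<Rightarrow> real \<Rightarrow> 'a tensor \<Rightarrow> bool" where
  "tensor_fil_inf E \<alpha> \<tau> \<longleftrightarrow>
     (\<exists>V (m::nat) \<beta> \<gamma> s t. openin CP1 V \<and> None \<in> V \<and>
        (\<forall>l<m. \<beta> l + \<gamma> l = \<alpha> \<and> s l \<in> fil E (\<beta> l) V \<and> t l \<in> fil E (\<gamma> l) V) \<and>
        (\<forall>U e. mero_frame 2 E U e \<longrightarrow> U \<subseteq> V \<longrightarrow> (\<forall>i<2. \<forall>j<2. \<forall>z. Some z \<in> U \<longrightarrow>
           \<tau> U e i j z = (\<Sum>l<m. coeffs 2 E U e (res E V U (s l)) i z *
                                 coeffs 2 E U e (res E V U (t l)) j z))))"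

definition tensor_order_inf :: "'a fbundle \<Rightarrow> 'a tensor \<Rightarrow> ereal" where
  "tensor_order_inf E \<tau> = (INF \<alpha>\<in>{\<alpha>. tensor_fil_inf E \<alpha> \<tau>}. ereal \<alpha>)"

text \<open>
  Sections of the exterior square are the alternating tensors; the coefficient of \<open>\<omega>\<close> with respect
  to \<open>e 0 \<and> e 1\<close> is \<open>\<omega> U e 0 1\<close>.
\<close>

definition sl2_form :: "'a fbundle \<Rightarrow> 'a tensor \<Rightarrow> bool" where
  "sl2_form E \<omega> \<longleftrightarrow>
     tensor_section E \<omega> \<and>
     (\<forall>U e. mero_frame 2 E U e \<longrightarrow> (\<forall>i<2. \<forall>j<2. \<forall>z. Some z \<in> U \<longrightarrow> \<omega> U e i j z = - \<omega> U e j i z)) \<and>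
     (\<forall>U e. mero_frame 2 E U e \<longrightarrow> (\<forall>z. Some z \<in> U \<longrightarrow> \<omega> U e 0 1 z \<noteq> 0)) \<and>
     tensor_order_inf E \<omega> = 0"

definition wedge :: "'a fbundle \<Rightarrow> 'a \<Rightarrow> 'a \<Rightarrow> 'a tensor" where
  "wedge E s t = (\<lambda>U e i j z.
     coeffs 2 E U e (res E UNIV U s) i z * coeffs 2 E U e (res E UNIV U t) j z -
     coeffs 2 E U e (res E UNIV U t) i z * coeffs 2 E U e (res E UNIV U s) j z)"


section \<open>Higgs fields\<close>

text \<open>
  The form \<open>dz\<close> trivializes the sheaf of meromorphic 1-forms with poles only at infinity over the
  sheaf of meromorphic functions with poles only at infinity. Hence a meromorphic section
  \<open>\<phi>\<close> of \<open>End E \<otimes> K\<close> that is holomorphic on the affine line is \<open>\<Phi> dz\<close> for a unique endomorphism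
  \<open>\<Phi>\<close> of the sheaf of modules \<open>E\<close>. We represent \<open>\<phi>\<close> by \<open>\<Phi>\<close>.
\<close>

type_synonym 'a endo = "complex option set \<Rightarrow> 'a \<Rightarrow> 'a"

definition sl2_higgs_field :: "'a fbundle \<Rightarrow> 'a endo \<Rightarrow> bool" where
  "sl2_higgs_field E \<Phi> \<longleftrightarrow>
     (\<forall>U. openin CP1 U \<longrightarrow> linear_map (mero_ring U) (sec E U) (sec E U) (\<Phi> U)) \<and>
     (\<forall>U V. openin CP1 U \<longrightarrow> is_open U V \<longrightarrow>
        (\<forall>s\<in>secs E U. \<Phi> V (res E U V s) = res E U V (\<Phi> U s))) \<and>
     (\<forall>U e. mero_frame 2 E U e \<longrightarrow>
        (\<forall>z. Some z \<in> U \<longrightarrow> (\<Sum>i<2. coeffs 2 E U e (\<Phi> U (e i)) i z) = 0))"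


section \<open>Pullback along the ramified covering\<close>

text \<open>
  The covering \<open>x = y\<^sup>4\<close> reads \<open>z = u\<^sup>4\<close> in the affine coordinates \<open>z = 1/x\<close>, \<open>u = 1/y\<close>.
\<close>

definition \<psi> :: "complex option \<Rightarrow> complex option" where
  "\<psi> = map_option (\<lambda>u. u ^ 4)"

text \<open>
  A section \<open>\<sigma>\<close> over \<open>V\<close> of the pullback of a bundle \<open>E\<close> of rank \<open>n\<close> is given by its coefficients
  \<open>\<sigma> W e i\<close> (functions on \<open>V \<inter> \<psi> -` W\<close>) with respect to the pullbacks of all frames \<open>e\<close> of \<open>E\<close>
  over all open \<open>W\<close>.
\<close>

type_synonym 'a pull = "complex option set \<Rightarrow> (nat \<Rightarrow> 'a) \<Rightarrow> nat \<Rightarrow> complex \<Rightarrow> complex"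

definition pull_sections :: "nat \<Rightarrow> 'a fbundle \<Rightarrow> complex option set \<Rightarrow> 'a pull set" where
  "pull_sections n E V = {\<sigma>.
     (\<forall>W e i. if mero_frame n E W e \<and> i < n
              then \<sigma> W e i \<in> carrier (mero_ring (V \<inter> \<psi> -` W)) else \<sigma> W e i = (\<lambda>_. 0)) \<and>
     (\<forall>W e W' e'. mero_frame n E W e \<longrightarrow> mero_frame n E W' e' \<longrightarrow> W' \<subseteq> W \<longrightarrow>
        (\<forall>k<n. \<forall>u. Some u \<in> V \<inter> \<psi> -` W' \<longrightarrow>
           \<sigma> W' e' k u = (\<Sum>i<n. coeffs n E W' e' (res E W W' (e i)) k (u ^ 4) * \<sigma> W e i u)))}"

text \<open>The pullback, as a section over \<open>\<psi> -` W\<close>, of the section \<open>s\<close> of \<open>E\<close> over \<open>W\<close>.\<close>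

definition pull_section :: "nat \<Rightarrow> 'a fbundle \<Rightarrow> complex option set \<Rightarrow> 'a \<Rightarrow> 'a pull" where
  "pull_section n E W s = (\<lambda>W' e i u.
     if mero_frame n E W' e \<and> i < n
     then coeffs n E (W \<inter> W') (\<lambda>j. res E W' (W \<inter> W') (e j)) (res E W (W \<inter> W') s) i (u ^ 4) else 0)"

text \<open>
  Step \<open>\<alpha>\<close> of the filtration is generated near infinity by the \<open>g * \<psi>\<^sup>*t\<close>, where \<open>t\<close> is in step
  \<open>\<beta>\<close> of \<open>E\<close>, \<open>g\<close> has pole order at most \<open>k\<close> in \<open>y\<close>, and \<open>4 \<beta> + k \<le> \<alpha>\<close>.
\<close>

definition pull_fil :: "nat \<Rightarrow> 'a fbundle \<Rightarrow> real \<Rightarrow> complex option set \<Rightarrow> 'a pull set" where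
  "pull_fil n E \<alpha> V = {\<sigma> \<in> pull_sections n E V. None \<in> V \<longrightarrow>
     (\<exists>V' W (m::nat) \<beta> k g t.
        is_open V V' \<and> None \<in> V' \<and> openin CP1 W \<and> V' \<subseteq> \<psi> -` W \<and>
        (\<forall>l<m. 4 * \<beta> l + of_int (k l) \<le> \<alpha> \<and> t l \<in> fil E (\<beta> l) W \<and>
               g l \<in> carrier (mero_ring V') \<and> pole_order_le (k l) (g l)) \<and>
        (\<forall>W' e i u. Some u \<in> V' \<longrightarrow>
           \<sigma> W' e i u = (\<Sum>l<m. g l u * pull_section n E W (t l) W' e i u)))}"

definition pullback :: "nat \<Rightarrow> 'a fbundle \<Rightarrow> 'a pull fbundle" where
  "pullback n E =
     \<lparr>sec = (\<lambda>V. \<lparr>carrier = pull_sections n E V, mult = undefined, one = undefined,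
                  zero = (\<lambda>W e i u. 0),
                  add = (\<lambda>\<sigma> \<tau> W e i u. \<sigma> W e i u + \<tau> W e i u),
                  smult = (\<lambda>f \<sigma> W e i u. f u * \<sigma> W e i u)\<rparr>),
      res = (\<lambda>V V' \<sigma> W e i. restr V' (\<sigma> W e i)),
      fil = pull_fil n E\<rparr>"

definition pull_endo :: "nat \<Rightarrow> 'a fbundle \<Rightarrow> 'a endo \<Rightarrow> 'a pull \<Rightarrow> 'a pull" where
  "pull_endo n E \<Phi> \<sigma> = (\<lambda>W e i u.
     if mero_frame n E W e \<and> i < n
     then (\<Sum>j<n. coeffs n E W e (\<Phi> W (e j)) i (u ^ 4) * \<sigma> W e j u) else 0)"

text \<open>
  The pullback of \<open>\<Phi> dz\<close>, as an endomorphism times \<open>dy\<close>; here \<open>z = y\<^sup>-\<^sup>4\<close>.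
\<close>

definition pull_higgs :: "nat \<Rightarrow> 'a fbundle \<Rightarrow> 'a endo \<Rightarrow> 'a pull \<Rightarrow> 'a pull" where
  "pull_higgs n E \<Phi> \<sigma> = (\<lambda>W e i u.
     deriv (\<lambda>y. y powi (- 4)) (inverse u) * pull_endo n E \<Phi> \<sigma> W e i u)"


section \<open>The category and its moduli set\<close>

definition \<aa> :: "nat \<Rightarrow> complex \<Rightarrow> complex" where
  "\<aa> r y = 2 / 5 * (- 1) ^ r * y powi (- 10)"

text \<open>
  On the disc \<open>K\<close> is trivialized by \<open>dy\<close>, so the last condition says that
  \<open>\<phi>\<^sub>r - d\<aa>\<^sub>r\<close> maps step \<open>\<alpha>\<close> of the \<open>r\<close>-th summand to step \<open>\<alpha> + 1\<close> tensored with \<open>K\<close>.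
\<close>

definition irregular_type :: "'a fbundle \<Rightarrow> 'a endo \<Rightarrow> bool" where
  "irregular_type E \<Phi> \<longleftrightarrow>
     (\<exists>R>0. \<exists>S :: nat \<Rightarrow> complex option set \<Rightarrow> 'a pull set.
        let D = disc R; F = pullback 2 E; L = (\<lambda>r. sub_fbundle F (S r)) in
        (\<forall>r\<in>{1, 2}. filtered_bundle D 1 (L r) \<and> pole_order_filtration D 1 (L r)) \<and>
        fb_iso_map D (direct_sum (L 1) (L 2)) F (\<lambda>V (\<sigma>, \<tau>). \<sigma> \<oplus>\<^bsub>sec F V\<^esub> \<tau>) \<and>
        (\<forall>r\<in>{1, 2}. \<forall>V. is_open D V \<longrightarrow>
           pull_higgs 2 E \<Phi> \<in> secs (L r) V \<rightarrow> secs (L r) V \<and>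
           (\<forall>\<alpha>. \<forall>\<sigma>\<in>fil (L r) \<alpha> V.
              (\<lambda>W e i u. pull_higgs 2 E \<Phi> \<sigma> W e i u - deriv (\<aa> r) (inverse u) * \<sigma> W e i u)
                \<in> fil (L r) (\<alpha> + 1) V)))"

type_synonym 'a higgs_bundle = "'a fbundle \<times> 'a tensor \<times> 'a endo"

definition C23 :: "'a higgs_bundle set" where
  "C23 = {(E, \<omega>, \<Phi>). filtered_bundle UNIV 2 E \<and> sl2_form E \<omega> \<and> sl2_higgs_field E \<Phi> \<and>
                      irregular_type E \<Phi>}"

text \<open>
  Morphisms are not required to preserve the volume forms. The relation compares bundles whose
  sections have different types; the moduli set \<open>M23\<close> is formed from the bundles with sections in a
  given type. The type of the sections of \<open>big_bundle\<close> below loses nothing, since a filtered bundle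
  has at most continuum many sections.
\<close>

definition higgs_iso :: "'a higgs_bundle \<Rightarrow> 'b higgs_bundle \<Rightarrow> bool" where
  "higgs_iso = (\<lambda>(E, _, \<Phi>) (E', _, \<Phi>').
     \<exists>h. fb_iso_map UNIV E E' h \<and>
         (\<forall>U. openin CP1 U \<longrightarrow> (\<forall>s\<in>secs E U. h U (\<Phi> U s) = \<Phi>' U (h U s))))"

definition iso_rel :: "('a higgs_bundle \<times> 'a higgs_bundle) set" where
  "iso_rel = {(X, Y). X \<in> C23 \<and> Y \<in> C23 \<and> higgs_iso X Y}"

definition M23 :: "'a higgs_bundle set set" where
  "M23 = C23 // iso_rel"

definition big_bundle :: "((complex \<Rightarrow> complex) \<times> (complex \<Rightarrow> complex)) fbundle" where
  "big_bundle = direct_sum (line_bundle (1 / 4)) (line_bundle (- 1 / 4))"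

definition M23_big :: "'a higgs_bundle set set" where
  "M23_big = {c \<in> M23. \<exists>E \<omega> \<Phi>. (E, \<omega>, \<Phi>) \<in> c \<and> fb_iso UNIV E big_bundle}"

text \<open>
  The quotient \<open>(z\<^sup>3 - w\<^sup>3) / (z - w)\<close> is a quotient of polynomials in \<open>z\<close>, hence also defined at \<open>z = w\<close>.
\<close>

definition rep_higgs ::
  "complex \<Rightarrow> complex \<Rightarrow> ((complex \<Rightarrow> complex) \<times> (complex \<Rightarrow> complex)) endo" where
  "rep_higgs w \<gamma> = (\<lambda>U (s, t).
     (\<lambda>z. \<gamma> * s z + poly ((monom 1 3 - [:w ^ 3:]) div [:- w, 1:]) z * t z,
      \<lambda>z. (z - w) * s z - \<gamma> * t z))"

definition rep ::
  "complex \<Rightarrow> complex \<Rightarrow> ((complex \<Rightarrow> complex) \<times> (complex \<Rightarrow> complex)) higgs_bundle" where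
  "rep w \<gamma> = (big_bundle, wedge big_bundle (\<lambda>_. 1, \<lambda>_. 0) (\<lambda>_. 0, \<lambda>_. 1), rep_higgs w \<gamma>)"

end

theory Submission
  imports Defs
begin

text \<open>
  The canonical sections \<open>e\<^sub>0\<close>, \<open>e\<^sub>1\<close> turn a Higgs field on \<open>\<O>(1/4) \<oplus> \<O>(-1/4)\<close> into a traceless
  matrix with rows \<open>(a, b)\<close> and \<open>(c, -a)\<close> of polynomials in \<open>z\<close>. Two questions remain: which
  matrices have the prescribed irregular type, and which of them are conjugate under automorphisms.

  \<^emph>\<open>The irregular type.\<close> The sections \<open>e\<^sub>0\<close>, \<open>e\<^sub>1\<close> have orders \<open>-1/4\<close> and \<open>1/4\<close>, hence orders \<open>-1\<close> and
  \<open>1\<close> after the pullback: \<open>f\<^sub>0 e\<^sub>0 + f\<^sub>1 e\<^sub>1\<close> lies in step \<open>\<alpha>\<close> iff \<open>f\<^sub>0\<close> and \<open>f\<^sub>1\<close> have pole orders at most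
  \<open>\<lfloor>\<alpha>\<rfloor> + 1\<close> and \<open>\<lfloor>\<alpha>\<rfloor> - 1\<close> (\<open>pull_fil_iff\<close>). Since \<open>dz = -4 u\<^sup>5 dy\<close> for \<open>u = 1/y\<close>, the condition on
  \<open>\<phi>\<^sub>r - d\<aa>\<^sub>r\<close> says that the matrix at \<open>z = u\<^sup>4\<close> has an eigenvalue \<open>\<mu>\<^sub>r = (-1)\<^sup>r u\<^sup>6 + O(u\<^sup>-\<^sup>4)\<close> on the
  \<open>r\<close>-th summand (\<open>eigenvalue_at_infinity\<close>). The product of the two eigenvalues is the determinant, so
  \<open>a\<^sup>2 + b c = z\<^sup>3 + O(z\<^sup>1\<^sup>/\<^sup>2)\<close>; being a polynomial, this is \<open>z\<^sup>3\<close> plus a constant. Moreover, the splitting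
  of \<open>e\<^sub>0\<close> and \<open>e\<^sub>1\<close> into eigenvectors respects the filtration, which bounds the degrees of \<open>a\<close>, \<open>b\<close>, \<open>c\<close>
  by \<open>1\<close>, \<open>2\<close>, \<open>1\<close> (\<open>big_higgs_matrix\<close>). Conversely, if \<open>a\<^sup>2 + b c = z\<^sup>3 + C\<close>, then the eigenvalues are
  \<open>\<plusminus> u\<^sup>6 (1 + C/u\<^sup>1\<^sup>2)\<^sup>1\<^sup>/\<^sup>2\<close> for large \<open>u\<close>, and for the matrices of the family suitably scaled
  eigenvectors generate the two summands (\<open>irregular_type_rep\<close>, by way of \<open>irregular_typeI\<close>).

  \<^emph>\<open>Conjugation.\<close> The two orders differ by less than \<open>1\<close>, so an automorphism is an upper triangular
  matrix with constant entries. The cubic term of \<open>a\<^sup>2 + b c\<close> forces \<open>c\<close> to have degree exactly \<open>1\<close>. A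
  diagonal matrix makes \<open>c = z - w\<close>, a unipotent one makes \<open>a\<close> a constant \<open>\<gamma>\<close>, and then
  \<open>\<gamma>\<^sup>2 + b (z - w) = z\<^sup>3 + C\<close> leaves only \<open>b = (z\<^sup>3 - w\<^sup>3) / (z - w)\<close> (\<open>normal_form_polynomials\<close>). Among
  matrices of this shape only scalars are left as conjugating automorphisms, so \<open>w\<close> and \<open>\<gamma>\<close> are
  determined (\<open>higgs_iso_rep_unique\<close>).

  \<^emph>\<open>Sheaves and frames.\<close> Tensors, pullbacks and traces are given by coefficients in all local frames.
  An isomorphism to the big bundle supplies global coordinates, and Cramer's rule expresses all
  coefficients through them (\<open>coeffs_cramer\<close>), so that the compatibility conditions become identities
  for two-by-two matrices. The sheaf axioms for the eigenlines inside the pullback are not checked by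
  hand but transported from the line bundle \<open>\<O>(0)\<close> (locale \<open>bundle_iso\<close>).
\<close>

section \<open>Functions near infinity on the projective line\<close>

text \<open>
  A set containing infinity is open iff its complement is closed and bounded. Boundedness is
  expressed by the filter at infinity, because pole orders are computed with respect to that filter.
\<close>

lemma openin_CP1_iff:
  "openin CP1 U \<longleftrightarrow> open {z. Some z \<in> U} \<and> (None \<in> U \<longrightarrow> (\<forall>\<^sub>F z in at_infinity. Some z \<in> U))"
proof -
  have img: "(\<exists>V. open V \<and> U = Some ` V) \<longleftrightarrow> None \<notin> U \<and> open {z. Some z \<in> U}"
  proof (safe)
    fix V :: "complex set" assume "open V"
    moreover have "{z. Some z \<in> Some ` V} = V" by auto
    ultimately show "open {z. Some z \<in> Some ` V}" by simp
  next
    assume "None \<notin> U" "open {z. Some z \<in> U}"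
    moreover have "U = Some ` {z. Some z \<in> U}"
      using \<open>None \<notin> U\<close> by (auto simp: image_iff) (metis option.exhaust)
    ultimately show "\<exists>V. open V \<and> U = Some ` V" by blast
  qed 
  have inf: "(\<exists>C. compact C \<and> closed C \<and> U = insert None (Some ` (UNIV - C))) \<longleftrightarrow>
     None \<in> U \<and> open {z. Some z \<in> U} \<and> (\<forall>\<^sub>F z in at_infinity. Some z \<in> U)" (is "?A \<longleftrightarrow> ?B")
  proof
    assume ?A
    then obtain C where C: "compact C" "closed C" "U = insert None (Some ` (UNIV - C))" by blast
    have eq: "{z. Some z \<in> U} = - C" using C by auto
    obtain B where B: "\<And>x. x \<in> C \<Longrightarrow> norm x \<le> B"
      using C(1) compact_imp_bounded bounded_iff by metis
    have "\<forall>\<^sub>F z in at_infinity. Some z \<in> U"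
      unfolding eventually_at_infinity
    proof (intro exI[of _ "B + 1"] allI impI)
      fix z :: complex assume "B + 1 \<le> norm z"
      then have "z \<notin> C" using B[of z] by auto
      then show "Some z \<in> U" using C by auto
    qed
    then show ?B using C eq by (auto simp: open_Compl)
  next
    assume b: ?B
    then obtain B where B: "\<And>z. B \<le> norm z \<Longrightarrow> Some z \<in> U"
      by (auto simp: eventually_at_infinity)
    define C where "C = - {z. Some z \<in> U}"
    have "closed C" using b C_def by auto
    moreover have "bounded C"
      unfolding bounded_iff using B by (intro exI[of _ B]) (force simp: C_def)
    ultimately have "compact C" by (simp add: compact_eq_bounded_closed)
    moreover have "U = insert None (Some ` (UNIV - C))"
    proof (rule Set.set_eqI)
      fix x show "x \<in> U \<longleftrightarrow> x \<in> insert None (Some ` (UNIV - C))"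
        using b by (cases x) (auto simp: C_def)
    qed
    ultimately show ?A using \<open>closed C\<close> by blast
  qed
  show ?thesis
    unfolding openin_Alexandroff_compactification
    using img inf by (auto simp: compactin_euclidean_iff)
qed

lemma open_affine_part: "openin CP1 U \<Longrightarrow> open {z. Some z \<in> U}"
  and eventually_in_nhd_infinity: "openin CP1 U \<Longrightarrow> None \<in> U \<Longrightarrow> \<forall>\<^sub>F z in at_infinity. Some z \<in> U"
  by (auto simp: openin_CP1_iff)

lemma open_disc: "openin CP1 (disc R)"
proof -
  have "{z. Some z \<in> disc R} = - cball 0 R" by (auto simp: disc_def)
  then show ?thesis
    by (auto simp: openin_CP1_iff disc_def eventually_at_infinity intro!: exI[of _ "R + 1"])
qed

lemma open_UNIV_CP1: "openin CP1 UNIV"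
  by (simp add: openin_CP1_iff)

lemma pole_order_le_at_infinity:
  "pole_order_le n f \<longleftrightarrow>
     (\<exists>g. g analytic_on {0} \<and> (\<forall>\<^sub>F z in at_infinity. f z = g (inverse z) * z powi n))"
proof -
  have "(\<forall>\<^sub>F x in at 0. f (inverse x) = g x * x powi (- n)) \<longleftrightarrow>
        (\<forall>\<^sub>F z in at_infinity. f z = g (inverse z) * z powi n)" for g
    by (simp add: at_to_infinity eventually_filtermap power_int_inverse power_int_minus)
  then show ?thesis by (simp add: pole_order_le_def)
qed

lemma pole_order_leI:
  assumes "g analytic_on {0}" "\<forall>\<^sub>F z in at_infinity. f z = g (inverse z) * z powi n"
  shows "pole_order_le n f"
  using assms by (auto simp: pole_order_le_at_infinity)

lemma eventually_nonzero_at_infinity: "\<forall>\<^sub>F z :: complex in at_infinity. z \<noteq> 0"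
  unfolding eventually_at_infinity by (intro exI[of _ 1]) auto

lemma pole_order_le_cong:
  assumes "\<forall>\<^sub>F z in at_infinity. f z = g z"
  shows "pole_order_le n f \<longleftrightarrow> pole_order_le n g"
proof -
  have "pole_order_le n f" if "pole_order_le n g" "\<forall>\<^sub>F z in at_infinity. f z = g z" for f g
  proof -
    from that(1) obtain h where h: "h analytic_on {0}" "\<forall>\<^sub>F z in at_infinity. g z = h (inverse z) * z powi n"
      by (auto simp: pole_order_le_at_infinity)
    show ?thesis
      by (rule pole_order_leI[OF h(1)]) (use that(2) h(2) in eventually_elim, simp)
  qed
  from this[of f g] this[of g f] show ?thesis using assms by (auto simp: eq_commute)
qed

lemma pole_order_le_mono:
  assumes "pole_order_le m f" "m \<le> n"
  shows "pole_order_le n f"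
proof -
  from assms(1) obtain g where g: "g analytic_on {0}" "\<forall>\<^sub>F z in at_infinity. f z = g (inverse z) * z powi m"
    by (auto simp: pole_order_le_at_infinity)
  show ?thesis
  proof (rule pole_order_leI)
    show "(\<lambda>x. g x * x ^ nat (n - m)) analytic_on {0}" by (intro analytic_intros g)
    show "\<forall>\<^sub>F z in at_infinity. f z = (g (inverse z) * inverse z ^ nat (n - m)) * z powi n"
      using g(2) eventually_nonzero_at_infinity
    proof eventually_elim
      case (elim z)
      have "inverse z ^ nat (n - m) = z powi (m - n)"
        using assms(2) by (simp add: power_int_def)
      also have "\<dots> = z powi m / z powi n" using elim by (simp add: power_int_diff)
      finally show ?case using elim by simp
    qed
  qed
qed

lemma pole_order_le_add:
  assumes "pole_order_le n f" "pole_order_le n g"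
  shows "pole_order_le n (\<lambda>z. f z + g z)"
proof -
  obtain a where a: "a analytic_on {0}" "\<forall>\<^sub>F z in at_infinity. f z = a (inverse z) * z powi n"
    using assms by (auto simp: pole_order_le_at_infinity)
  obtain b where b: "b analytic_on {0}" "\<forall>\<^sub>F z in at_infinity. g z = b (inverse z) * z powi n"
    using assms by (auto simp: pole_order_le_at_infinity)
  show ?thesis
    by (rule pole_order_leI[of "\<lambda>x. a x + b x"], intro analytic_intros a b,
        use a(2) b(2) in eventually_elim) (simp add: algebra_simps)
qed

lemma pole_order_le_mult:
  assumes "pole_order_le m f" "pole_order_le n g"
  shows "pole_order_le (m + n) (\<lambda>z. f z * g z)"
proof -
  obtain a where a: "a analytic_on {0}" "\<forall>\<^sub>F z in at_infinity. f z = a (inverse z) * z powi m"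
    using assms by (auto simp: pole_order_le_at_infinity)
  obtain b where b: "b analytic_on {0}" "\<forall>\<^sub>F z in at_infinity. g z = b (inverse z) * z powi n"
    using assms by (auto simp: pole_order_le_at_infinity)
  show ?thesis
    by (rule pole_order_leI[of "\<lambda>x. a x * b x"], intro analytic_intros a b,
        use a(2) b(2) eventually_nonzero_at_infinity in eventually_elim)
       (simp add: algebra_simps power_int_add)
qed

lemma pole_order_le_mult':
  assumes "pole_order_le m f" "pole_order_le n g" "m + n \<le> k"
  shows "pole_order_le k (\<lambda>z. f z * g z)"
  using pole_order_le_mult[OF assms(1,2)] assms(3) pole_order_le_mono by blast

lemma pole_order_le_inverse_argument:
  assumes "g analytic_on {0}"
  shows "pole_order_le 0 (\<lambda>z. g (inverse z))"
  by (rule pole_order_leI[OF assms]) simp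

lemma pole_order_le_powi: "pole_order_le n (\<lambda>z. z powi n)"
  by (rule pole_order_leI[of "\<lambda>_. 1"]) auto

lemma pole_order_le_zero: "pole_order_le n (\<lambda>_. 0)"
  by (rule pole_order_leI[of "\<lambda>_. 0"]) auto

lemma pole_order_le_const: "0 \<le> n \<Longrightarrow> pole_order_le n (\<lambda>_. c)"
  by (rule pole_order_le_mono[of 0], rule pole_order_leI[of "\<lambda>_. c"]) auto

lemma pole_order_le_cmult: "pole_order_le n f \<Longrightarrow> pole_order_le n (\<lambda>z. c * f z)"
  by (rule pole_order_le_mult'[OF pole_order_le_const[of 0]]) auto

lemma pole_order_le_uminus: "pole_order_le n f \<Longrightarrow> pole_order_le n (\<lambda>z. - f z)"
  using pole_order_le_cmult[of n f "-1"] by simp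

lemma pole_order_le_diff:
  "pole_order_le n f \<Longrightarrow> pole_order_le n g \<Longrightarrow> pole_order_le n (\<lambda>z. f z - g z)"
  using pole_order_le_add[OF _ pole_order_le_uminus, of n f g] by simp

lemma pole_order_le_sum:
  "(\<And>i. i \<in> I \<Longrightarrow> pole_order_le n (f i)) \<Longrightarrow> pole_order_le n (\<lambda>z. \<Sum>i\<in>I. f i z)"
  by (induction I rule: infinite_finite_induct) (auto simp: pole_order_le_zero intro: pole_order_le_add)

lemma pole_order_le_power: "pole_order_le (int n) (\<lambda>z. z ^ n)"
  using pole_order_le_powi[of "int n"] by simp

lemma pole_order_le_power': "int n \<le> m \<Longrightarrow> pole_order_le m (\<lambda>z. z ^ n)"
  using pole_order_le_power pole_order_le_mono by blast

lemma pole_order_le_inverse: "pole_order_le (- 1) inverse"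
  using pole_order_le_powi[of "- 1"] by (simp add: power_int_minus)

lemma filterlim_power4_at_infinity: "filterlim (\<lambda>u :: complex. u ^ 4) at_infinity at_infinity"
  by (rule filterlim_power_at_infinity) (auto intro: filterlim_ident)

lemma pole_order_le_power4:
  assumes "pole_order_le n f"
  shows "pole_order_le (4 * n) (\<lambda>u. f (u ^ 4))"
proof -
  obtain g where g: "g analytic_on {0}" "\<forall>\<^sub>F z in at_infinity. f z = g (inverse z) * z powi n"
    using assms by (auto simp: pole_order_le_at_infinity)
  show ?thesis
  proof (rule pole_order_leI)
    have "(g \<circ> (\<lambda>x. x ^ 4)) analytic_on {0}"
      by (rule analytic_on_compose) (auto intro!: analytic_intros g)
    then show "(\<lambda>x. g (x ^ 4)) analytic_on {0}" by (simp add: o_def)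
    show "\<forall>\<^sub>F u in at_infinity. f (u ^ 4) = g (inverse u ^ 4) * u powi (4 * n)"
      using eventually_compose_filterlim[OF g(2) filterlim_power4_at_infinity]
      by eventually_elim (simp add: power_inverse power_int_mult)
  qed
qed

lemma pole_order_le_negative_tendsto:
  assumes "pole_order_le n f" "n < 0"
  shows "(f \<longlongrightarrow> 0) at_infinity"
proof -
  obtain g where g: "g analytic_on {0}" "\<forall>\<^sub>F z in at_infinity. f z = g (inverse z) * z powi (-1)"
    using pole_order_le_mono[OF assms(1), of "-1"] assms(2) by (auto simp: pole_order_le_at_infinity)
  have "isCont g 0" using g(1) analytic_at_imp_isCont by blast
  then have "((\<lambda>z. g (inverse z)) \<longlongrightarrow> g 0) at_infinity"
    using tendsto_inverse_0 isCont_tendsto_compose by blast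
  then have "((\<lambda>z. g (inverse z) * inverse z) \<longlongrightarrow> g 0 * 0) at_infinity"
    by (intro tendsto_mult tendsto_inverse_0)
  then show ?thesis
    using filterlim_cong[OF refl refl g(2), of "nhds 0"] by (simp add: power_int_minus)
qed

text \<open>
  The leading power of the Laurent expansion splits off, and the remaining factor is analytic. From
  here on, sections near infinity are handled through explicit pole orders.
\<close>

lemma meromorphic_at_infinity_iff:
  "(\<lambda>x. f (inverse x)) meromorphic_on {0} \<longleftrightarrow> (\<exists>n. pole_order_le n f)"
proof
  assume "(\<lambda>x. f (inverse x)) meromorphic_on {0}"
  then obtain F where F: "(\<lambda>x. f (inverse x)) has_laurent_expansion F"
    by (auto simp: meromorphic_on_def)
  define P where "P = fls_base_factor_to_fps F"
  have conv: "fps_conv_radius P > 0"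
    using F by (simp add: has_laurent_expansion_def fls_conv_radius_altdef P_def)
  have "\<forall>\<^sub>F x in at 0. eval_fls F x = f (inverse x)"
    using F by (simp add: has_laurent_expansion_def)
  then have "\<forall>\<^sub>F x in at 0. f (inverse x) = eval_fps P x * x powi (- (- fls_subdegree F))"
    by eventually_elim (simp add: eval_fls_def P_def)
  moreover have "eval_fps P analytic_on {0}"
    using conv by (intro analytic_on_eval_fps) (auto simp: zero_ereal_def)
  ultimately show "\<exists>n. pole_order_le n f" unfolding pole_order_le_def by blast
next
  assume "\<exists>n. pole_order_le n f"
  then obtain n g where g: "g analytic_on {0}" "\<forall>\<^sub>F x in at 0. f (inverse x) = g x * x powi (- n)"
    unfolding pole_order_le_def by blast
  have "(\<lambda>x. g x * x powi (- n)) meromorphic_on {0}"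
    by (intro meromorphic_intros analytic_on_imp_meromorphic_on g)
  then show "(\<lambda>x. f (inverse x)) meromorphic_on {0}"
    using meromorphic_on_cong[of "{0}" "\<lambda>x. f (inverse x)" "\<lambda>x. g x * x powi (- n)" "{0}"] g(2) by auto
qed

text \<open>
  Liouville's theorem for functions of polynomial growth.
\<close>

lemma entire_pole_order_polynomial:
  assumes "f holomorphic_on UNIV" "pole_order_le (int n) f"
  shows "\<exists>p. degree p \<le> n \<and> f = poly p"
proof -
  obtain g where g: "g analytic_on {0}" "\<forall>\<^sub>F z in at_infinity. f z = g (inverse z) * z powi int n"
    using assms(2) by (auto simp: pole_order_le_at_infinity)
  have "isCont g 0" using g(1) analytic_at_imp_isCont by blast
  then have "((\<lambda>z. g (inverse z)) \<longlongrightarrow> g 0) at_infinity"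
    using tendsto_inverse_0 isCont_tendsto_compose by blast
  then have "\<forall>\<^sub>F z in at_infinity. dist (g (inverse z)) (g 0) < 1"
    using tendstoD zero_less_one by blast
  then have "\<forall>\<^sub>F z in at_infinity. norm (f z) \<le> (norm (g 0) + 1) * norm z ^ n"
    using g(2)
  proof eventually_elim
    case (elim z)
    have "norm (g (inverse z)) \<le> norm (g 0) + dist (g (inverse z)) (g 0)"
      by (metis add.commute dist_norm norm_triangle_sub)
    then have "norm (g (inverse z)) \<le> norm (g 0) + 1" using elim(1) by linarith
    then show ?case by (simp add: elim(2) norm_mult norm_power mult_right_mono)
  qed
  then obtain A where A: "\<And>z. A \<le> norm z \<Longrightarrow> norm (f z) \<le> (norm (g 0) + 1) * norm z ^ n"
    by (auto simp: eventually_at_infinity)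
  define p where "p = (\<Sum>k\<le>n. monom ((deriv ^^ k) f 0 / fact k) k)"
  have "f z = poly p z" for z
    using Liouville_polynomial[OF assms(1) A] by (simp add: p_def poly_sum poly_monom)
  moreover have "degree p \<le> n"
    unfolding p_def by (intro degree_sum_le) (auto intro: order_trans[OF degree_monom_le])
  ultimately show ?thesis by blast
qed

text \<open>
  As a polynomial in \<open>u\<close>, \<open>p (u ^ 4)\<close> has degree \<open>4 * degree p\<close>. In this way a bound by a fractional
  power of \<open>z\<close> still bounds the degree by the integer part of the exponent.
\<close>

lemma degree_le_from_power4:
  fixes p :: "complex poly"
  assumes "pole_order_le (int n) (\<lambda>u. poly p (u ^ 4))"
  shows "4 * degree p \<le> n"
proof -
  have "(\<lambda>u. poly p (u ^ 4)) holomorphic_on UNIV" by (intro holomorphic_intros)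
  then obtain q where q: "degree q \<le> n" "(\<lambda>u. poly p (u ^ 4)) = poly q"
    using entire_pole_order_polynomial[OF _ assms] by blast
  have "pcompose p (monom 1 4) = q"
    using q(2) by (auto simp flip: poly_eq_poly_eq_iff simp: poly_pcompose poly_monom fun_eq_iff)
  then have "degree q = degree p * 4"
    by (metis degree_monom_eq degree_pcompose zero_neq_one)
  then show ?thesis using q(1) by simp
qed


section \<open>Structure sheaves and filtered line bundles\<close>

lemma mero_ring_simps [simp]:
  "f \<otimes>\<^bsub>mero_ring U\<^esub> g = (\<lambda>z. f z * g z)" "\<one>\<^bsub>mero_ring U\<^esub> = restr U (\<lambda>_. 1)"
  "\<zero>\<^bsub>mero_ring U\<^esub> = (\<lambda>_. 0)" "f \<oplus>\<^bsub>mero_ring U\<^esub> g = (\<lambda>z. f z + g z)"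
  by (simp_all add: mero_ring_def)

lemma mero_ring_iff:
  "f \<in> carrier (mero_ring U) \<longleftrightarrow> f holomorphic_on {z. Some z \<in> U} \<and> (\<forall>z. Some z \<notin> U \<longrightarrow> f z = 0) \<and>
     (None \<in> U \<longrightarrow> (\<exists>n. pole_order_le n f))"
  by (simp add: mero_ring_def meromorphic_at_infinity_iff)

lemma hol_ring_iff:
  "f \<in> carrier (hol_ring U) \<longleftrightarrow> f \<in> carrier (mero_ring U) \<and> (None \<in> U \<longrightarrow> pole_order_le 0 f)"
  by (simp add: hol_ring_def)

lemma mero_ring_outside: "f \<in> carrier (mero_ring U) \<Longrightarrow> Some z \<notin> U \<Longrightarrow> f z = 0"
  by (simp add: mero_ring_iff)

lemma mero_ring_pole_order: "f \<in> carrier (mero_ring U) \<Longrightarrow> None \<in> U \<Longrightarrow> \<exists>n. pole_order_le n f"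
  by (simp add: mero_ring_iff)

lemma mero_ring_zero: "(\<lambda>_. 0) \<in> carrier (mero_ring U)"
  by (auto simp: mero_ring_iff intro: pole_order_le_zero)

lemma mero_ring_add:
  assumes "f \<in> carrier (mero_ring U)" "g \<in> carrier (mero_ring U)"
  shows "(\<lambda>z. f z + g z) \<in> carrier (mero_ring U)"
proof -
  have "\<exists>n. pole_order_le n (\<lambda>z. f z + g z)" if "None \<in> U"
  proof -
    obtain m n where "pole_order_le m f" "pole_order_le n g"
      using mero_ring_pole_order[OF assms(1) \<open>None \<in> U\<close>] mero_ring_pole_order[OF assms(2) \<open>None \<in> U\<close>] by blast
    then have "pole_order_le (max m n) (\<lambda>z. f z + g z)"
      by (intro pole_order_le_add) (auto elim: pole_order_le_mono)
    then show ?thesis ..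
  qed
  then show ?thesis using assms by (auto simp: mero_ring_iff intro!: holomorphic_intros)
qed

lemma mero_ring_mult:
  assumes "f \<in> carrier (mero_ring U)" "g \<in> carrier (mero_ring U)"
  shows "(\<lambda>z. f z * g z) \<in> carrier (mero_ring U)"
  using assms by (auto simp: mero_ring_iff intro!: holomorphic_intros dest: pole_order_le_mult)

lemma mero_ring_cmult:
  assumes "f \<in> carrier (mero_ring U)"
  shows "(\<lambda>z. c * f z) \<in> carrier (mero_ring U)"
  using assms by (auto simp: mero_ring_iff intro!: holomorphic_intros dest: pole_order_le_cmult)

lemma mero_ring_uminus:
  "f \<in> carrier (mero_ring U) \<Longrightarrow> (\<lambda>z. - f z) \<in> carrier (mero_ring U)"
  using mero_ring_cmult[of f U "-1"] by simp

lemma mero_ring_diff: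
  "f \<in> carrier (mero_ring U) \<Longrightarrow> g \<in> carrier (mero_ring U) \<Longrightarrow> (\<lambda>z. f z - g z) \<in> carrier (mero_ring U)"
  using mero_ring_add[OF _ mero_ring_uminus, of f U g] by simp

lemma restr_restr: "V \<subseteq> U \<Longrightarrow> restr V (restr U f) = restr V f"
  by (auto simp: restr_def fun_eq_iff)

lemma restr_same: "f \<in> carrier (mero_ring U) \<Longrightarrow> restr U f = f"
  by (auto simp: restr_def mero_ring_iff)

lemma restr_apply: "restr V f z = (if Some z \<in> V then f z else 0)"
  by (simp add: restr_def)

lemma restr_mult: "restr V (\<lambda>z. f z * g z) = (\<lambda>z. restr V f z * restr V g z)"
  and restr_add: "restr V (\<lambda>z. f z + g z) = (\<lambda>z. restr V f z + restr V g z)"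
  and restr_zero: "restr V (\<lambda>_. 0) = (\<lambda>_. 0)"
  by (auto simp: restr_def)

lemma pole_order_le_restr:
  assumes "openin CP1 V" "None \<in> V"
  shows "pole_order_le n (restr V f) \<longleftrightarrow> pole_order_le n f"
  by (rule pole_order_le_cong, use eventually_in_nhd_infinity[OF assms] in eventually_elim)
     (simp add: restr_def)

lemma holomorphic_on_restr:
  "restr V f holomorphic_on A \<longleftrightarrow> f holomorphic_on A" if "A \<subseteq> {z. Some z \<in> V}"
  by (rule holomorphic_cong) (use that in \<open>auto simp: restr_def\<close>)

lemma restr_mero_ring:
  assumes "openin CP1 V" "f holomorphic_on {z. Some z \<in> V}" "None \<in> V \<Longrightarrow> \<exists>n. pole_order_le n f"
  shows "restr V f \<in> carrier (mero_ring V)"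
  using assms by (auto simp: mero_ring_iff holomorphic_on_restr pole_order_le_restr) (auto simp: restr_def)

lemma restr_closed:
  assumes "f \<in> carrier (mero_ring U)" "is_open U V"
  shows "restr V f \<in> carrier (mero_ring V)"
  by (rule restr_mero_ring) (use assms in \<open>auto simp: mero_ring_iff elim: holomorphic_on_subset\<close>)

lemma restr_one_closed: "openin CP1 V \<Longrightarrow> restr V (\<lambda>_. c) \<in> carrier (mero_ring V)"
  by (rule restr_mero_ring) (auto intro: pole_order_le_const exI[of _ 0])

lemma cring_mero_ring: assumes "openin CP1 U" shows "cring (mero_ring U)"
proof (rule cringI)
  show "abelian_group (mero_ring U)"
  proof (rule abelian_groupI)
    fix f assume "f \<in> carrier (mero_ring U)"
    then show "\<exists>g\<in>carrier (mero_ring U). g \<oplus>\<^bsub>mero_ring U\<^esub> f = \<zero>\<^bsub>mero_ring U\<^esub>"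
      by (intro bexI[of _ "\<lambda>z. - f z"]) (auto intro: mero_ring_uminus)
  qed (auto simp: add_ac intro: mero_ring_add mero_ring_zero)
  show "Group.comm_monoid (mero_ring U)"
  proof (rule comm_monoidI)
    fix f assume f: "f \<in> carrier (mero_ring U)"
    show "\<one>\<^bsub>mero_ring U\<^esub> \<otimes>\<^bsub>mero_ring U\<^esub> f = f"
      using mero_ring_outside[OF f] by (auto simp: restr_def)
  qed (auto simp: mult_ac intro: mero_ring_mult restr_one_closed assms)
qed (auto simp: algebra_simps)

lemma line_bundle_simps [simp]:
  "secs (line_bundle a) U = carrier (mero_ring U)"
  "s \<oplus>\<^bsub>sec (line_bundle a) U\<^esub> t = (\<lambda>z. s z + t z)"
  "f \<odot>\<^bsub>sec (line_bundle a) U\<^esub> t = (\<lambda>z. f z * t z)"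
  "\<zero>\<^bsub>sec (line_bundle a) U\<^esub> = (\<lambda>_. 0)"
  "res (line_bundle a) U V = restr V"
  "fil (line_bundle a) \<beta> U = {f \<in> carrier (mero_ring U). None \<in> U \<longrightarrow> pole_order_le \<lfloor>\<beta> + a\<rfloor> f}"
  by (simp_all add: line_bundle_def ring.defs module.defs mero_ring_def)

lemma module_line_bundle:
  assumes "openin CP1 U" shows "Module.module (mero_ring U) (sec (line_bundle a) U)"
proof (rule moduleI)
  show "abelian_group (sec (line_bundle a) U)"
  proof (rule abelian_groupI)
    fix f assume "f \<in> secs (line_bundle a) U"
    then show "\<exists>g\<in>secs (line_bundle a) U. g \<oplus>\<^bsub>sec (line_bundle a) U\<^esub> f = \<zero>\<^bsub>sec (line_bundle a) U\<^esub>"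
      by (intro bexI[of _ "\<lambda>z. - f z"]) (auto intro: mero_ring_uminus)
  qed (auto simp: add_ac intro: mero_ring_add mero_ring_zero)
  fix f assume f: "f \<in> secs (line_bundle a) U"
  show "\<one>\<^bsub>mero_ring U\<^esub> \<odot>\<^bsub>sec (line_bundle a) U\<^esub> f = f"
    using mero_ring_outside[of f U] f by (auto simp: restr_def)
qed (auto simp: algebra_simps intro: mero_ring_mult cring_mero_ring assms)

text \<open>
  Near every point, infinity included, the glued function agrees with one of the given functions.
\<close>

lemma mero_ring_glue:
  assumes U: "\<And>U. U \<in> \<U> \<Longrightarrow> openin CP1 U" and s: "\<And>U. U \<in> \<U> \<Longrightarrow> s U \<in> carrier (mero_ring U)"
    and eq: "\<And>U V. U \<in> \<U> \<Longrightarrow> V \<in> \<U> \<Longrightarrow> restr (U \<inter> V) (s U) = restr (U \<inter> V) (s V)"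
  shows "\<exists>!t. t \<in> carrier (mero_ring (\<Union>\<U>)) \<and> (\<forall>U\<in>\<U>. restr U t = s U)"
proof -
  define t where "t z = (if \<exists>U\<in>\<U>. Some z \<in> U then s (SOME U. U \<in> \<U> \<and> Some z \<in> U) z else 0)" for z
  have t: "t z = s U z" if "U \<in> \<U>" "Some z \<in> U" for U z
  proof -
    define V where "V = (SOME U. U \<in> \<U> \<and> Some z \<in> U)"
    have V: "V \<in> \<U>" "Some z \<in> V"
      using someI[of "\<lambda>U. U \<in> \<U> \<and> Some z \<in> U" U] that by (auto simp: V_def)
    have "t z = s V z" using that by (auto simp: t_def V_def)
    also have "\<dots> = s U z"
      using fun_cong[OF eq[OF that(1) V(1)], of z] that V by (simp add: restr_def)
    finally show ?thesis .
  qed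
  have res: "restr U t = s U" if "U \<in> \<U>" for U
    using t[OF that] mero_ring_outside[OF s[OF that]] by (auto simp: restr_def)
  have "t \<in> carrier (mero_ring (\<Union>\<U>))"
    unfolding mero_ring_iff
  proof (intro conjI allI impI)
    have "t holomorphic_on (\<Union>U\<in>\<U>. {z. Some z \<in> U})"
    proof (rule holomorphic_on_UN_open)
      fix U assume u: "U \<in> \<U>"
      have "s U holomorphic_on {z. Some z \<in> U}" using s[OF u] by (simp add: mero_ring_iff)
      then show "t holomorphic_on {z. Some z \<in> U}"
        by (rule holomorphic_transform) (use t[OF u] in auto)
    qed (use U open_affine_part in auto)
    moreover have "(\<Union>U\<in>\<U>. {z. Some z \<in> U}) = {z. Some z \<in> \<Union>\<U>}" by auto
    ultimately show "t holomorphic_on {z. Some z \<in> \<Union>\<U>}" by simp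
    show "t z = 0" if "Some z \<notin> \<Union>\<U>" for z using that by (auto simp: t_def)
    assume "None \<in> \<Union>\<U>"
    then obtain V where V: "V \<in> \<U>" "None \<in> V" by blast
    obtain n where "pole_order_le n (s V)" using s[OF V(1)] V(2) by (auto simp: mero_ring_iff)
    then have "pole_order_le n (restr V t)" using res[OF V(1)] by simp
    then show "\<exists>n. pole_order_le n t" using pole_order_le_restr[OF U[OF V(1)] V(2)] by blast
  qed
  moreover have "t' = t''" if "t' \<in> carrier (mero_ring (\<Union>\<U>))" "\<forall>U\<in>\<U>. restr U t' = s U"
     "t'' \<in> carrier (mero_ring (\<Union>\<U>))" "\<forall>U\<in>\<U>. restr U t'' = s U" for t' t''
  proof
    fix z show "t' z = t'' z"
    proof (cases "Some z \<in> \<Union>\<U>")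
      case True
      then obtain U where "U \<in> \<U>" "Some z \<in> U" by blast
      moreover have "restr U t' z = restr U t'' z" using that \<open>U \<in> \<U>\<close> by simp
      ultimately show ?thesis by (simp add: restr_def)
    qed (use that in \<open>simp add: mero_ring_outside\<close>)
  qed
  ultimately show ?thesis using res by (intro ex1I[of _ t]) auto
qed

lemma module_sheaf_line_bundle: "module_sheaf X (line_bundle a)"
  unfolding module_sheaf_def
proof (intro conjI allI impI ballI)
  fix \<U> :: "complex option set set" and s
  assume "\<forall>U\<in>\<U>. is_open X U \<and> s U \<in> secs (line_bundle a) U"
    "\<forall>U\<in>\<U>. \<forall>V\<in>\<U>. res (line_bundle a) U (U \<inter> V) (s U) = res (line_bundle a) V (U \<inter> V) (s V)"
  then have "\<exists>!t. t \<in> carrier (mero_ring (\<Union>\<U>)) \<and> (\<forall>U\<in>\<U>. restr U t = s U)"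
    by (intro mero_ring_glue) (auto simp del: Union_iff)
  then show "\<exists>!t. t \<in> secs (line_bundle a) (\<Union>\<U>) \<and> (\<forall>U\<in>\<U>. res (line_bundle a) (\<Union>\<U>) U t = s U)"
    by simp
qed (auto simp: module_line_bundle restr_add restr_mult restr_same restr_restr intro: restr_closed)

lemma submodule_of_abelian_group:
  fixes M (structure)
  assumes "abelian_group M" "H \<subseteq> carrier M" "\<zero> \<in> H" "\<And>a. a \<in> H \<Longrightarrow> \<ominus> a \<in> H"
    "\<And>a b. a \<in> H \<Longrightarrow> b \<in> H \<Longrightarrow> a \<oplus> b \<in> H" "\<And>a x. a \<in> carrier R \<Longrightarrow> x \<in> H \<Longrightarrow> a \<odot> x \<in> H"
  shows "submodule H R M"
  using assms by (intro submodule.intro subgroup.intro submodule_axioms.intro) (auto simp: a_inv_def)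

lemma line_bundle_uminus:
  assumes "openin CP1 U" "f \<in> carrier (mero_ring U)"
  shows "\<ominus>\<^bsub>sec (line_bundle a) U\<^esub> f = (\<lambda>z. - f z)"
proof -
  interpret M: Module.module "mero_ring U" "sec (line_bundle a) U" by (rule module_line_bundle[OF assms(1)])
  show ?thesis by (rule M.minus_equality) (use assms in \<open>auto intro: mero_ring_uminus\<close>)
qed

lemma hol_submodule_line_bundle: "hol_submodule X (line_bundle a) (fil (line_bundle a) \<beta>)"
  unfolding hol_submodule_def
proof (intro conjI allI impI ballI)
  fix U assume U: "is_open X U"
  show "submodule (fil (line_bundle a) \<beta> U) (hol_ring U) (sec (line_bundle a) U)"
  proof (rule submodule_of_abelian_group)
    show "abelian_group (sec (line_bundle a) U)"
      using module_line_bundle U by (simp add: Module.module_def)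
    fix f s assume "f \<in> carrier (hol_ring U)" "s \<in> fil (line_bundle a) \<beta> U"
    then show "f \<odot>\<^bsub>sec (line_bundle a) U\<^esub> s \<in> fil (line_bundle a) \<beta> U"
      using pole_order_le_mult[of 0 f] by (auto simp: hol_ring_iff intro: mero_ring_mult)
  qed (use U in \<open>auto simp: line_bundle_uminus intro: pole_order_le_zero pole_order_le_add pole_order_le_uminus
           mero_ring_zero mero_ring_add mero_ring_uminus\<close>)
next
  fix U V assume "is_open X U" "is_open U V"
  then show "res (line_bundle a) U V \<in> fil (line_bundle a) \<beta> U \<rightarrow> fil (line_bundle a) \<beta> V"
    by (auto simp: pole_order_le_restr intro: restr_closed)
next
  fix \<U> s assume U: "\<forall>U\<in>\<U>. is_open X U" and s: "s \<in> secs (line_bundle a) (\<Union>\<U>)"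
    "\<forall>U\<in>\<U>. res (line_bundle a) (\<Union>\<U>) U s \<in> fil (line_bundle a) \<beta> U"
  show "s \<in> fil (line_bundle a) \<beta> (\<Union>\<U>)"
    using U s pole_order_le_restr by auto
qed

text \<open>
  The steps of the filtration of a line bundle are constant on half-open intervals of length \<open>1\<close>;
  this is why they are continuous from the right.
\<close>

lemma floor_right_continuous: "\<exists>\<beta>>\<alpha>. \<lfloor>\<beta> + a\<rfloor> = \<lfloor>\<alpha> + a :: real\<rfloor>"
proof -
  have "\<alpha> + a < of_int \<lfloor>\<alpha> + a\<rfloor> + 1" by linarith
  then have "\<lfloor>(\<alpha> + (of_int \<lfloor>\<alpha> + a\<rfloor> + 1 - a)) / 2 + a\<rfloor> = \<lfloor>\<alpha> + a\<rfloor>"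
    unfolding floor_eq_iff by (auto simp: field_simps) linarith+
  moreover have "(\<alpha> + (of_int \<lfloor>\<alpha> + a\<rfloor> + 1 - a)) / 2 > \<alpha>"
    using \<open>\<alpha> + a < of_int \<lfloor>\<alpha> + a\<rfloor> + 1\<close> by (simp add: field_simps)
  ultimately show ?thesis by blast
qed

lemma fil_line_bundle_Inf:
  "fil (line_bundle a) \<alpha> U = (\<Inter>\<beta>\<in>{\<alpha><..}. fil (line_bundle a) \<beta> U)"
proof -
  obtain \<beta> where b: "\<beta> > \<alpha>" "\<lfloor>\<beta> + a\<rfloor> = \<lfloor>\<alpha> + a\<rfloor>" using floor_right_continuous by blast
  have "pole_order_le \<lfloor>\<gamma> + a\<rfloor> f" if "pole_order_le \<lfloor>\<alpha> + a\<rfloor> f" "\<gamma> > \<alpha>" for f \<gamma>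
    using that(1) by (rule pole_order_le_mono) (use that(2) in \<open>auto intro: floor_mono\<close>)
  then have "fil (line_bundle a) \<alpha> U \<subseteq> fil (line_bundle a) \<gamma> U" if "\<gamma> > \<alpha>" for \<gamma>
    using that by auto
  moreover have "fil (line_bundle a) \<beta> U = fil (line_bundle a) \<alpha> U" using b by simp
  ultimately show ?thesis using b(1) by blast
qed

lemma fil_line_bundle_shift:
  assumes "openin CP1 U" "None \<in> U" "Some 0 \<notin> U"
  shows "fil (line_bundle a) (\<alpha> - 1) U =
    (\<lambda>s. restr U inverse \<odot>\<^bsub>sec (line_bundle a) U\<^esub> s) ` fil (line_bundle a) \<alpha> U" (is "?L = ?R")
proof
  have fl: "\<lfloor>\<alpha> - 1 + a\<rfloor> = - 1 + \<lfloor>\<alpha> + a\<rfloor>" by linarith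
  have nz: "Some z \<in> U \<Longrightarrow> z \<noteq> 0" for z using assms(3) by auto
  have inv: "restr U inverse \<in> carrier (mero_ring U)"
    by (rule restr_mero_ring) (use assms(1) nz pole_order_le_inverse in \<open>auto intro!: holomorphic_intros\<close>)
  have id: "restr U (\<lambda>z. z) \<in> carrier (mero_ring U)"
    using pole_order_le_power[of 1] by (intro restr_mero_ring) (use assms(1) in \<open>auto intro!: holomorphic_intros\<close>)
  show "?R \<subseteq> ?L"
    using pole_order_le_mult[of "-1" "restr U inverse"] inv assms
    by (auto simp: fl pole_order_le_restr pole_order_le_inverse intro: mero_ring_mult)
  show "?L \<subseteq> ?R"
  proof
    fix f assume f: "f \<in> ?L"
    have "pole_order_le \<lfloor>\<alpha> + a\<rfloor> (\<lambda>z. restr U (\<lambda>z. z) z * f z)"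
      by (rule pole_order_le_mult'[of 1 _ "\<lfloor>\<alpha> + a\<rfloor> - 1"])
         (use f fl assms pole_order_le_power[of 1] in \<open>auto simp: pole_order_le_restr\<close>)
    then have "(\<lambda>z. restr U (\<lambda>z. z) z * f z) \<in> fil (line_bundle a) \<alpha> U"
      using f id by (auto intro: mero_ring_mult)
    moreover have "f = restr U inverse \<odot>\<^bsub>sec (line_bundle a) U\<^esub> (\<lambda>z. restr U (\<lambda>z. z) z * f z)"
      using f nz mero_ring_outside[of f U] by (auto simp: restr_def fun_eq_iff)
    ultimately show "f \<in> ?R" by blast
  qed
qed

lemma finsum_lessThan:
  assumes "abelian_monoid M"
  shows "f 0 \<in> carrier M \<Longrightarrow> finsum M f {..<1::nat} = f 0"
    and "f 0 \<in> carrier M \<Longrightarrow> f 1 \<in> carrier M \<Longrightarrow> finsum M f {..<2::nat} = f 0 \<oplus>\<^bsub>M\<^esub> f 1"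
proof -
  interpret abelian_monoid M by fact
  have [simp]: "{..<Suc 0} = {0}" "{..<2::nat} = insert 0 {1}" by auto
  show "f 0 \<in> carrier M \<Longrightarrow> finsum M f {..<1::nat} = f 0"
    and "f 0 \<in> carrier M \<Longrightarrow> f 1 \<in> carrier M \<Longrightarrow> finsum M f {..<2::nat} = f 0 \<oplus>\<^bsub>M\<^esub> f 1"
    by (simp_all add: finsum_insert)
qed

lemma module_abelian_monoid: "Module.module R M \<Longrightarrow> abelian_monoid M"
  by (simp add: Module.module_def abelian_group_def)

lemma PiE_lessThan:
  "c \<in> {..<1::nat} \<rightarrow>\<^sub>E A \<Longrightarrow> c = (\<lambda>i\<in>{..<1}. c 0)"
  "c \<in> {..<2::nat} \<rightarrow>\<^sub>E A \<Longrightarrow> c = (\<lambda>i\<in>{..<2}. if i = 0 then c 0 else c 1)"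
  by (auto simp: fun_eq_iff PiE_def extensional_def less_2_cases_iff)

text \<open>
  The coefficient of \<open>s\<close> in the frame \<open>g\<close> is \<open>s / g\<close>. Since \<open>x / 0 = 0\<close>, this quotient vanishes
  outside \<open>V\<close>, as the representation of sections demands.
\<close>

lemma frame_line_bundle:
  assumes U: "openin CP1 U" and R: "\<And>V f. f \<in> carrier (R V) \<Longrightarrow> f \<in> carrier (mero_ring V)"
    and g: "g \<in> L U" "g \<in> carrier (mero_ring U)" "\<And>z. Some z \<in> U \<Longrightarrow> g z \<noteq> 0"
    and L: "\<And>V s. is_open U V \<Longrightarrow> s \<in> L V \<Longrightarrow>
       (\<forall>z. Some z \<notin> V \<longrightarrow> s z = 0) \<and> (\<lambda>z. s z / g z) \<in> carrier (R V)"
  shows "frame R 1 (line_bundle a) L U (\<lambda>_. g)"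
  unfolding frame_def
proof (intro conjI allI impI ballI)
  fix V s assume V: "is_open U V" and s: "s \<in> L V"
  let ?M = "sec (line_bundle a) V"
  have sum: "finsum ?M (\<lambda>i. c i \<odot>\<^bsub>?M\<^esub> res (line_bundle a) U V g) {..<1} = (\<lambda>z. c 0 z * restr V g z)"
    if "c \<in> {..<1} \<rightarrow>\<^sub>E carrier (R V)" for c :: "nat \<Rightarrow> _"
  proof -
    have "c 0 \<in> carrier (mero_ring V)" using that by (intro R PiE_mem[of c "{..<1}"]) auto
    then show ?thesis
      by (subst finsum_lessThan(1))
         (use V g in \<open>auto intro: module_abelian_monoid module_line_bundle mero_ring_mult restr_closed\<close>)
  qed
  show "\<exists>!c. c \<in> {..<1::nat} \<rightarrow>\<^sub>E carrier (R V) \<and>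
      s = finsum ?M (\<lambda>i. c i \<odot>\<^bsub>?M\<^esub> res (line_bundle a) U V g) {..<1}"
  proof (rule ex1I)
    let ?c = "\<lambda>i\<in>{..<1::nat}. \<lambda>z. s z / g z"
    have c: "?c \<in> {..<1::nat} \<rightarrow>\<^sub>E carrier (R V)" using L[OF V s] by auto
    show "?c \<in> {..<1::nat} \<rightarrow>\<^sub>E carrier (R V) \<and>
      s = finsum ?M (\<lambda>i. ?c i \<odot>\<^bsub>?M\<^esub> res (line_bundle a) U V g) {..<1}"
    proof
      have "s z = s z / g z * restr V g z" for z
        using L[OF V s] V g(3)[of z] by (cases "Some z \<in> V") (auto simp: restr_def)
      then show "s = finsum ?M (\<lambda>i. ?c i \<odot>\<^bsub>?M\<^esub> res (line_bundle a) U V g) {..<1}"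
        unfolding sum[OF c] by (intro ext) simp
    qed (rule c)
    fix c assume c: "c \<in> {..<1::nat} \<rightarrow>\<^sub>E carrier (R V) \<and>
      s = finsum ?M (\<lambda>i. c i \<odot>\<^bsub>?M\<^esub> res (line_bundle a) U V g) {..<1}"
    then have eq: "s = (\<lambda>z. c 0 z * restr V g z)" using sum by blast
    have "c 0 \<in> carrier (R V)" using c by auto
    then have "c 0 z = 0" if "Some z \<notin> V" for z using mero_ring_outside R that by blast
    then have "c 0 z = s z / g z" for z
      using V g(3)[of z] fun_cong[OF eq, of z] by (cases "Some z \<in> V") (auto simp: restr_def)
    then have "c 0 = (\<lambda>z. s z / g z)" by blast
    moreover have "c = (\<lambda>i\<in>{..<1}. c 0)" using c by (intro PiE_lessThan(1)) blast
    ultimately show "c = ?c" by simp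
  qed
qed (use U g in auto)

lemma hol_ring_mero: "f \<in> carrier (hol_ring V) \<Longrightarrow> f \<in> carrier (mero_ring V)"
  by (simp add: hol_ring_iff)

lemma mero_ring_divide:
  assumes s: "s \<in> carrier (mero_ring V)" and g: "g holomorphic_on {z. Some z \<in> V}"
    "\<And>z. Some z \<in> V \<Longrightarrow> g z \<noteq> 0" "None \<in> V \<Longrightarrow> \<exists>m. pole_order_le m (\<lambda>z. inverse (g z))"
  shows "(\<lambda>z. s z / g z) \<in> carrier (mero_ring V)"
proof -
  have "\<exists>n. pole_order_le n (\<lambda>z. s z / g z)" if "None \<in> V"
    using mero_ring_pole_order[OF s that] g(3)[OF that] pole_order_le_mult by (auto simp: divide_inverse) metis
  then show ?thesis using s g(1,2) by (auto simp: mero_ring_iff intro!: holomorphic_intros)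
qed

text \<open>
  Near infinity a power of \<open>z\<close> generates step \<open>\<beta>\<close> of \<open>\<O>(a)\<close>, but it may vanish or have a pole at \<open>0\<close>.
  Away from infinity every step consists of all sections, and \<open>1\<close> generates. Therefore the generator is
  only used on neighbourhoods that do not contain both \<open>0\<close> and infinity.
\<close>

definition generator :: "real \<Rightarrow> real \<Rightarrow> complex option set \<Rightarrow> complex \<Rightarrow> complex" where
  "generator a \<beta> U = restr U (\<lambda>z. if None \<in> U then z powi \<lfloor>\<beta> + a\<rfloor> else 1)"

lemma generator:
  assumes U: "openin CP1 U" "None \<in> U \<longrightarrow> Some 0 \<notin> U"
  shows "generator a \<beta> U \<in> fil (line_bundle a) \<beta> U" "Some z \<in> U \<Longrightarrow> generator a \<beta> U z \<noteq> 0"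
    "is_open U V \<Longrightarrow> s \<in> fil (line_bundle a) \<beta> V \<Longrightarrow> (\<lambda>z. s z / generator a \<beta> U z) \<in> carrier (hol_ring V)"
proof -
  have nz: "Some z \<in> U \<Longrightarrow> z \<noteq> 0 \<or> None \<notin> U" for z using U by auto
  then show ne: "Some z \<in> U \<Longrightarrow> generator a \<beta> U z \<noteq> 0" for z by (auto simp: generator_def restr_def)
  have hol: "(\<lambda>z. if None \<in> U then z powi \<lfloor>\<beta> + a\<rfloor> else 1) holomorphic_on {z. Some z \<in> U}"
    using nz by (cases "None \<in> U") (auto intro!: holomorphic_intros)
  then show gen: "generator a \<beta> U \<in> fil (line_bundle a) \<beta> U"
    unfolding generator_def using U pole_order_le_powi
    by (auto simp: pole_order_le_restr intro!: restr_mero_ring intro: exI[of _ "\<lfloor>\<beta> + a\<rfloor>"])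
  assume V: "is_open U V" and s: "s \<in> fil (line_bundle a) \<beta> V"
  have inv: "pole_order_le (- \<lfloor>\<beta> + a\<rfloor>) (\<lambda>z. inverse (generator a \<beta> U z))" if "None \<in> V"
  proof -
    have "\<forall>\<^sub>F z in at_infinity. inverse (generator a \<beta> U z) = z powi (- \<lfloor>\<beta> + a\<rfloor>)"
      using eventually_in_nhd_infinity[of V] V that
      by (auto elim!: eventually_mono simp: generator_def restr_def power_int_minus)
    then show ?thesis using pole_order_le_cong pole_order_le_powi by metis
  qed
  have "(\<lambda>z. s z / generator a \<beta> U z) \<in> carrier (mero_ring V)"
    by (rule mero_ring_divide) (use s V gen ne inv in \<open>auto simp: mero_ring_iff elim: holomorphic_on_subset\<close>)
  moreover have "pole_order_le 0 (\<lambda>z. s z / generator a \<beta> U z)" if "None \<in> V"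
    using pole_order_le_mult[OF _ inv[OF that], of "\<lfloor>\<beta> + a\<rfloor>" s] s that by (simp add: divide_inverse)
  ultimately show "(\<lambda>z. s z / generator a \<beta> U z) \<in> carrier (hol_ring V)" by (simp add: hol_ring_iff)
qed

lemma nhd_avoiding_zero_or_infinity:
  assumes "openin CP1 X" "p \<in> X"
  shows "\<exists>U. is_open X U \<and> p \<in> U \<and> (None \<in> U \<longrightarrow> Some 0 \<notin> U)"
proof (cases p)
  case None
  have "openin CP1 (X - {Some 0})"
  proof -
    have "{z. Some z \<in> X - {Some 0}} = {z. Some z \<in> X} - {0}" by auto
    moreover have "\<forall>\<^sub>F z in at_infinity. Some z \<in> X - {Some 0}" if "None \<in> X"
      using eventually_in_nhd_infinity[OF assms(1) that] eventually_nonzero_at_infinity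
      by eventually_elim auto
    ultimately show ?thesis using assms(1) by (auto simp: openin_CP1_iff intro: open_delete)
  qed
  then show ?thesis using None assms by (intro exI[of _ "X - {Some 0}"]) auto
next
  case (Some z)
  have "{z. Some z \<in> X - {None}} = {z. Some z \<in> X}" by auto
  then have "openin CP1 (X - {None})" using assms(1) by (auto simp: openin_CP1_iff)
  then show ?thesis using Some assms by (intro exI[of _ "X - {None}"]) auto
qed

lemma filtered_line_bundle:
  assumes X: "openin CP1 X"
  shows "filtered_bundle X 1 (line_bundle a)"
  unfolding filtered_bundle_def
proof (intro conjI allI impI)
  show "module_sheaf X (line_bundle a)" by (rule module_sheaf_line_bundle)
  show "locally_free mero_ring 1 X (line_bundle a) (secs (line_bundle a))"
    unfolding locally_free_def
  proof (intro ballI exI conjI)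
    show "frame mero_ring 1 (line_bundle a) (secs (line_bundle a)) X (\<lambda>_. restr X (\<lambda>_. 1))"
    proof (rule frame_line_bundle)
      fix V s assume "is_open X V" "s \<in> secs (line_bundle a) V"
      then show "(\<forall>z. Some z \<notin> V \<longrightarrow> s z = 0) \<and> (\<lambda>z. s z / restr X (\<lambda>_. 1) z) \<in> carrier (mero_ring V)"
      proof (intro conjI)
        show "(\<lambda>z. s z / restr X (\<lambda>_. 1) z) \<in> carrier (mero_ring V)"
          if "is_open X V" "s \<in> secs (line_bundle a) V"
        proof -
          have "(\<lambda>z. s z / restr X (\<lambda>_. 1) z) = s"
            using that mero_ring_outside[of s V] by (fastforce simp: restr_def)
          then show ?thesis using that by simp
        qed
      qed (auto simp: mero_ring_outside)
    qed (use X restr_one_closed[OF X] in \<open>auto simp: restr_apply\<close>)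
  qed (use X in auto)
  fix \<alpha>
  show "hol_submodule X (line_bundle a) (fil (line_bundle a) \<alpha>)" by (rule hol_submodule_line_bundle)
  show "locally_free hol_ring 1 X (line_bundle a) (fil (line_bundle a) \<alpha>)"
    unfolding locally_free_def
  proof
    fix p assume "p \<in> X"
    then obtain U where U: "is_open X U" "p \<in> U" "None \<in> U \<longrightarrow> Some 0 \<notin> U" using nhd_avoiding_zero_or_infinity[OF X] by blast
    have "frame hol_ring 1 (line_bundle a) (fil (line_bundle a) \<alpha>) U (\<lambda>_. generator a \<alpha> U)"
    proof (rule frame_line_bundle)
      show "generator a \<alpha> U \<in> fil (line_bundle a) \<alpha> U" using generator(1) U by blast
      then show "generator a \<alpha> U \<in> carrier (mero_ring U)" by simp
      show "(\<forall>z. Some z \<notin> V \<longrightarrow> s z = 0) \<and> (\<lambda>z. s z / generator a \<alpha> U z) \<in> carrier (hol_ring V)"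
        if "is_open U V" "s \<in> fil (line_bundle a) \<alpha> V" for V s
        using generator(3)[OF _ U(3) that] U that mero_ring_outside[of s V] by auto
    qed (use U generator(2) in \<open>auto simp: hol_ring_mero\<close>)
    then show "\<exists>U e. is_open X U \<and> p \<in> U \<and> frame hol_ring 1 (line_bundle a) (fil (line_bundle a) \<alpha>) U e"
      using U by blast
  qed
  fix \<beta> U
  show "fil (line_bundle a) \<alpha> U \<subseteq> fil (line_bundle a) \<beta> U" if "\<alpha> \<le> \<beta>"
    using that by (auto elim!: pole_order_le_mono intro: floor_mono)
  show "fil (line_bundle a) \<alpha> U = (\<Inter>\<beta>\<in>{\<alpha><..}. fil (line_bundle a) \<beta> U)"
    by (rule fil_line_bundle_Inf)
  show "fil (line_bundle a) (\<alpha> - 1) U =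
     (\<lambda>s. restr U inverse \<odot>\<^bsub>sec (line_bundle a) U\<^esub> s) ` fil (line_bundle a) \<alpha> U"
    if "is_open X U" "None \<in> U" "Some 0 \<notin> U"
    using fil_line_bundle_shift that by blast
qed auto


section \<open>Direct sums of line bundles\<close>

lemma direct_sum_simps [simp]:
  "secs (direct_sum E F) U = secs E U \<times> secs F U"
  "p \<oplus>\<^bsub>sec (direct_sum E F) U\<^esub> q =
     (fst p \<oplus>\<^bsub>sec E U\<^esub> fst q, snd p \<oplus>\<^bsub>sec F U\<^esub> snd q)"
  "f \<odot>\<^bsub>sec (direct_sum E F) U\<^esub> p = (f \<odot>\<^bsub>sec E U\<^esub> fst p, f \<odot>\<^bsub>sec F U\<^esub> snd p)"
  "\<zero>\<^bsub>sec (direct_sum E F) U\<^esub> = (\<zero>\<^bsub>sec E U\<^esub>, \<zero>\<^bsub>sec F U\<^esub>)"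
  "res (direct_sum E F) U V p = (res E U V (fst p), res F U V (snd p))"
  "fil (direct_sum E F) \<alpha> U = fil E \<alpha> U \<times> fil F \<alpha> U"
  by (simp_all add: direct_sum_def case_prod_unfold)

lemma module_direct_sum:
  assumes "Module.module R (sec E U)" "Module.module R (sec F U)"
  shows "Module.module R (sec (direct_sum E F) U)"
proof -
  interpret M: Module.module R "sec E U" by fact
  interpret N: Module.module R "sec F U" by fact
  show ?thesis
  proof (rule moduleI)
    show "cring R" by (rule M.R.is_cring)
    show "abelian_group (sec (direct_sum E F) U)"
    proof (rule abelian_groupI)
      fix p assume "p \<in> secs (direct_sum E F) U"
      then show "\<exists>q\<in>secs (direct_sum E F) U. q \<oplus>\<^bsub>sec (direct_sum E F) U\<^esub> p = \<zero>\<^bsub>sec (direct_sum E F) U\<^esub>"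
        by (intro bexI[of _ "(\<ominus>\<^bsub>sec E U\<^esub> fst p, \<ominus>\<^bsub>sec F U\<^esub> snd p)"]) (auto simp: M.l_neg N.l_neg)
    qed (auto intro: M.a_assoc N.a_assoc M.a_comm N.a_comm)
  qed (auto simp: M.smult_l_distr N.smult_l_distr M.smult_r_distr N.smult_r_distr
       M.smult_assoc1 N.smult_assoc1)
qed

lemma module_sheaf_module: "module_sheaf X E \<Longrightarrow> is_open X U \<Longrightarrow> Module.module (mero_ring U) (sec E U)"
  by (simp add: module_sheaf_def)

lemma module_sheaf_res:
  assumes "module_sheaf X E" "is_open X U" "is_open U V" "s \<in> secs E U"
  shows "res E U V s \<in> secs E V"
    "t \<in> secs E U \<Longrightarrow> res E U V (s \<oplus>\<^bsub>sec E U\<^esub> t) = res E U V s \<oplus>\<^bsub>sec E V\<^esub> res E U V t"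
    "f \<in> carrier (mero_ring U) \<Longrightarrow> res E U V (f \<odot>\<^bsub>sec E U\<^esub> s) = restr V f \<odot>\<^bsub>sec E V\<^esub> res E U V s"
    "is_open V W \<Longrightarrow> res E V W (res E U V s) = res E U W s"
proof -
  have res: "res E U V \<in> secs E U \<rightarrow> secs E V \<and>
        (\<forall>s\<in>secs E U. \<forall>t\<in>secs E U.
           res E U V (s \<oplus>\<^bsub>sec E U\<^esub> t) = res E U V s \<oplus>\<^bsub>sec E V\<^esub> res E U V t) \<and>
        (\<forall>f\<in>carrier (mero_ring U). \<forall>s\<in>secs E U.
           res E U V (f \<odot>\<^bsub>sec E U\<^esub> s) = restr V f \<odot>\<^bsub>sec E V\<^esub> res E U V s)"
    using conjunct1[OF conjunct2[OF assms(1)[unfolded module_sheaf_def]]] assms(2,3) by metis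
  note rest = conjunct2[OF conjunct2[OF assms(1)[unfolded module_sheaf_def]]]
  show "res E U V s \<in> secs E V" using conjunct1[OF res] assms(4) by (rule funcset_mem)
  show "t \<in> secs E U \<Longrightarrow> res E U V (s \<oplus>\<^bsub>sec E U\<^esub> t) = res E U V s \<oplus>\<^bsub>sec E V\<^esub> res E U V t"
    using conjunct1[OF conjunct2[OF res]] assms(4) by metis
  show "f \<in> carrier (mero_ring U) \<Longrightarrow> res E U V (f \<odot>\<^bsub>sec E U\<^esub> s) = restr V f \<odot>\<^bsub>sec E V\<^esub> res E U V s"
    using conjunct2[OF conjunct2[OF res]] assms(4) by metis
  show "is_open V W \<Longrightarrow> res E V W (res E U V s) = res E U W s"
    using conjunct1[OF conjunct2[OF rest]] assms(2-4) by metis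
qed

lemma module_sheaf_res_self:
  assumes "module_sheaf X E" "is_open X U" "s \<in> secs E U"
  shows "res E U U s = s"
  using conjunct1[OF conjunct2[OF conjunct2[OF assms(1)[unfolded module_sheaf_def]]]] assms(2,3) by metis

lemma module_sheaf_glue:
  assumes "module_sheaf X E" "\<forall>U\<in>\<U>. is_open X U \<and> s U \<in> secs E U"
    "\<forall>U\<in>\<U>. \<forall>V\<in>\<U>. res E U (U \<inter> V) (s U) = res E V (U \<inter> V) (s V)"
  shows "\<exists>!t. t \<in> secs E (\<Union>\<U>) \<and> (\<forall>U\<in>\<U>. res E (\<Union>\<U>) U t = s U)"
proof -
  note glue = conjunct2[OF conjunct2[OF conjunct2[OF conjunct2[OF assms(1)[unfolded module_sheaf_def]]]]]
  show ?thesis using spec[OF spec[OF glue], of \<U> s] assms(2,3) by metis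
qed

lemma module_sheaf_direct_sum:
  assumes E: "module_sheaf X E" and F: "module_sheaf X F"
  shows "module_sheaf X (direct_sum E F)"
  unfolding module_sheaf_def
proof (intro conjI allI impI ballI)
  fix \<U> :: "complex option set set" and s
  assume s: "\<forall>U\<in>\<U>. is_open X U \<and> s U \<in> secs (direct_sum E F) U"
    and eq: "\<forall>U\<in>\<U>. \<forall>V\<in>\<U>. res (direct_sum E F) U (U \<inter> V) (s U) = res (direct_sum E F) V (U \<inter> V) (s V)"
  have 1: "\<exists>!t. t \<in> secs E (\<Union>\<U>) \<and> (\<forall>U\<in>\<U>. res E (\<Union>\<U>) U t = fst (s U))"
    by (rule module_sheaf_glue[OF E]) (use s eq in auto)
  have 2: "\<exists>!t. t \<in> secs F (\<Union>\<U>) \<and> (\<forall>U\<in>\<U>. res F (\<Union>\<U>) U t = snd (s U))"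
    by (rule module_sheaf_glue[OF F]) (use s eq in auto)
  obtain a where a: "a \<in> secs E (\<Union>\<U>)" "\<forall>U\<in>\<U>. res E (\<Union>\<U>) U a = fst (s U)" using ex1_implies_ex[OF 1] by blast
  obtain b where b: "b \<in> secs F (\<Union>\<U>)" "\<forall>U\<in>\<U>. res F (\<Union>\<U>) U b = snd (s U)" using ex1_implies_ex[OF 2] by blast
  show "\<exists>!t. t \<in> secs (direct_sum E F) (\<Union>\<U>) \<and> (\<forall>U\<in>\<U>. res (direct_sum E F) (\<Union>\<U>) U t = s U)"
  proof (rule ex1I[of _ "(a, b)"])
    show "(a, b) \<in> secs (direct_sum E F) (\<Union>\<U>) \<and> (\<forall>U\<in>\<U>. res (direct_sum E F) (\<Union>\<U>) U (a, b) = s U)"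
      using a b by simp
    fix t assume t: "t \<in> secs (direct_sum E F) (\<Union>\<U>) \<and> (\<forall>U\<in>\<U>. res (direct_sum E F) (\<Union>\<U>) U t = s U)"
    have 3: "\<forall>U\<in>\<U>. res E (\<Union>\<U>) U (fst t) = fst (s U)" "\<forall>U\<in>\<U>. res F (\<Union>\<U>) U (snd t) = snd (s U)"
      using t by (metis direct_sum_simps(5) fst_conv, metis direct_sum_simps(5) snd_conv)
    have "fst t = a" "snd t = b"
      using 1 2 a b 3 t by (metis direct_sum_simps(1) mem_Times_iff)+
    then show "t = (a, b)" by (metis prod.collapse)
  qed
next
  fix U V W s assume "is_open X U" "is_open U V" "is_open V W" "s \<in> secs (direct_sum E F) U"
  then show "res (direct_sum E F) V W (res (direct_sum E F) U V s) = res (direct_sum E F) U W s"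
    using module_sheaf_res(4)[OF E, of U V "fst s" W] module_sheaf_res(4)[OF F, of U V "snd s" W] by auto
qed (use module_sheaf_res(1-3)[OF E] module_sheaf_res(1-3)[OF F] module_sheaf_res_self[OF E] module_sheaf_res_self[OF F] in
     \<open>auto intro!: module_direct_sum module_sheaf_module[OF E] module_sheaf_module[OF F]\<close>)

lemma submodule_facts:
  assumes "submodule H R M" "abelian_group M"
  shows "H \<subseteq> carrier M" "\<zero>\<^bsub>M\<^esub> \<in> H" "a \<in> H \<Longrightarrow> \<ominus>\<^bsub>M\<^esub> a \<in> H"
    "a \<in> H \<Longrightarrow> b \<in> H \<Longrightarrow> a \<oplus>\<^bsub>M\<^esub> b \<in> H" "f \<in> carrier R \<Longrightarrow> a \<in> H \<Longrightarrow> f \<odot>\<^bsub>M\<^esub> a \<in> H"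
  using assms unfolding submodule_def submodule_axioms_def subgroup_def by (auto simp: a_inv_def)

lemma module_abelian_group: "Module.module R M \<Longrightarrow> abelian_group M"
  by (simp add: Module.module_def)

lemma hol_submodule_direct_sum:
  assumes E: "hol_submodule X E L" "module_sheaf X E" and F: "hol_submodule X F L'" "module_sheaf X F"
  shows "hol_submodule X (direct_sum E F) (\<lambda>U. L U \<times> L' U)"
  unfolding hol_submodule_def
proof (intro conjI allI impI ballI)
  fix U assume U: "is_open X U"
  note mE = module_sheaf_module[OF E(2) U] and mF = module_sheaf_module[OF F(2) U]
  note agE = module_abelian_group[OF mE] and agF = module_abelian_group[OF mF]
  have ag: "abelian_group (sec (direct_sum E F) U)"
    by (rule module_abelian_group[OF module_direct_sum[OF mE mF]])
  have sE: "submodule (L U) (hol_ring U) (sec E U)" and sF: "submodule (L' U) (hol_ring U) (sec F U)"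
    using E(1) F(1) U by (auto simp: hol_submodule_def)
  show "submodule (L U \<times> L' U) (hol_ring U) (sec (direct_sum E F) U)"
  proof (rule submodule_of_abelian_group[OF ag])
    fix p assume p: "p \<in> L U \<times> L' U"
    have "\<ominus>\<^bsub>sec (direct_sum E F) U\<^esub> p = (\<ominus>\<^bsub>sec E U\<^esub> fst p, \<ominus>\<^bsub>sec F U\<^esub> snd p)"
    proof (rule abelian_group.minus_equality[OF ag])
      have "fst p \<in> secs E U" "snd p \<in> secs F U"
        using submodule_facts(1)[OF sE agE] submodule_facts(1)[OF sF agF] p by auto
      then show "(\<ominus>\<^bsub>sec E U\<^esub> fst p, \<ominus>\<^bsub>sec F U\<^esub> snd p) \<oplus>\<^bsub>sec (direct_sum E F) U\<^esub> p = \<zero>\<^bsub>sec (direct_sum E F) U\<^esub>"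
        "p \<in> secs (direct_sum E F) U"
        "(\<ominus>\<^bsub>sec E U\<^esub> fst p, \<ominus>\<^bsub>sec F U\<^esub> snd p) \<in> secs (direct_sum E F) U"
        using agE agF by (auto simp: abelian_group.l_neg abelian_group.a_inv_closed mem_Times_iff)
    qed
    then show "\<ominus>\<^bsub>sec (direct_sum E F) U\<^esub> p \<in> L U \<times> L' U"
      using p submodule_facts(3)[OF sE agE] submodule_facts(3)[OF sF agF] by auto
  qed (use submodule_facts[OF sE agE] submodule_facts[OF sF agF] in auto)
next
  fix U V assume "is_open X U" "is_open U V"
  then show "res (direct_sum E F) U V \<in> L U \<times> L' U \<rightarrow> L V \<times> L' V"
    using E(1) F(1) unfolding hol_submodule_def by (fastforce simp: Pi_def)
next
  fix \<U> s assume U: "\<forall>U\<in>\<U>. is_open X U" and s: "s \<in> secs (direct_sum E F) (\<Union>\<U>)"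
    "\<forall>U\<in>\<U>. res (direct_sum E F) (\<Union>\<U>) U s \<in> L U \<times> L' U"
  have "fst s \<in> L (\<Union>\<U>)" using E(1) U s unfolding hol_submodule_def by auto
  moreover have "snd s \<in> L' (\<Union>\<U>)" using F(1) U s unfolding hol_submodule_def by auto
  ultimately show "s \<in> L (\<Union>\<U>) \<times> L' (\<Union>\<U>)" by (simp add: mem_Times_iff)
qed

text \<open>
  As for a single line bundle, the coefficients in a diagonal frame are quotients.
\<close>

lemma frame_line_sum:
  fixes a b
  defines "E \<equiv> direct_sum (line_bundle a) (line_bundle b)"
  assumes U: "openin CP1 U" and R: "\<And>V f. f \<in> carrier (R V) \<Longrightarrow> f \<in> carrier (mero_ring V)"
    and g: "(g0, \<lambda>_. 0) \<in> L U" "(\<lambda>_. 0, g1) \<in> L U" "g0 \<in> carrier (mero_ring U)" "g1 \<in> carrier (mero_ring U)"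
       "\<And>z. Some z \<in> U \<Longrightarrow> g0 z \<noteq> 0" "\<And>z. Some z \<in> U \<Longrightarrow> g1 z \<noteq> 0"
    and L: "\<And>V s t. is_open U V \<Longrightarrow> (s, t) \<in> L V \<Longrightarrow>
       (\<forall>z. Some z \<notin> V \<longrightarrow> s z = 0 \<and> t z = 0) \<and>
       (\<lambda>z. s z / g0 z) \<in> carrier (R V) \<and> (\<lambda>z. t z / g1 z) \<in> carrier (R V)"
  shows "frame R 2 E L U (\<lambda>i. if i = 0 then (g0, \<lambda>_. 0) else (\<lambda>_. 0, g1))"
    (is "frame _ _ _ _ _ ?e")
  unfolding frame_def
proof (intro conjI allI impI ballI)
  fix V p assume V: "is_open U V" and "p \<in> L V"
  then obtain s t where st: "p = (s, t)" "(s, t) \<in> L V" by (metis prod.collapse)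
  let ?M = "sec E V"
  have mod: "Module.module (mero_ring V) ?M"
    unfolding E_def by (rule module_direct_sum; rule module_line_bundle[OF conjunct1[OF V]])
  have sum: "finsum ?M (\<lambda>i. c i \<odot>\<^bsub>?M\<^esub> res E U V (?e i)) {..<2} =
     (\<lambda>z. c 0 z * restr V g0 z, \<lambda>z. c 1 z * restr V g1 z)"
    if "c \<in> {..<2} \<rightarrow>\<^sub>E carrier (R V)" for c :: "nat \<Rightarrow> _"
  proof -
    have "c 0 \<in> carrier (mero_ring V)" "c 1 \<in> carrier (mero_ring V)"
      by (rule R, rule PiE_mem[OF that], simp)+
    then show ?thesis
      by (subst finsum_lessThan(2)[OF module_abelian_monoid[OF mod]])
         (use V g in \<open>auto simp: E_def restr_zero intro: mero_ring_zero mero_ring_mult restr_closed\<close>)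
  qed
  show "\<exists>!c. c \<in> {..<2} \<rightarrow>\<^sub>E carrier (R V) \<and> p = finsum ?M (\<lambda>i. c i \<odot>\<^bsub>?M\<^esub> res E U V (?e i)) {..<2}"
  proof (rule ex1I)
    let ?c = "\<lambda>i\<in>{..<2::nat}. if i = 0 then \<lambda>z. s z / g0 z else (\<lambda>z. t z / g1 z)"
    have c: "?c \<in> {..<2} \<rightarrow>\<^sub>E carrier (R V)" using L[OF V st(2)] by auto
    show "?c \<in> {..<2} \<rightarrow>\<^sub>E carrier (R V) \<and> p = finsum ?M (\<lambda>i. ?c i \<odot>\<^bsub>?M\<^esub> res E U V (?e i)) {..<2}"
    proof
      have "s z = s z / g0 z * restr V g0 z" "t z = t z / g1 z * restr V g1 z" for z
        using L[OF V st(2)] V g(5,6)[of z] by (cases "Some z \<in> V"; auto simp: restr_def)+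
      then show "p = finsum ?M (\<lambda>i. ?c i \<odot>\<^bsub>?M\<^esub> res E U V (?e i)) {..<2}"
        unfolding sum[OF c] st(1) by (intro arg_cong2[of _ _ _ _ Pair] ext) simp_all
    qed (rule c)
    fix c assume c: "c \<in> {..<2::nat} \<rightarrow>\<^sub>E carrier (R V) \<and> p = finsum ?M (\<lambda>i. c i \<odot>\<^bsub>?M\<^esub> res E U V (?e i)) {..<2}"
    then have eq: "s = (\<lambda>z. c 0 z * restr V g0 z)" "t = (\<lambda>z. c 1 z * restr V g1 z)"
      using sum st(1) by auto
    have "c 0 \<in> carrier (R V)" "c 1 \<in> carrier (R V)" by (rule PiE_mem[OF conjunct1[OF c]], simp)+
    then have "c 0 z = 0" "c 1 z = 0" if "Some z \<notin> V" for z using mero_ring_outside R that by blast+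
    then have "c 0 z = s z / g0 z" "c 1 z = t z / g1 z" for z
      using V g(5,6)[of z] fun_cong[OF eq(1), of z] fun_cong[OF eq(2), of z]
      by (cases "Some z \<in> V"; auto simp: restr_def)+
    then have c01: "c 0 = (\<lambda>z. s z / g0 z)" "c 1 = (\<lambda>z. t z / g1 z)" by blast+
    have "c = (\<lambda>i\<in>{..<2}. if i = 0 then c 0 else c 1)" using c by (intro PiE_lessThan(2)) blast
    also have "\<dots> = ?c" by (simp only: c01)
    finally show "c = ?c" .
  qed
qed (use U g in auto)

lemma canonical_line_frame:
  assumes X: "openin CP1 X"
  shows "frame mero_ring 2 (direct_sum (line_bundle a) (line_bundle b)) (\<lambda>U. carrier (mero_ring U) \<times> carrier (mero_ring U))
    X (\<lambda>i. if i = 0 then (restr X (\<lambda>_. 1), \<lambda>_. 0) else (\<lambda>_. 0, restr X (\<lambda>_. 1)))"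
proof (rule frame_line_sum)
  fix V s t assume V: "is_open X V" and "(s, t) \<in> carrier (mero_ring V) \<times> carrier (mero_ring V)"
  then have st: "s \<in> carrier (mero_ring V)" "t \<in> carrier (mero_ring V)" by auto
  have *: "(\<lambda>z. f z / restr X (\<lambda>_. 1) z) = f" if "f \<in> carrier (mero_ring V)" for f
    using that V mero_ring_outside[of f V] by (fastforce simp: restr_def)
  show "(\<forall>z. Some z \<notin> V \<longrightarrow> s z = 0 \<and> t z = 0) \<and> (\<lambda>z. s z / restr X (\<lambda>_. 1) z) \<in> carrier (mero_ring V) \<and>
     (\<lambda>z. t z / restr X (\<lambda>_. 1) z) \<in> carrier (mero_ring V)"
    unfolding *[OF st(1)] *[OF st(2)] using st mero_ring_outside by blast
qed (use X restr_one_closed[OF X] mero_ring_zero in \<open>auto simp: restr_apply\<close>)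

lemma filtered_bundleD:
  assumes "filtered_bundle X n F"
  shows "module_sheaf X F" "locally_free mero_ring n X F (secs F)"
    "hol_submodule X F (fil F \<alpha>)" "locally_free hol_ring n X F (fil F \<alpha>)"
    "is_open X U \<Longrightarrow> \<alpha> \<le> \<beta> \<Longrightarrow> fil F \<alpha> U \<subseteq> fil F \<beta> U"
    "is_open X U \<Longrightarrow> None \<notin> U \<Longrightarrow> fil F \<alpha> U = secs F U"
    "is_open X U \<Longrightarrow> fil F \<alpha> U = (\<Inter>\<beta>\<in>{\<alpha><..}. fil F \<beta> U)"
    "is_open X U \<Longrightarrow> None \<in> U \<Longrightarrow> Some 0 \<notin> U \<Longrightarrow>
        fil F (\<alpha> - 1) U = (\<lambda>s. restr U inverse \<odot>\<^bsub>sec F U\<^esub> s) ` fil F \<alpha> U"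
    "is_open X U \<Longrightarrow> fil F \<alpha> U \<subseteq> secs F U"
proof -
  note D = assms[unfolded filtered_bundle_def]
  note D3 = conjunct2[OF conjunct2[OF D]]
  note D4 = conjunct2[OF D3] note D5 = conjunct2[OF D4] note D6 = conjunct2[OF D5]
  show sh: "module_sheaf X F" by (rule conjunct1[OF D])
  show "locally_free mero_ring n X F (secs F)" by (rule conjunct1[OF conjunct2[OF D]])
  show sub: "hol_submodule X F (fil F \<alpha>)" by (rule conjunct1[OF spec[OF conjunct1[OF D3]]])
  show "locally_free hol_ring n X F (fil F \<alpha>)" by (rule conjunct2[OF spec[OF conjunct1[OF D3]]])
  show "is_open X U \<Longrightarrow> \<alpha> \<le> \<beta> \<Longrightarrow> fil F \<alpha> U \<subseteq> fil F \<beta> U"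
    by (rule conjunct1[OF D4, rule_format])
  show "is_open X U \<Longrightarrow> None \<notin> U \<Longrightarrow> fil F \<alpha> U = secs F U"
    by (rule conjunct1[OF D5, rule_format])
  show "is_open X U \<Longrightarrow> fil F \<alpha> U = (\<Inter>\<beta>\<in>{\<alpha><..}. fil F \<beta> U)"
    by (rule conjunct1[OF D6, rule_format])
  show "is_open X U \<Longrightarrow> None \<in> U \<Longrightarrow> Some 0 \<notin> U \<Longrightarrow>
        fil F (\<alpha> - 1) U = (\<lambda>s. restr U inverse \<odot>\<^bsub>sec F U\<^esub> s) ` fil F \<alpha> U"
    by (rule conjunct2[OF D6, rule_format])
  assume U: "is_open X U"
  show "fil F \<alpha> U \<subseteq> secs F U"
  proof (rule submodule_facts(1))
    show "submodule (fil F \<alpha> U) (hol_ring U) (sec F U)" using sub U by (simp add: hol_submodule_def)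
    show "abelian_group (sec F U)" using module_sheaf_module[OF sh U] by (rule module_abelian_group)
  qed
qed

lemma filtered_line_sum:
  assumes X: "openin CP1 X"
  shows "filtered_bundle X 2 (direct_sum (line_bundle a) (line_bundle b))" (is "filtered_bundle X 2 ?E")
proof -
  have A: "filtered_bundle X 1 (line_bundle c)" for c by (rule filtered_line_bundle[OF X])
  show ?thesis
    unfolding filtered_bundle_def
  proof (intro conjI allI impI)
    show sheaf: "module_sheaf X ?E"
      by (intro module_sheaf_direct_sum module_sheaf_line_bundle)
    show "locally_free mero_ring 2 X ?E (secs ?E)"
      unfolding locally_free_def
    proof (intro ballI exI conjI)
      have "secs ?E = (\<lambda>U. carrier (mero_ring U) \<times> carrier (mero_ring U))" by auto
      then show "frame mero_ring 2 ?E (secs ?E)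
         X (\<lambda>i. if i = 0 then (restr X (\<lambda>_. 1), \<lambda>_. 0) else (\<lambda>_. 0, restr X (\<lambda>_. 1)))"
        using canonical_line_frame[OF X] by simp
    qed (use X in auto)
    fix \<alpha>
    have "hol_submodule X ?E (\<lambda>U. fil (line_bundle a) \<alpha> U \<times> fil (line_bundle b) \<alpha> U)"
      by (intro hol_submodule_direct_sum hol_submodule_line_bundle module_sheaf_line_bundle)
    moreover have filE: "fil ?E \<alpha> = (\<lambda>U. fil (line_bundle a) \<alpha> U \<times> fil (line_bundle b) \<alpha> U)"
      by (rule ext) (rule direct_sum_simps)
    ultimately show "hol_submodule X ?E (fil ?E \<alpha>)" by simp
    show "locally_free hol_ring 2 X ?E (fil ?E \<alpha>)"
      unfolding locally_free_def
    proof
      fix p assume "p \<in> X"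
      then obtain U where U: "is_open X U" "p \<in> U" "None \<in> U \<longrightarrow> Some 0 \<notin> U" using nhd_avoiding_zero_or_infinity[OF X] by blast
      have gen: "generator c \<alpha> U \<in> fil (line_bundle c) \<alpha> U" for c using generator(1) U by blast
      then have gen': "generator c \<alpha> U \<in> carrier (mero_ring U)" for c by simp
      have "frame hol_ring 2 ?E (fil ?E \<alpha>) U
          (\<lambda>i. if i = 0 then (generator a \<alpha> U, \<lambda>_. 0) else (\<lambda>_. 0, generator b \<alpha> U))"
      proof (rule frame_line_sum)
        have "(\<lambda>_. 0) \<in> fil (line_bundle c) \<alpha> U" for c by (simp add: mero_ring_zero pole_order_le_zero)
        then show "(generator a \<alpha> U, \<lambda>_. 0) \<in> fil ?E \<alpha> U" "(\<lambda>_. 0, generator b \<alpha> U) \<in> fil ?E \<alpha> U"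
          unfolding direct_sum_simps using gen by blast+
        fix V s t assume V: "is_open U V" and "(s, t) \<in> fil ?E \<alpha> V"
        then have st: "s \<in> fil (line_bundle a) \<alpha> V" "t \<in> fil (line_bundle b) \<alpha> V" by auto
        show "(\<forall>z. Some z \<notin> V \<longrightarrow> s z = 0 \<and> t z = 0) \<and>
           (\<lambda>z. s z / generator a \<alpha> U z) \<in> carrier (hol_ring V) \<and>
           (\<lambda>z. t z / generator b \<alpha> U z) \<in> carrier (hol_ring V)"
          using generator(3)[OF _ U(3) V] U st mero_ring_outside[of s V] mero_ring_outside[of t V] by auto
      qed (use U generator(2) gen' in \<open>auto simp: hol_ring_mero\<close>)
      then show "\<exists>U e. is_open X U \<and> p \<in> U \<and> frame hol_ring 2 ?E (fil ?E \<alpha>) U e"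
        using U by blast
    qed
    fix \<beta> U
    show "fil ?E \<alpha> U \<subseteq> fil ?E \<beta> U" if "is_open X U" "\<alpha> \<le> \<beta>"
      using filtered_bundleD(5)[OF A that, of a] filtered_bundleD(5)[OF A that, of b]
      unfolding direct_sum_simps by blast
    show "fil ?E \<alpha> U = secs ?E U" if "is_open X U" "None \<notin> U"
      using that by simp
    show "fil ?E \<alpha> U = (\<Inter>\<beta>\<in>{\<alpha><..}. fil ?E \<beta> U)" if "is_open X U"
      unfolding direct_sum_simps fil_line_bundle_Inf[of _ \<alpha>] using gt_ex[of \<alpha>] by blast
    show "fil ?E (\<alpha> - 1) U = (\<lambda>s. restr U inverse \<odot>\<^bsub>sec ?E U\<^esub> s) ` fil ?E \<alpha> U"
      if "is_open X U" "None \<in> U" "Some 0 \<notin> U"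
      unfolding direct_sum_simps fil_line_bundle_shift[OF conjunct1[OF that(1)] that(2,3)]
      by (auto simp: image_iff simp del: line_bundle_simps(6))
  qed
qed

lemma filtered_big_bundle: "filtered_bundle UNIV 2 big_bundle"
  unfolding big_bundle_def by (rule filtered_line_sum[OF open_UNIV_CP1])

section \<open>Transport of structure along isomorphisms of filtered bundles\<close>

lemma linear_map_zero:
  assumes "linear_map R M N h" "abelian_group M" "abelian_group N"
  shows "h \<zero>\<^bsub>M\<^esub> = \<zero>\<^bsub>N\<^esub>"
proof -
  interpret M: abelian_group M by fact
  interpret N: abelian_group N by fact
  have "h \<zero>\<^bsub>M\<^esub> \<in> carrier N" using assms(1) by (auto simp: linear_map_def)
  moreover have "h \<zero>\<^bsub>M\<^esub> \<oplus>\<^bsub>N\<^esub> h \<zero>\<^bsub>M\<^esub> = h \<zero>\<^bsub>M\<^esub>"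
    using assms(1) unfolding linear_map_def by (metis M.l_zero M.zero_closed)
  ultimately show ?thesis by (metis N.add.l_cancel_one)
qed

lemma linear_map_finsum:
  assumes h: "linear_map R M N h" and M: "abelian_group M" and N: "abelian_group N"
    and A: "finite A" "f \<in> A \<rightarrow> carrier M"
  shows "h (finsum M f A) = finsum N (\<lambda>i. h (f i)) A"
proof -
  interpret M: abelian_group M by fact
  interpret N: abelian_group N by fact
  show ?thesis
    using A
  proof (induction rule: finite_induct)
    case empty
    then show ?case using linear_map_zero[OF h M N] by simp
  next
    case (insert x A)
    have f: "f x \<in> carrier M" "f \<in> A \<rightarrow> carrier M" using insert.prems by auto
    have "h (f x \<oplus>\<^bsub>M\<^esub> finsum M f A) = h (f x) \<oplus>\<^bsub>N\<^esub> h (finsum M f A)"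
      using h f unfolding linear_map_def by (auto intro: M.finsum_closed)
    moreover have "(\<lambda>i. h (f i)) \<in> A \<rightarrow> carrier N" "h (f x) \<in> carrier N"
      using h f unfolding linear_map_def by auto
    ultimately show ?case using insert f by simp
  qed
qed

text \<open>
  An isomorphism onto a sheaf of modules transports the axioms back: an equation between sections of
  \<open>E\<close> holds because it holds after applying the injective map \<open>h U\<close>. Therefore only closure properties
  of \<open>E\<close> are assumed. The locale serves two purposes: it inverts isomorphisms between given
  bundles, and it proves the axioms for subsheaves of the pullback.
\<close>

locale bundle_iso =
  fixes X :: "complex option set" and E :: "'a fbundle" and F :: "'b fbundle" and h
  assumes iso: "fb_iso_map X E F h" and F_sheaf: "module_sheaf X F"
    and zero_in: "\<And>U. is_open X U \<Longrightarrow> \<zero>\<^bsub>sec E U\<^esub> \<in> secs E U"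
    and h_zero: "\<And>U. is_open X U \<Longrightarrow> h U \<zero>\<^bsub>sec E U\<^esub> = \<zero>\<^bsub>sec F U\<^esub>"
    and add_in: "\<And>U s t. is_open X U \<Longrightarrow> s \<in> secs E U \<Longrightarrow> t \<in> secs E U \<Longrightarrow> s \<oplus>\<^bsub>sec E U\<^esub> t \<in> secs E U"
    and smult_in: "\<And>U f s. is_open X U \<Longrightarrow> f \<in> carrier (mero_ring U) \<Longrightarrow> s \<in> secs E U \<Longrightarrow> f \<odot>\<^bsub>sec E U\<^esub> s \<in> secs E U"
    and res_in: "\<And>U V s. is_open X U \<Longrightarrow> is_open U V \<Longrightarrow> s \<in> secs E U \<Longrightarrow> res E U V s \<in> secs E V"
    and fil_sub: "\<And>U \<alpha>. is_open X U \<Longrightarrow> fil E \<alpha> U \<subseteq> secs E U"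
begin

abbreviation hinv where "hinv U \<equiv> inv_into (secs E U) (h U)"

lemma h_lin: "is_open X U \<Longrightarrow> linear_map (mero_ring U) (sec E U) (sec F U) (h U)"
  using iso by (simp add: fb_iso_map_def)

lemma h_bij: "is_open X U \<Longrightarrow> bij_betw (h U) (secs E U) (secs F U)"
  using iso by (simp add: fb_iso_map_def)

lemma h_in: "is_open X U \<Longrightarrow> s \<in> secs E U \<Longrightarrow> h U s \<in> secs F U"
  using h_bij by (auto dest: bij_betw_apply)

lemma h_add: "is_open X U \<Longrightarrow> s \<in> secs E U \<Longrightarrow> t \<in> secs E U \<Longrightarrow>
    h U (s \<oplus>\<^bsub>sec E U\<^esub> t) = h U s \<oplus>\<^bsub>sec F U\<^esub> h U t"
  and h_smult: "is_open X U \<Longrightarrow> f \<in> carrier (mero_ring U) \<Longrightarrow> s \<in> secs E U \<Longrightarrow>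
    h U (f \<odot>\<^bsub>sec E U\<^esub> s) = f \<odot>\<^bsub>sec F U\<^esub> h U s"
  using h_lin unfolding linear_map_def by blast+

lemma h_res: "is_open X U \<Longrightarrow> is_open U V \<Longrightarrow> s \<in> secs E U \<Longrightarrow> h V (res E U V s) = res F U V (h U s)"
  using iso by (simp add: fb_iso_map_def)

lemma h_inj: "is_open X U \<Longrightarrow> s \<in> secs E U \<Longrightarrow> t \<in> secs E U \<Longrightarrow> h U s = h U t \<longleftrightarrow> s = t"
  using h_bij unfolding bij_betw_def inj_on_def by blast

lemma hinv_in: "is_open X U \<Longrightarrow> t \<in> secs F U \<Longrightarrow> hinv U t \<in> secs E U"
  and h_hinv: "is_open X U \<Longrightarrow> t \<in> secs F U \<Longrightarrow> h U (hinv U t) = t"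
  and hinv_h: "is_open X U \<Longrightarrow> s \<in> secs E U \<Longrightarrow> hinv U (h U s) = s"
  using h_bij unfolding bij_betw_def by (auto simp: inv_into_into f_inv_into_f)

lemma fil_iff: "is_open X U \<Longrightarrow> s \<in> fil E \<alpha> U \<longleftrightarrow> s \<in> secs E U \<and> h U s \<in> fil F \<alpha> U"
proof -
  assume U: "is_open X U"
  then have "h U ` fil E \<alpha> U = fil F \<alpha> U" using iso by (simp add: fb_iso_map_def)
  then have "h U s \<in> fil F \<alpha> U \<longleftrightarrow> (\<exists>t\<in>fil E \<alpha> U. h U s = h U t)" by (metis image_iff)
  then show ?thesis using fil_sub[OF U, of \<alpha>] h_inj[OF U, of s] by blast
qed

lemma F_module: "is_open X U \<Longrightarrow> Module.module (mero_ring U) (sec F U)"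
  by (rule module_sheaf_module[OF F_sheaf])

lemma E_module:
  assumes U: "is_open X U"
  shows "Module.module (mero_ring U) (sec E U)"
proof -
  interpret F: Module.module "mero_ring U" "sec F U" by (rule F_module[OF U])
  note h = h_add[OF U] h_smult[OF U] h_zero[OF U] h_in[OF U] zero_in[OF U] add_in[OF U] smult_in[OF U]
  have inj: "s = t" if "h U s = h U t" "s \<in> secs E U" "t \<in> secs E U" for s t
    using h_inj[OF U] that by blast
  show ?thesis
  proof (rule moduleI)
    show "cring (mero_ring U)" by (rule F.R.is_cring)
    show "abelian_group (sec E U)"
    proof (rule abelian_groupI)
      fix s assume s: "s \<in> secs E U"
      have "hinv U (\<ominus>\<^bsub>sec F U\<^esub> h U s) \<oplus>\<^bsub>sec E U\<^esub> s = \<zero>\<^bsub>sec E U\<^esub>"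
        by (rule inj) (use s in \<open>simp_all add: h hinv_in[OF U] h_hinv[OF U] F.l_neg\<close>)
      then show "\<exists>t\<in>secs E U. t \<oplus>\<^bsub>sec E U\<^esub> s = \<zero>\<^bsub>sec E U\<^esub>"
        by (rule bexI[of _ "hinv U (\<ominus>\<^bsub>sec F U\<^esub> h U s)"]) (use s in \<open>simp add: h hinv_in[OF U]\<close>)
    qed (auto intro!: inj simp: h F.a_ac)
    show "(a \<oplus>\<^bsub>mero_ring U\<^esub> b) \<odot>\<^bsub>sec E U\<^esub> x = a \<odot>\<^bsub>sec E U\<^esub> x \<oplus>\<^bsub>sec E U\<^esub> b \<odot>\<^bsub>sec E U\<^esub> x"
      if "a \<in> carrier (mero_ring U)" "b \<in> carrier (mero_ring U)" "x \<in> secs E U" for a b x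
      by (rule inj) (use that F.R.a_closed[OF that(1,2)] F.smult_l_distr[OF that(1,2) h_in[OF U that(3)]]
         in \<open>simp_all add: h\<close>)
    show "a \<odot>\<^bsub>sec E U\<^esub> (x \<oplus>\<^bsub>sec E U\<^esub> y) = a \<odot>\<^bsub>sec E U\<^esub> x \<oplus>\<^bsub>sec E U\<^esub> a \<odot>\<^bsub>sec E U\<^esub> y"
      if "a \<in> carrier (mero_ring U)" "x \<in> secs E U" "y \<in> secs E U" for a x y
      by (rule inj) (use that in \<open>simp_all add: h F.smult_r_distr\<close>)
    show "(a \<otimes>\<^bsub>mero_ring U\<^esub> b) \<odot>\<^bsub>sec E U\<^esub> x = a \<odot>\<^bsub>sec E U\<^esub> (b \<odot>\<^bsub>sec E U\<^esub> x)"
      if "a \<in> carrier (mero_ring U)" "b \<in> carrier (mero_ring U)" "x \<in> secs E U" for a b x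
      by (rule inj) (use that F.R.m_closed[OF that(1,2)] F.smult_assoc1[OF that(1,2) h_in[OF U that(3)]]
         in \<open>simp_all add: h\<close>)
    show "\<one>\<^bsub>mero_ring U\<^esub> \<odot>\<^bsub>sec E U\<^esub> x = x" if "x \<in> secs E U" for x
      by (rule inj) (use that F.R.one_closed F.smult_one[OF h_in[OF U that]] in \<open>simp_all add: h\<close>)
  qed (auto intro: h)
qed

lemma E_sheaf: "module_sheaf X E"
  unfolding module_sheaf_def
proof (intro conjI allI impI ballI)
  fix U assume U: "is_open X U"
  show "Module.module (mero_ring U) (sec E U)" by (rule E_module[OF U])
next
  fix U s assume U: "is_open X U" and s: "s \<in> secs E U"
  show "res E U U s = s"
    using h_inj[OF U res_in[OF U _ s, of U] s] h_res[OF U _ s, of U] module_sheaf_res_self[OF F_sheaf U h_in[OF U s]]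
      U h_in[OF U s] by auto
next
  fix U V assume U: "is_open X U" and V: "is_open U V"
  then have XV: "is_open X V" by auto
  show "res E U V \<in> secs E U \<rightarrow> secs E V" using res_in[OF U V] by blast
  fix s assume s: "s \<in> secs E U"
  { fix t assume t: "t \<in> secs E U"
    show "res E U V (s \<oplus>\<^bsub>sec E U\<^esub> t) = res E U V s \<oplus>\<^bsub>sec E V\<^esub> res E U V t"
      using h_inj[OF XV] module_sheaf_res(2)[OF F_sheaf U V h_in[OF U s] h_in[OF U t]]
      by (simp add: h_res[OF U V] h_add[OF U] h_add[OF XV] res_in[OF U V] s t add_in[OF U] add_in[OF XV]
          flip: h_inj[OF XV]) }
  { fix f assume f: "f \<in> carrier (mero_ring U)"
    have f': "restr V f \<in> carrier (mero_ring V)" using restr_closed f V by blast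
    show "res E U V (f \<odot>\<^bsub>sec E U\<^esub> s) = restr V f \<odot>\<^bsub>sec E V\<^esub> res E U V s"
      using module_sheaf_res(3)[OF F_sheaf U V h_in[OF U s] f]
      by (simp add: h_res[OF U V] h_smult[OF U] h_smult[OF XV] res_in[OF U V] s f f' smult_in[OF U] smult_in[OF XV]
          flip: h_inj[OF XV]) }
  fix W assume W: "is_open V W"
  then have XW: "is_open X W" "is_open U W" using XV V by auto
  show "res E V W (res E U V s) = res E U W s"
    using module_sheaf_res(4)[OF F_sheaf U V h_in[OF U s] W]
    by (simp add: h_res[OF U V] h_res[OF XV W] h_res[OF U XW(2)] s res_in[OF U V] res_in[OF XV W]
        res_in[OF U XW(2)] flip: h_inj[OF XW(1)])
next
  fix \<U> s assume s: "\<forall>U\<in>\<U>. is_open X U \<and> s U \<in> secs E U"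
    and eq: "\<forall>U\<in>\<U>. \<forall>V\<in>\<U>. res E U (U \<inter> V) (s U) = res E V (U \<inter> V) (s V)"
  have un: "is_open X (\<Union>\<U>)" using s by auto
  have sub: "is_open (\<Union>\<U>) U" if "U \<in> \<U>" for U using that s by auto
  have "\<exists>!t. t \<in> secs F (\<Union>\<U>) \<and> (\<forall>U\<in>\<U>. res F (\<Union>\<U>) U t = h U (s U))"
  proof (rule module_sheaf_glue[OF F_sheaf]; intro ballI)
    fix U assume u: "U \<in> \<U>"
    then have U: "is_open X U" and sU: "s U \<in> secs E U" using s by blast+
    show "is_open X U \<and> h U (s U) \<in> secs F U" using U h_in[OF U sU] by blast
    fix V assume v: "V \<in> \<U>"
    then have V: "is_open X V" and sV: "s V \<in> secs E V" using s by blast+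
    have i: "is_open U (U \<inter> V)" "is_open V (U \<inter> V)" using U V by auto
    show "res F U (U \<inter> V) (h U (s U)) = res F V (U \<inter> V) (h V (s V))"
      using eq u v h_res[OF U i(1) sU] h_res[OF V i(2) sV] by metis
  qed
  then obtain t where t: "t \<in> secs F (\<Union>\<U>)" "\<forall>U\<in>\<U>. res F (\<Union>\<U>) U t = h U (s U)"
    and uniq: "\<And>t'. t' \<in> secs F (\<Union>\<U>) \<Longrightarrow> \<forall>U\<in>\<U>. res F (\<Union>\<U>) U t' = h U (s U) \<Longrightarrow> t' = t" by blast
  have iff: "res E (\<Union>\<U>) U t' = s U \<longleftrightarrow> res F (\<Union>\<U>) U (h (\<Union>\<U>) t') = h U (s U)"
    if "U \<in> \<U>" "t' \<in> secs E (\<Union>\<U>)" for U t'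
  proof -
    have U: "is_open X U" "s U \<in> secs E U" using s that by blast+
    show ?thesis using h_inj[OF U(1) res_in[OF un sub[OF that(1)] that(2)] U(2)] h_res[OF un sub[OF that(1)] that(2)]
      by simp
  qed
  show "\<exists>!t. t \<in> secs E (\<Union>\<U>) \<and> (\<forall>U\<in>\<U>. res E (\<Union>\<U>) U t = s U)"
  proof (rule ex1I[of _ "hinv (\<Union>\<U>) t"])
    show "hinv (\<Union>\<U>) t \<in> secs E (\<Union>\<U>) \<and> (\<forall>U\<in>\<U>. res E (\<Union>\<U>) U (hinv (\<Union>\<U>) t) = s U)"
      using t iff hinv_in[OF un t(1)] h_hinv[OF un t(1)] by auto
    fix t' assume t': "t' \<in> secs E (\<Union>\<U>) \<and> (\<forall>U\<in>\<U>. res E (\<Union>\<U>) U t' = s U)"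
    then have "h (\<Union>\<U>) t' = t" by (intro uniq h_in[OF un]) (use iff in auto)
    then show "t' = hinv (\<Union>\<U>) t" using hinv_h[OF un] t' by auto
  qed
qed

lemma h_minus: "is_open X U \<Longrightarrow> s \<in> secs E U \<Longrightarrow> h U (\<ominus>\<^bsub>sec E U\<^esub> s) = \<ominus>\<^bsub>sec F U\<^esub> h U s"
proof -
  assume U: "is_open X U" and s: "s \<in> secs E U"
  interpret E: Module.module "mero_ring U" "sec E U" by (rule E_module[OF U])
  interpret F: Module.module "mero_ring U" "sec F U" by (rule F_module[OF U])
  have "h U (\<ominus>\<^bsub>sec E U\<^esub> s) \<oplus>\<^bsub>sec F U\<^esub> h U s = \<zero>\<^bsub>sec F U\<^esub>"
    using h_add[OF U E.a_inv_closed[OF s] s] by (simp add: s E.l_neg h_zero[OF U])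
  then show ?thesis
    by (metis F.minus_equality h_in[OF U] E.a_inv_closed[OF s] s)
qed

lemma hol_submodule_transport:
  assumes L: "\<And>U. is_open X U \<Longrightarrow> L U = {s \<in> secs E U. h U s \<in> L' U}" and L': "hol_submodule X F L'"
  shows "hol_submodule X E L"
  unfolding hol_submodule_def
proof (intro conjI allI impI ballI)
  fix U assume U: "is_open X U"
  have F: "submodule (L' U) (hol_ring U) (sec F U)" using L' U by (simp add: hol_submodule_def)
  have ag: "abelian_group (sec E U)" "abelian_group (sec F U)"
    using E_module[OF U] F_module[OF U] by (auto simp: module_abelian_group)
  note sf = submodule_facts[OF F ag(2)]
  interpret E: abelian_group "sec E U" by (rule ag)
  show "submodule (L U) (hol_ring U) (sec E U)"
    by (rule submodule_of_abelian_group[OF ag(1)])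
       (use sf in \<open>auto simp: L[OF U] h_zero[OF U] h_add[OF U] h_smult[OF U] h_minus[OF U] add_in[OF U]
          smult_in[OF U] hol_ring_mero\<close>)
next
  fix U V assume U: "is_open X U" and V: "is_open U V"
  then have XV: "is_open X V" by auto
  have "res F U V \<in> L' U \<rightarrow> L' V" using L' U V unfolding hol_submodule_def by blast
  then show "res E U V \<in> L U \<rightarrow> L V"
    using U V XV by (auto simp: L[OF U] L[OF XV] h_res[OF U V] res_in[OF U V])
next
  fix \<U> s assume U: "\<forall>U\<in>\<U>. is_open X U" and s: "s \<in> secs E (\<Union>\<U>)" "\<forall>U\<in>\<U>. res E (\<Union>\<U>) U s \<in> L U"
  have un: "is_open X (\<Union>\<U>)" using U by auto
  have "\<forall>U\<in>\<U>. res F (\<Union>\<U>) U (h (\<Union>\<U>) s) \<in> L' U"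
  proof
    fix U assume u: "U \<in> \<U>"
    then have "is_open X U" "is_open (\<Union>\<U>) U" "res E (\<Union>\<U>) U s \<in> L U" using U s by auto
    then show "res F (\<Union>\<U>) U (h (\<Union>\<U>) s) \<in> L' U" using L h_res[OF un _ s(1)] by auto
  qed
  then have "h (\<Union>\<U>) s \<in> L' (\<Union>\<U>)"
    using L' U h_in[OF un s(1)] unfolding hol_submodule_def by blast
  then show "s \<in> L (\<Union>\<U>)" using L[OF un] s by blast
qed

lemma frame_transport:
  assumes L: "\<And>U. is_open X U \<Longrightarrow> L U = {s \<in> secs E U. h U s \<in> L' U}"
    and L': "\<And>U. is_open X U \<Longrightarrow> L' U \<subseteq> secs F U"
    and R: "\<And>V f. f \<in> carrier (R V) \<Longrightarrow> f \<in> carrier (mero_ring V)"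
    and U: "is_open X U" and f: "frame R n F L' U f"
  shows "frame R n E L U (\<lambda>i. hinv U (f i))"
  unfolding frame_def
proof (intro conjI allI impI ballI)
  have fi: "f i \<in> L' U" "f i \<in> secs F U" if "i < n" for i
    using f that L'[OF U] by (auto simp: frame_def)
  show "hinv U (f i) \<in> L U" if "i < n" for i
    using L[OF U] fi[OF that] by (auto simp: hinv_in[OF U] h_hinv[OF U])
  fix V s assume V: "is_open U V" and s: "s \<in> L V"
  then have XV: "is_open X V" using U by auto
  have sE: "s \<in> secs E V" and sF: "h V s \<in> L' V" using s L[OF XV] by auto
  have ki: "res E U V (hinv U (f i)) \<in> secs E V" if "i < n" for i
    using fi[OF that] res_in[OF U V] hinv_in[OF U] by blast
  have *: "s = finsum (sec E V) (\<lambda>i. c i \<odot>\<^bsub>sec E V\<^esub> res E U V (hinv U (f i))) {..<n} \<longleftrightarrow>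
      h V s = finsum (sec F V) (\<lambda>i. c i \<odot>\<^bsub>sec F V\<^esub> res F U V (f i)) {..<n}"
    if c: "c \<in> {..<n} \<rightarrow>\<^sub>E carrier (R V)" for c
  proof -
    have cc: "c i \<in> carrier (mero_ring V)" if "i < n" for i by (rule R, rule PiE_mem[OF c]) (simp add: that)
    interpret E: Module.module "mero_ring V" "sec E V" by (rule E_module[OF XV])
    interpret F: Module.module "mero_ring V" "sec F V" by (rule F_module[OF XV])
    have in': "(\<lambda>i. c i \<odot>\<^bsub>sec E V\<^esub> res E U V (hinv U (f i))) \<in> {..<n} \<rightarrow> secs E V"
      using cc ki by auto
    have "h V (finsum (sec E V) (\<lambda>i. c i \<odot>\<^bsub>sec E V\<^esub> res E U V (hinv U (f i))) {..<n}) =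
       finsum (sec F V) (\<lambda>i. h V (c i \<odot>\<^bsub>sec E V\<^esub> res E U V (hinv U (f i)))) {..<n}"
      by (rule linear_map_finsum[OF h_lin[OF XV] E.abelian_group_axioms F.abelian_group_axioms _ in']) simp
    also have "\<dots> = finsum (sec F V) (\<lambda>i. c i \<odot>\<^bsub>sec F V\<^esub> res F U V (f i)) {..<n}"
    proof (rule F.finsum_cong'[OF refl])
      show "(\<lambda>i. c i \<odot>\<^bsub>sec F V\<^esub> res F U V (f i)) \<in> {..<n} \<rightarrow> secs F V"
        using cc fi module_sheaf_res(1)[OF F_sheaf U V] by auto
      show "h V (c i \<odot>\<^bsub>sec E V\<^esub> res E U V (hinv U (f i))) = c i \<odot>\<^bsub>sec F V\<^esub> res F U V (f i)"
        if "i \<in> {..<n}" for i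
        using that by (simp add: h_smult[OF XV] cc ki h_res[OF U V] hinv_in[OF U] h_hinv[OF U] fi)
    qed
    finally show ?thesis using h_inj[OF XV sE E.finsum_closed[OF in']] by simp
  qed
  have "\<exists>!c. c \<in> {..<n} \<rightarrow>\<^sub>E carrier (R V) \<and>
     h V s = finsum (sec F V) (\<lambda>i. c i \<odot>\<^bsub>sec F V\<^esub> res F U V (f i)) {..<n}"
    by (rule bspec[OF mp[OF spec[OF conjunct2[OF conjunct2[OF f[unfolded frame_def]]]] V] sF])
  moreover have "(c \<in> {..<n} \<rightarrow>\<^sub>E carrier (R V) \<and>
        h V s = finsum (sec F V) (\<lambda>i. c i \<odot>\<^bsub>sec F V\<^esub> res F U V (f i)) {..<n}) \<longleftrightarrow>
      (c \<in> {..<n} \<rightarrow>\<^sub>E carrier (R V) \<and>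
        s = finsum (sec E V) (\<lambda>i. c i \<odot>\<^bsub>sec E V\<^esub> res E U V (hinv U (f i))) {..<n})" for c
    using * by (rule conj_cong[OF refl, OF sym])
  ultimately show "\<exists>!c. c \<in> {..<n} \<rightarrow>\<^sub>E carrier (R V) \<and>
      s = finsum (sec E V) (\<lambda>i. c i \<odot>\<^bsub>sec E V\<^esub> res E U V (hinv U (f i))) {..<n}"
    by (simp only:)
qed (use U in auto)

lemma locally_free_transport:
  assumes "\<And>U. is_open X U \<Longrightarrow> L U = {s \<in> secs E U. h U s \<in> L' U}"
    and "\<And>U. is_open X U \<Longrightarrow> L' U \<subseteq> secs F U"
    and "\<And>V f. f \<in> carrier (R V) \<Longrightarrow> f \<in> carrier (mero_ring V)"
    and "locally_free R n X F L'"
  shows "locally_free R n X E L"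
  using assms(4) frame_transport[OF assms(1-3)] unfolding locally_free_def by meson

lemma filtered_bundle_transport:
  assumes F: "filtered_bundle X n F"
  shows "filtered_bundle X n E"
  unfolding filtered_bundle_def
proof (intro conjI allI impI)
  have filE: "fil E \<alpha> U = {s \<in> secs E U. h U s \<in> fil F \<alpha> U}" if "is_open X U" for U \<alpha>
    using fil_iff[OF that] by blast
  have filF: "fil F \<alpha> U \<subseteq> secs F U" if "is_open X U" for U \<alpha> by (rule filtered_bundleD(9)[OF F that])
  show "module_sheaf X E" by (rule E_sheaf)
  show "locally_free mero_ring n X E (secs E)"
    by (rule locally_free_transport[of _ "secs F"]) (use filtered_bundleD(2)[OF F] h_in in auto)
  fix \<alpha>
  show "hol_submodule X E (fil E \<alpha>)"
    by (rule hol_submodule_transport[OF filE filtered_bundleD(3)[OF F]])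
  show "locally_free hol_ring n X E (fil E \<alpha>)"
    by (rule locally_free_transport[OF filE filF hol_ring_mero filtered_bundleD(4)[OF F]])
  fix \<beta> U
  show "fil E \<alpha> U \<subseteq> fil E \<beta> U" if "is_open X U" "\<alpha> \<le> \<beta>"
  proof -
    have "fil F \<alpha> U \<subseteq> fil F \<beta> U" by (rule filtered_bundleD(5)[OF F that])
    then show ?thesis using filE[OF that(1)] by blast
  qed
  show "fil E \<alpha> U = secs E U" if "is_open X U" "None \<notin> U"
  proof -
    have "fil F \<alpha> U = secs F U" by (rule filtered_bundleD(6)[OF F that])
    then show ?thesis using filE[OF that(1)] h_in[OF that(1)] by blast
  qed
  show "fil E \<alpha> U = (\<Inter>\<beta>\<in>{\<alpha><..}. fil E \<beta> U)" if "is_open X U"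
  proof -
    have "{s \<in> secs E U. h U s \<in> fil F \<alpha> U} =
        {s \<in> secs E U. h U s \<in> (\<Inter>\<beta>\<in>{\<alpha><..}. fil F \<beta> U)}"
      using filtered_bundleD(7)[OF F that, of \<alpha>] by (rule arg_cong)
    also have "\<dots> = (\<Inter>\<beta>\<in>{\<alpha><..}. {s \<in> secs E U. h U s \<in> fil F \<beta> U})"
      using gt_ex[of \<alpha>] by auto
    finally show ?thesis by (simp only: filE[OF that])
  qed
  show "fil E (\<alpha> - 1) U = (\<lambda>s. restr U inverse \<odot>\<^bsub>sec E U\<^esub> s) ` fil E \<alpha> U"
    if U: "is_open X U" and "None \<in> U" "Some 0 \<notin> U"
  proof -
    have inv: "restr U inverse \<in> carrier (mero_ring U)"
      by (rule restr_mero_ring) (use that pole_order_le_inverse in \<open>auto intro!: holomorphic_intros\<close>)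
    have eqF: "fil F (\<alpha> - 1) U = (\<lambda>s. restr U inverse \<odot>\<^bsub>sec F U\<^esub> s) ` fil F \<alpha> U"
      by (rule filtered_bundleD(8)[OF F that])
    show ?thesis
    proof (intro equalityI subsetI)
      fix s assume "s \<in> fil E (\<alpha> - 1) U"
      then have s: "s \<in> secs E U" "h U s \<in> fil F (\<alpha> - 1) U" using fil_iff[OF U] by auto
      then obtain t where t: "t \<in> fil F \<alpha> U" "h U s = restr U inverse \<odot>\<^bsub>sec F U\<^esub> t" using eqF by auto
      then have t': "t \<in> secs F U" using filF[OF U] by blast
      have "hinv U t \<in> fil E \<alpha> U" using fil_iff[OF U] hinv_in[OF U t'] h_hinv[OF U t'] t by simp
      moreover have "s = restr U inverse \<odot>\<^bsub>sec E U\<^esub> hinv U t"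
        using h_inj[OF U s(1) smult_in[OF U inv hinv_in[OF U t']]] h_smult[OF U inv hinv_in[OF U t']] h_hinv[OF U t'] t
        by simp
      ultimately show "s \<in> (\<lambda>s. restr U inverse \<odot>\<^bsub>sec E U\<^esub> s) ` fil E \<alpha> U" by blast
    next
      fix s assume "s \<in> (\<lambda>s. restr U inverse \<odot>\<^bsub>sec E U\<^esub> s) ` fil E \<alpha> U"
      then show "s \<in> fil E (\<alpha> - 1) U"
        using fil_iff[OF U] smult_in[OF U inv] h_smult[OF U inv] eqF by auto
    qed
  qed
qed

end

lemma fb_iso_mapD:
  assumes "fb_iso_map X E F h" "is_open X U"
  shows "linear_map (mero_ring U) (sec E U) (sec F U) (h U)" "bij_betw (h U) (secs E U) (secs F U)"
    "h U ` fil E \<alpha> U = fil F \<alpha> U"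
  using conjunct1[OF assms(1)[unfolded fb_iso_map_def]] assms(2) by simp_all

lemma bundle_isoI:
  assumes E: "module_sheaf X E" and F: "module_sheaf X F" and h: "fb_iso_map X E F h"
    and fil: "\<And>U \<alpha>. is_open X U \<Longrightarrow> fil E \<alpha> U \<subseteq> secs E U"
  shows "bundle_iso X E F h"
proof
  show "fb_iso_map X E F h" "module_sheaf X F" by (rule h, rule F)
  fix U assume U: "is_open X U"
  interpret E: Module.module "mero_ring U" "sec E U" by (rule module_sheaf_module[OF E U])
  show "h U \<zero>\<^bsub>sec E U\<^esub> = \<zero>\<^bsub>sec F U\<^esub>"
    by (rule linear_map_zero[OF fb_iso_mapD(1)[OF h U] E.abelian_group_axioms
        module_abelian_group[OF module_sheaf_module[OF F U]]])
  show "\<zero>\<^bsub>sec E U\<^esub> \<in> secs E U" by simp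
  show "s \<oplus>\<^bsub>sec E U\<^esub> t \<in> secs E U" if "s \<in> secs E U" "t \<in> secs E U" for s t using that by simp
  show "f \<odot>\<^bsub>sec E U\<^esub> s \<in> secs E U" if "f \<in> carrier (mero_ring U)" "s \<in> secs E U" for f s
    using that by simp
  show "fil E \<alpha> U \<subseteq> secs E U" for \<alpha> by (rule fil[OF U])
  show "res E U V s \<in> secs E V" if "is_open U V" "s \<in> secs E U" for V s
    by (rule module_sheaf_res(1)[OF E U that])
qed


section \<open>Coordinates on bundles isomorphic to the big bundle\<close>

lemma big_bundle_simps [simp]:
  "secs big_bundle U = carrier (mero_ring U) \<times> carrier (mero_ring U)"
  "p \<oplus>\<^bsub>sec big_bundle U\<^esub> q = (\<lambda>z. fst p z + fst q z, \<lambda>z. snd p z + snd q z)"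
  "f \<odot>\<^bsub>sec big_bundle U\<^esub> p = (\<lambda>z. f z * fst p z, \<lambda>z. f z * snd p z)"
  "\<zero>\<^bsub>sec big_bundle U\<^esub> = (\<lambda>_. 0, \<lambda>_. 0)"
  "res big_bundle U V p = (restr V (fst p), restr V (snd p))"
  by (simp_all add: big_bundle_def)

lemma fil_big_bundle:
  "fil big_bundle \<alpha> U = fil (line_bundle (1/4)) \<alpha> U \<times> fil (line_bundle (-1/4)) \<alpha> U"
  by (simp add: big_bundle_def)

lemma fil_big_bundle_iff:
  "p \<in> fil big_bundle \<alpha> U \<longleftrightarrow> p \<in> secs big_bundle U \<and>
     (None \<in> U \<longrightarrow> pole_order_le \<lfloor>\<alpha> + 1/4\<rfloor> (fst p) \<and> pole_order_le \<lfloor>\<alpha> - 1/4\<rfloor> (snd p))"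
  by (cases p) (auto simp: fil_big_bundle)

lemma frame_restrict:
  assumes E: "module_sheaf UNIV E" and f: "mero_frame n E U f" and V: "is_open U V"
  shows "mero_frame n E V (\<lambda>i. res E U V (f i))"
  unfolding frame_def
proof (intro conjI allI impI ballI)
  have U: "is_open UNIV U" using f by (simp add: frame_def)
  have V': "is_open UNIV V" using V by simp
  have fi: "f i \<in> secs E U" if "i < n" for i using f that by (auto simp: frame_def)
  show "res E U V (f i) \<in> secs E V" if "i < n" for i
    by (rule module_sheaf_res(1)[OF E U V fi[OF that]])
  fix W s assume W: "is_open V W" and s: "s \<in> secs E W"
  have UW: "is_open U W" using V W by auto
  interpret E: Module.module "mero_ring W" "sec E W"
    by (rule module_sheaf_module[OF E]) (use W in auto)
  have ex: "\<exists>!c. c \<in> {..<n} \<rightarrow>\<^sub>E carrier (mero_ring W) \<and>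
     s = finsum (sec E W) (\<lambda>i. c i \<odot>\<^bsub>sec E W\<^esub> res E U W (f i)) {..<n}"
    by (rule bspec[OF mp[OF spec[OF conjunct2[OF conjunct2[OF f[unfolded frame_def]]]] UW] s])
  have "finsum (sec E W) (\<lambda>i. c i \<odot>\<^bsub>sec E W\<^esub> res E U W (f i)) {..<n} =
     finsum (sec E W) (\<lambda>i. c i \<odot>\<^bsub>sec E W\<^esub> res E V W (res E U V (f i))) {..<n}"
    if c: "c \<in> {..<n} \<rightarrow>\<^sub>E carrier (mero_ring W)" for c
  proof (rule E.finsum_cong'[OF refl])
    have ci: "c i \<in> carrier (mero_ring W)" if "i < n" for i by (rule PiE_mem[OF c]) (simp add: that)
    have ri: "res E V W (res E U V (f i)) \<in> secs E W" if "i < n" for i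
      using module_sheaf_res(1)[OF E V' W] module_sheaf_res(1)[OF E U V fi[OF that]] by blast
    show "(\<lambda>i. c i \<odot>\<^bsub>sec E W\<^esub> res E V W (res E U V (f i))) \<in> {..<n} \<rightarrow> secs E W"
      using E.smult_closed[OF ci ri] by auto
    show "c i \<odot>\<^bsub>sec E W\<^esub> res E U W (f i) = c i \<odot>\<^bsub>sec E W\<^esub> res E V W (res E U V (f i))"
      if "i \<in> {..<n}" for i
      using module_sheaf_res(4)[OF E U V fi W] that by simp
  qed
  then have "(c \<in> {..<n} \<rightarrow>\<^sub>E carrier (mero_ring W) \<and>
       s = finsum (sec E W) (\<lambda>i. c i \<odot>\<^bsub>sec E W\<^esub> res E U W (f i)) {..<n}) \<longleftrightarrow>
     (c \<in> {..<n} \<rightarrow>\<^sub>E carrier (mero_ring W) \<and>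
       s = finsum (sec E W) (\<lambda>i. c i \<odot>\<^bsub>sec E W\<^esub> res E V W (res E U V (f i))) {..<n})" for c
    by (intro conj_cong refl) simp
  then show "\<exists>!c. c \<in> {..<n} \<rightarrow>\<^sub>E carrier (mero_ring W) \<and>
      s = finsum (sec E W) (\<lambda>i. c i \<odot>\<^bsub>sec E W\<^esub> res E V W (res E U V (f i))) {..<n}"
    using ex by (simp only:)
qed (use V in auto)

lemma frame_two_coeffs:
  assumes E: "module_sheaf UNIV E" and f: "mero_frame 2 E U f" and s: "s \<in> secs E U"
  shows "coeffs 2 E U f s 0 \<in> carrier (mero_ring U)" "coeffs 2 E U f s 1 \<in> carrier (mero_ring U)"
    "s = coeffs 2 E U f s 0 \<odot>\<^bsub>sec E U\<^esub> f 0 \<oplus>\<^bsub>sec E U\<^esub> coeffs 2 E U f s 1 \<odot>\<^bsub>sec E U\<^esub> f 1"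
proof -
  have U: "is_open UNIV U" using f by (simp add: frame_def)
  have fi: "f i \<in> secs E U" if "i < 2" for i using f that by (auto simp: frame_def)
  interpret E: Module.module "mero_ring U" "sec E U" by (rule module_sheaf_module[OF E U])
  let ?P = "\<lambda>c. c \<in> {..<2} \<rightarrow>\<^sub>E carrier (mero_ring U) \<and>
     s = finsum (sec E U) (\<lambda>i. c i \<odot>\<^bsub>sec E U\<^esub> f i) {..<2}"
  have cl: "c 0 \<in> carrier (mero_ring U)" "c 1 \<in> carrier (mero_ring U)"
    if "c \<in> {..<2::nat} \<rightarrow>\<^sub>E carrier (mero_ring U)" for c
    by (rule PiE_mem[OF that], simp)+
  have sum: "finsum (sec E U) (\<lambda>i. c i \<odot>\<^bsub>sec E U\<^esub> f i) {..<2} = c 0 \<odot>\<^bsub>sec E U\<^esub> f 0 \<oplus>\<^bsub>sec E U\<^esub> c 1 \<odot>\<^bsub>sec E U\<^esub> f 1"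
    if "c \<in> {..<2::nat} \<rightarrow>\<^sub>E carrier (mero_ring U)" for c
    using cl[OF that] fi by (intro finsum_lessThan(2)[OF E.abelian_monoid_axioms]) auto
  have sum': "finsum (sec E U) (\<lambda>i. c i \<odot>\<^bsub>sec E U\<^esub> res E U U (f i)) {..<2} =
     c 0 \<odot>\<^bsub>sec E U\<^esub> f 0 \<oplus>\<^bsub>sec E U\<^esub> c 1 \<odot>\<^bsub>sec E U\<^esub> f 1"
    if "c \<in> {..<2::nat} \<rightarrow>\<^sub>E carrier (mero_ring U)" for c
    using cl[OF that] fi by (subst finsum_lessThan(2)[OF E.abelian_monoid_axioms])
       (auto simp: module_sheaf_res_self[OF E U])
  have UU: "is_open U U" using U by simp
  have "\<exists>!c. c \<in> {..<2} \<rightarrow>\<^sub>E carrier (mero_ring U) \<and>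
     s = finsum (sec E U) (\<lambda>i. c i \<odot>\<^bsub>sec E U\<^esub> res E U U (f i)) {..<2}"
    by (rule bspec[OF mp[OF spec[OF conjunct2[OF conjunct2[OF f[unfolded frame_def]]]] UU] s])
  moreover have "(c \<in> {..<2} \<rightarrow>\<^sub>E carrier (mero_ring U) \<and>
     s = finsum (sec E U) (\<lambda>i. c i \<odot>\<^bsub>sec E U\<^esub> res E U U (f i)) {..<2}) \<longleftrightarrow> ?P c" for c
    by (intro conj_cong refl) (simp only: sum sum')
  ultimately have "\<exists>!c. ?P c" by (simp only:)
  then have P: "?P (coeffs 2 E U f s)" unfolding coeffs_def by (rule theI')
  show "coeffs 2 E U f s 0 \<in> carrier (mero_ring U)" "coeffs 2 E U f s 1 \<in> carrier (mero_ring U)"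
    "s = coeffs 2 E U f s 0 \<odot>\<^bsub>sec E U\<^esub> f 0 \<oplus>\<^bsub>sec E U\<^esub> coeffs 2 E U f s 1 \<odot>\<^bsub>sec E U\<^esub> f 1"
    using cl[OF conjunct1[OF P]] conjunct2[OF P] sum[OF conjunct1[OF P]] by (blast, blast, simp only:)
qed

text \<open>
  Through \<open>h\<close> every section has two coordinate functions. All data that are defined by coefficients in
  arbitrary frames are expressed by these coordinates below.
\<close>

locale big_iso =
  fixes E :: "'a fbundle" and h
  assumes E_shf: "module_sheaf UNIV E" and h_iso: "fb_iso_map UNIV E big_bundle h"
    and fil_subset: "\<And>U \<alpha>. openin CP1 U \<Longrightarrow> fil E \<alpha> U \<subseteq> secs E U"
begin

sublocale bundle_iso UNIV E big_bundle h
  by (rule bundle_isoI[OF E_shf filtered_bundleD(1)[OF filtered_big_bundle] h_iso fil_subset]) simp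

text \<open>
  The sections of \<open>E\<close> that correspond to the canonical sections of the two summands. Every index
  other than \<open>0\<close> stands for the second one.
\<close>

definition canon :: "nat \<Rightarrow> 'a" where
  "canon = (\<lambda>i. hinv UNIV (if i = 0 then (\<lambda>_. 1, \<lambda>_. 0) else (\<lambda>_. 0, \<lambda>_. 1)))"

abbreviation "c0 U s \<equiv> fst (h U s)"
abbreviation "c1 U s \<equiv> snd (h U s)"

lemma is_open_UNIV: "openin CP1 U \<Longrightarrow> is_open UNIV U" by simp

lemma restr_UNIV: "restr UNIV f = f" by (simp add: restr_def)

lemma const_mero_UNIV: "(\<lambda>_. c) \<in> carrier (mero_ring UNIV)"
  using restr_one_closed[OF open_UNIV_CP1] by (simp add: restr_UNIV)

lemma canon_in: "canon i \<in> secs E UNIV"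
  and h_canon: "h UNIV (canon i) = (if i = 0 then (\<lambda>_. 1, \<lambda>_. 0) else (\<lambda>_. 0, \<lambda>_. 1))"
proof -
  have *: "(if i = 0 then (\<lambda>_. 1, \<lambda>_. 0) else (\<lambda>_. 0, \<lambda>_. 1)) \<in> secs big_bundle UNIV"
    using const_mero_UNIV by simp
  show "canon i \<in> secs E UNIV" unfolding canon_def by (rule hinv_in[OF is_open_UNIV[OF open_UNIV_CP1] *])
  show "h UNIV (canon i) = (if i = 0 then (\<lambda>_. 1, \<lambda>_. 0) else (\<lambda>_. 0, \<lambda>_. 1))"
    unfolding canon_def by (rule h_hinv[OF is_open_UNIV[OF open_UNIV_CP1] *])
qed

lemma frame_canon: "mero_frame 2 E UNIV canon"
proof -
  have *: "secs big_bundle = (\<lambda>U. carrier (mero_ring U) \<times> carrier (mero_ring U))" by auto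
  have "mero_frame 2 big_bundle UNIV (\<lambda>i. if i = 0 then (\<lambda>_. 1, \<lambda>_. 0) else (\<lambda>_. 0, \<lambda>_. 1))"
    using canonical_line_frame[OF open_UNIV_CP1, of "1/4" "-1/4"]
    unfolding * by (simp only: restr_UNIV big_bundle_def)
  then show ?thesis
    unfolding canon_def
    by (intro frame_transport[of _ "secs big_bundle"]) (use h_in open_UNIV_CP1 in \<open>auto simp del: big_bundle_simps\<close>)
qed

lemma coords_mero:
  assumes "openin CP1 U" "s \<in> secs E U"
  shows "c0 U s \<in> carrier (mero_ring U)" "c1 U s \<in> carrier (mero_ring U)"
  using h_in[OF is_open_UNIV[OF assms(1)] assms(2)] by (auto simp: mem_Times_iff)

lemma frame_in: "mero_frame 2 E U f \<Longrightarrow> i < 2 \<Longrightarrow> f i \<in> secs E U"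
  and frame_open: "mero_frame 2 E U f \<Longrightarrow> openin CP1 U"
  by (auto simp: frame_def)

lemma coeffs_closed:
  assumes "mero_frame 2 E U f" "s \<in> secs E U" "i < 2"
  shows "coeffs 2 E U f s i \<in> carrier (mero_ring U)"
  using frame_two_coeffs(1,2)[OF E_shf assms(1,2)] assms(3) by (auto simp: less_2_cases_iff)

lemma coeffs_eq:
  assumes f: "mero_frame 2 E U f" and s: "s \<in> secs E U"
  shows "c0 U s z = coeffs 2 E U f s 0 z * c0 U (f 0) z + coeffs 2 E U f s 1 z * c0 U (f 1) z"
    "c1 U s z = coeffs 2 E U f s 0 z * c1 U (f 0) z + coeffs 2 E U f s 1 z * c1 U (f 1) z"
proof -
  note U = is_open_UNIV[OF frame_open[OF f]]
  note c = frame_two_coeffs[OF E_shf f s]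
  have f2: "f 0 \<in> secs E U" "f 1 \<in> secs E U" using frame_in[OF f] by auto
  have "h U s = h U (coeffs 2 E U f s 0 \<odot>\<^bsub>sec E U\<^esub> f 0 \<oplus>\<^bsub>sec E U\<^esub> coeffs 2 E U f s 1 \<odot>\<^bsub>sec E U\<^esub> f 1)"
    using c(3) by (rule arg_cong)
  also have "\<dots> = (\<lambda>z. coeffs 2 E U f s 0 z * c0 U (f 0) z + coeffs 2 E U f s 1 z * c0 U (f 1) z,
      \<lambda>z. coeffs 2 E U f s 0 z * c1 U (f 0) z + coeffs 2 E U f s 1 z * c1 U (f 1) z)"
    by (simp add: h_add[OF U] h_smult[OF U] smult_in[OF U] c(1,2)[unfolded One_nat_def] f2[unfolded One_nat_def])
  finally have eq: "h U s = \<dots>" .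
  show "c0 U s z = coeffs 2 E U f s 0 z * c0 U (f 0) z + coeffs 2 E U f s 1 z * c0 U (f 1) z"
    "c1 U s z = coeffs 2 E U f s 0 z * c1 U (f 0) z + coeffs 2 E U f s 1 z * c1 U (f 1) z"
    unfolding eq by simp_all
qed

abbreviation det where
  "det U f z \<equiv> c0 U (f 0) z * c1 U (f 1) z - c0 U (f 1) z * c1 U (f 0) z"

lemma h_res_canon:
  assumes "openin CP1 U"
  shows "h U (res E UNIV U (canon i)) = (restr U (\<lambda>_. if i = 0 then 1 else 0), restr U (\<lambda>_. if i = 0 then 0 else 1))"
  using h_res[OF is_open_UNIV[OF open_UNIV_CP1], of U "canon i"] assms canon_in by (simp add: h_canon)

lemma res_canon_in: "openin CP1 U \<Longrightarrow> res E UNIV U (canon i) \<in> secs E U"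
  using res_in[OF is_open_UNIV[OF open_UNIV_CP1], of U "canon i"] canon_in by simp

text \<open>
  The canonical sections are combinations of the frame, so the identity matrix is a product of the
  matrix of the frame with another matrix.
\<close>

lemma det_nonzero:
  assumes f: "mero_frame 2 E U f" and z: "Some z \<in> U"
  shows "det U f z \<noteq> 0"
proof
  assume d: "det U f z = 0"
  note U = frame_open[OF f]
  note A = coeffs_eq[OF f res_canon_in[OF U, of 0], of z] and B = coeffs_eq[OF f res_canon_in[OF U, of 1], of z]
  define a b c d where "a = c0 U (f 0) z" "b = c0 U (f 1) z" "c = c1 U (f 0) z" "d = c1 U (f 1) z"
  note abcd = this
  from A B z d obtain x y x' y' where
    "1 = x * a + y * b" "0 = x * c + y * d" "0 = x' * a + y' * b" "1 = x' * c + y' * d" "a * d - b * c = 0"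
    by (auto simp: h_res_canon[OF U] restr_apply abcd)
  then have "1 = (x * a + y * b) * (x' * c + y' * d) - (x * c + y * d) * (x' * a + y' * b)" by simp
  also have "\<dots> = (x * y' - y * x') * (a * d - b * c)" by (simp add: algebra_simps)
  finally show False using \<open>a * d - b * c = 0\<close> by simp
qed

lemma cramer:
  fixes s0 :: complex
  assumes "s0 = x * p0 + y * p1" "s1 = x * q0 + y * q1" "p0 * q1 - p1 * q0 \<noteq> 0"
  shows "x = (s0 * q1 - p1 * s1) / (p0 * q1 - p1 * q0)" "y = (p0 * s1 - s0 * q0) / (p0 * q1 - p1 * q0)"
  unfolding eq_divide_eq using assms(3) by (simp_all add: assms(1,2) algebra_simps)

text \<open>
  Outside \<open>U\<close> both sides vanish, the right-hand side because of division by zero. Hence the formula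
  holds at every point.
\<close>

lemma coeffs_cramer:
  assumes f: "mero_frame 2 E U f" and s: "s \<in> secs E U"
  shows "coeffs 2 E U f s 0 z = (c0 U s z * c1 U (f 1) z - c0 U (f 1) z * c1 U s z) / det U f z"
    "coeffs 2 E U f s (Suc 0) z = (c0 U (f 0) z * c1 U s z - c0 U s z * c1 U (f 0) z) / det U f z"
proof -
  have U: "openin CP1 U" by (rule frame_open[OF f])
  have "coeffs 2 E U f s 0 z = (c0 U s z * c1 U (f 1) z - c0 U (f 1) z * c1 U s z) / det U f z \<and>
    coeffs 2 E U f s 1 z = (c0 U (f 0) z * c1 U s z - c0 U s z * c1 U (f 0) z) / det U f z"
  proof (cases "Some z \<in> U")
    case True
    then show ?thesis using cramer[OF coeffs_eq[OF f s] det_nonzero[OF f True]] by blast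
  next
    case False
    then show ?thesis
      using mero_ring_outside[OF coeffs_closed[OF f s] False] mero_ring_outside[OF coords_mero(1)[OF U] False]
        mero_ring_outside[OF coords_mero(2)[OF U] False] s frame_in[OF f] by simp
  qed
  then show "coeffs 2 E U f s 0 z = (c0 U s z * c1 U (f 1) z - c0 U (f 1) z * c1 U s z) / det U f z"
    "coeffs 2 E U f s (Suc 0) z = (c0 U (f 0) z * c1 U s z - c0 U s z * c1 U (f 0) z) / det U f z" by simp_all
qed

lemma coeffs_canon:
  assumes "s \<in> secs E UNIV"
  shows "coeffs 2 E UNIV canon s 0 = c0 UNIV s" "coeffs 2 E UNIV canon s (Suc 0) = c1 UNIV s"
  by (auto simp: coeffs_cramer[OF frame_canon assms] h_canon)

lemma cramer_linear:
  fixes D :: complex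
  shows "((x * p0 + y * p1) * b - a * (x * q0 + y * q1)) / D = (p0 * b - a * q0) / D * x + (p1 * b - a * q1) / D * y"
    "(a * (x * q0 + y * q1) - (x * p0 + y * p1) * b) / D = (a * q0 - p0 * b) / D * x + (a * q1 - p1 * b) / D * y"
  by (simp_all add: algebra_simps add_divide_distrib diff_divide_distrib)

text \<open>
  By Cramer's rule, coefficients depend linearly on the coordinates of the section. This is the
  transformation law required of tensors and of sections of the pullback.
\<close>

lemma coeffs_trans:
  assumes f: "mero_frame 2 E U f" and g: "mero_frame 2 E V g" and UV: "V \<subseteq> U" and s: "s \<in> secs E U"
    and k: "k < 2" and z: "Some z \<in> V"
  shows "coeffs 2 E V g (res E U V s) k z =
    (\<Sum>i<2. coeffs 2 E V g (res E U V (f i)) k z * coeffs 2 E U f s i z)"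
proof -
  have U: "openin CP1 U" and V: "is_open U V" using frame_open[OF f] frame_open[OF g] UV by auto
  have r: "res E U V t \<in> secs E V" if "t \<in> secs E U" for t using res_in[OF is_open_UNIV[OF U] V that] .
  have hr: "h V (res E U V t) = (restr V (c0 U t), restr V (c1 U t))" if "t \<in> secs E U" for t
    using h_res[OF is_open_UNIV[OF U] V that] by simp
  have f2: "f 0 \<in> secs E U" "f (Suc 0) \<in> secs E U" using frame_in[OF f] by auto
  have D: "det V g z \<noteq> 0" by (rule det_nonzero[OF g z])
  have sum2: "(\<Sum>i<2. F i) = F 0 + F (Suc 0)" for F :: "nat \<Rightarrow> complex"
    by (simp add: numeral_2_eq_2)
  note eq = coeffs_eq[OF f s, of z]
  from k consider "k = 0" | "k = Suc 0" by (auto simp: less_2_cases_iff)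
  then show ?thesis
  proof cases
    case 1
    show ?thesis
      unfolding 1 sum2 coeffs_cramer(1)[OF g r[OF s]] coeffs_cramer(1)[OF g r[OF f2(1)]] coeffs_cramer(1)[OF g r[OF f2(2)]]
        hr[OF s] hr[OF f2(1)] hr[OF f2(2)] fst_conv snd_conv restr_apply eq One_nat_def if_P[OF z]
      by (rule cramer_linear)
  next
    case 2
    show ?thesis
      unfolding 2 sum2 coeffs_cramer(2)[OF g r[OF s]] coeffs_cramer(2)[OF g r[OF f2(1)]] coeffs_cramer(2)[OF g r[OF f2(2)]]
        hr[OF s] hr[OF f2(1)] hr[OF f2(2)] fst_conv snd_conv restr_apply eq One_nat_def if_P[OF z]
      by (rule cramer_linear)
  qed
qed

lemma coeffs_trans_canon:
  assumes f: "mero_frame 2 E U f" and s: "s \<in> secs E U" and k: "k < 2"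
  shows "coeffs 2 E U f s k z =
    coeffs 2 E U f (res E UNIV U (canon 0)) k z * c0 U s z + coeffs 2 E U f (res E UNIV U (canon 1)) k z * c1 U s z"
proof -
  have U: "openin CP1 U" by (rule frame_open[OF f])
  note cr = coeffs_cramer[OF f s, of z] coeffs_cramer[OF f res_canon_in[OF U], of 0 z]
     coeffs_cramer[OF f res_canon_in[OF U], of "Suc 0" z]
  show ?thesis
  proof (cases "Some z \<in> U")
    case False
    then show ?thesis
      using mero_ring_outside[OF coeffs_closed[OF f s k] False]
        mero_ring_outside[OF coeffs_closed[OF f res_canon_in[OF U] k] False] by simp
  next
    case True
    have D: "det U f z \<noteq> 0" by (rule det_nonzero[OF f True])
    show ?thesis
      using k D unfolding less_2_cases_iff
      by (elim disjE) (simp_all add: cr h_res_canon[OF U] restr_apply True diff_divide_distrib)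
  qed
qed

end


section \<open>Coordinates on the pullback along the ramified covering\<close>

lemma pullback_simps [simp]:
  "secs (pullback n E) V = pull_sections n E V"
  "\<sigma> \<oplus>\<^bsub>sec (pullback n E) V\<^esub> \<tau> = (\<lambda>W e i u. \<sigma> W e i u + \<tau> W e i u)"
  "f \<odot>\<^bsub>sec (pullback n E) V\<^esub> \<sigma> = (\<lambda>W e i u. f u * \<sigma> W e i u)"
  "\<zero>\<^bsub>sec (pullback n E) V\<^esub> = (\<lambda>W e i u. 0)"
  "res (pullback n E) V V' \<sigma> = (\<lambda>W e i. restr V' (\<sigma> W e i))"
  "fil (pullback n E) \<alpha> V = pull_fil n E \<alpha> V"
  by (simp_all add: pullback_def)

lemma Some_vimage_psi: "Some u \<in> \<psi> -` W \<longleftrightarrow> Some (u ^ 4) \<in> W"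
  by (simp add: \<psi>_def)

lemma mero_ring_power4_mult:
  assumes c: "c \<in> carrier (mero_ring W)" and f: "f \<in> carrier (mero_ring V)"
  shows "(\<lambda>u. c (u ^ 4) * f u) \<in> carrier (mero_ring (V \<inter> \<psi> -` W))"
  unfolding mero_ring_iff
proof (intro conjI allI impI)
  have "c \<circ> (\<lambda>u. u ^ 4) holomorphic_on {u. Some u \<in> V \<inter> \<psi> -` W}"
    by (rule holomorphic_on_compose)
       (use c in \<open>auto simp: mero_ring_iff Some_vimage_psi simp del: vimage_eq intro!: holomorphic_intros elim!: holomorphic_on_subset\<close>)
  moreover have "f holomorphic_on {u. Some u \<in> V \<inter> \<psi> -` W}"
    using f by (auto simp: mero_ring_iff elim!: holomorphic_on_subset)
  ultimately show "(\<lambda>u. c (u ^ 4) * f u) holomorphic_on {u. Some u \<in> V \<inter> \<psi> -` W}"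
    by (auto simp: o_def intro!: holomorphic_intros)
  show "c (u ^ 4) * f u = 0" if "Some u \<notin> V \<inter> \<psi> -` W" for u
    using that mero_ring_outside[OF c, of "u ^ 4"] mero_ring_outside[OF f, of u] by (auto simp: \<psi>_def)
  assume "None \<in> V \<inter> \<psi> -` W"
  then obtain m n where "pole_order_le m c" "pole_order_le n f"
    using mero_ring_pole_order[OF c] mero_ring_pole_order[OF f] by (auto simp: \<psi>_def)
  then show "\<exists>n. pole_order_le n (\<lambda>u. c (u ^ 4) * f u)"
    using pole_order_le_mult[OF pole_order_le_power4] by blast
qed

lemma sum_lessThan_2: "(\<Sum>i<2. F i) = F 0 + F (Suc 0)" for F :: "nat \<Rightarrow> 'a :: comm_monoid_add"
  by (simp add: numeral_2_eq_2)

context big_iso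
begin

text \<open>
  The section \<open>f\<^sub>0 \<psi>\<^sup>*e\<^sub>0 + f\<^sub>1 \<psi>\<^sup>*e\<^sub>1\<close> of the pullback, where \<open>e\<^sub>0\<close>, \<open>e\<^sub>1\<close> are the canonical sections. Its
  coefficients in a frame are obtained by expanding \<open>e\<^sub>0\<close> and \<open>e\<^sub>1\<close> in that frame.
\<close>

definition pull_ext :: "(complex \<Rightarrow> complex) \<Rightarrow> (complex \<Rightarrow> complex) \<Rightarrow> 'a pull" where
  "pull_ext f0 f1 = (\<lambda>W e i u. if mero_frame 2 E W e \<and> i < 2
     then coeffs 2 E W e (res E UNIV W (canon 0)) i (u ^ 4) * f0 u +
          coeffs 2 E W e (res E UNIV W (canon (Suc 0))) i (u ^ 4) * f1 u else 0)"

lemma res_canon_self: "res E UNIV UNIV (canon i) = canon i"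
  by (rule module_sheaf_res_self[OF E_shf is_open_UNIV[OF open_UNIV_CP1] canon_in])

lemma pull_ext_UNIV: "pull_ext f0 f1 UNIV canon 0 = f0" "pull_ext f0 f1 UNIV canon (Suc 0) = f1"
  using frame_canon by (simp_all add: pull_ext_def res_canon_self coeffs_canon canon_in h_canon)

lemma pull_ext_inject: "pull_ext f0 f1 = pull_ext g0 g1 \<longleftrightarrow> f0 = g0 \<and> f1 = g1"
  by (metis pull_ext_UNIV)

lemma pull_ext_in:
  assumes "f0 \<in> carrier (mero_ring V)" "f1 \<in> carrier (mero_ring V)"
  shows "pull_ext f0 f1 \<in> pull_sections 2 E V"
  unfolding pull_sections_def
proof (intro CollectI conjI allI impI)
  fix W e i
  show "if mero_frame 2 E W e \<and> i < 2 then pull_ext f0 f1 W e i \<in> carrier (mero_ring (V \<inter> \<psi> -` W))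
        else pull_ext f0 f1 W e i = (\<lambda>_. 0)"
  proof (cases "mero_frame 2 E W e \<and> i < 2")
    case True
    then have "coeffs 2 E W e (res E UNIV W (canon j)) i \<in> carrier (mero_ring W)" for j
      using coeffs_closed res_canon_in frame_open by blast
    then show ?thesis
      using True assms by (auto simp: pull_ext_def intro!: mero_ring_add mero_ring_power4_mult)
  qed (auto simp: pull_ext_def fun_eq_iff)
next
  fix W and e :: "nat \<Rightarrow> 'a" and W' and e' :: "nat \<Rightarrow> 'a" and i :: nat and u :: complex
  assume e: "mero_frame 2 E W e" and e': "mero_frame 2 E W' e'" and sub: "W' \<subseteq> W" and i: "i < 2"
    and u: "Some u \<in> V \<inter> \<psi> -` W'"
  have z: "Some (u ^ 4) \<in> W'" using u by (simp add: \<psi>_def)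
  have W: "is_open UNIV W" "is_open W W'" using frame_open[OF e] frame_open[OF e'] sub by auto
  have "res E UNIV W' (canon j) = res E W W' (res E UNIV W (canon j))" for j
    using module_sheaf_res(4)[OF E_shf is_open_UNIV[OF open_UNIV_CP1] W(1) canon_in W(2)] by simp
  then have "coeffs 2 E W' e' (res E UNIV W' (canon j)) i (u ^ 4) =
     (\<Sum>l<2. coeffs 2 E W' e' (res E W W' (e l)) i (u ^ 4) * coeffs 2 E W e (res E UNIV W (canon j)) l (u ^ 4))" for j
    using coeffs_trans[OF e e' sub res_canon_in[OF frame_open[OF e]] i z] by simp
  then show "pull_ext f0 f1 W' e' i u = (\<Sum>l<2. coeffs 2 E W' e' (res E W W' (e l)) i (u ^ 4) * pull_ext f0 f1 W e l u)"
    using e e' i by (simp add: pull_ext_def sum_lessThan_2 algebra_simps)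
qed

text \<open>
  The canonical frame lives over the whole projective line, so every frame is compared with it by the
  compatibility condition, and the coefficients in the canonical frame determine the section.
\<close>

lemma pull_sections_eq_pull_ext:
  assumes s: "\<sigma> \<in> pull_sections 2 E V"
  shows "\<sigma> = pull_ext (\<sigma> UNIV canon 0) (\<sigma> UNIV canon (Suc 0))"
    "\<sigma> UNIV canon 0 \<in> carrier (mero_ring V)" "\<sigma> UNIV canon (Suc 0) \<in> carrier (mero_ring V)"
proof -
  note S = s[unfolded pull_sections_def mem_Collect_eq]
  have in': "\<sigma> W e i \<in> carrier (mero_ring (V \<inter> \<psi> -` W))" if "mero_frame 2 E W e" "i < 2" for W e i
    using spec[OF spec[OF spec[OF conjunct1[OF S]]], of W e i] that by simp
  show c: "\<sigma> UNIV canon 0 \<in> carrier (mero_ring V)" "\<sigma> UNIV canon (Suc 0) \<in> carrier (mero_ring V)"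
    using in'[OF frame_canon, of 0] in'[OF frame_canon, of 1] by simp_all
  show "\<sigma> = pull_ext (\<sigma> UNIV canon 0) (\<sigma> UNIV canon (Suc 0))"
  proof (intro ext)
    fix W e i u
    show "\<sigma> W e i u = pull_ext (\<sigma> UNIV canon 0) (\<sigma> UNIV canon (Suc 0)) W e i u"
    proof (cases "mero_frame 2 E W e \<and> i < 2")
      case False
      then show ?thesis
        using spec[OF spec[OF spec[OF conjunct1[OF S]]], of W e i] by (simp add: pull_ext_def if_not_P[OF False])
    next
      case True
      then have e: "mero_frame 2 E W e" and i: "i < 2" by auto
      show ?thesis
      proof (cases "Some u \<in> V \<inter> \<psi> -` W")
        case u: True
        have "\<sigma> W e i u = (\<Sum>j<2. coeffs 2 E W e (res E UNIV W (canon j)) i (u ^ 4) * \<sigma> UNIV canon j u)"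
          using conjunct2[OF S] frame_canon e i u by blast
        then show ?thesis using True by (simp add: pull_ext_def sum_lessThan_2)
      next
        case False
        have "pull_ext (\<sigma> UNIV canon 0) (\<sigma> UNIV canon (Suc 0)) \<in> pull_sections 2 E V" by (rule pull_ext_in[OF c])
        then have "pull_ext (\<sigma> UNIV canon 0) (\<sigma> UNIV canon (Suc 0)) W e i \<in> carrier (mero_ring (V \<inter> \<psi> -` W))"
          unfolding pull_sections_def using True by (simp split: if_splits)
        then show ?thesis
          using mero_ring_outside[OF in'[OF e i] False] mero_ring_outside[OF _ False] by metis
      qed
    qed
  qed
qed

lemma pull_ext_cases:
  assumes "\<sigma> \<in> pull_sections 2 E V"
  obtains f0 f1 where "f0 \<in> carrier (mero_ring V)" "f1 \<in> carrier (mero_ring V)" "\<sigma> = pull_ext f0 f1"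
  using pull_sections_eq_pull_ext[OF assms] by blast

lemma pull_ext_in_iff:
  "pull_ext f0 f1 \<in> pull_sections 2 E V \<longleftrightarrow> f0 \<in> carrier (mero_ring V) \<and> f1 \<in> carrier (mero_ring V)"
  using pull_ext_in pull_sections_eq_pull_ext(2,3)[of "pull_ext f0 f1" V] by (auto simp: pull_ext_UNIV)

lemma pull_ext_add:
  "(\<lambda>W e i u. pull_ext f0 f1 W e i u + pull_ext g0 g1 W e i u) = pull_ext (\<lambda>u. f0 u + g0 u) (\<lambda>u. f1 u + g1 u)"
  and pull_ext_smult:
  "(\<lambda>W e i u. g u * pull_ext f0 f1 W e i u) = pull_ext (\<lambda>u. g u * f0 u) (\<lambda>u. g u * f1 u)"
  and pull_ext_restr:
  "(\<lambda>W e i. restr V (pull_ext f0 f1 W e i)) = pull_ext (restr V f0) (restr V f1)"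
  and pull_ext_zero: "(\<lambda>W e i u. 0) = pull_ext (\<lambda>_. 0) (\<lambda>_. 0)"
  by (auto simp: pull_ext_def fun_eq_iff algebra_simps restr_apply)

lemma pull_section_UNIV_canon:
  assumes W: "openin CP1 W" and t: "t \<in> secs E W"
  shows "pull_section 2 E W t UNIV canon 0 u = c0 W t (u ^ 4)"
    "pull_section 2 E W t UNIV canon (Suc 0) u = c1 W t (u ^ 4)"
proof -
  have fr: "mero_frame 2 E W (\<lambda>j. res E UNIV W (canon j))"
    by (rule frame_restrict[OF E_shf frame_canon]) (use W in auto)
  have res: "res E W W t = t" by (rule module_sheaf_res_self[OF E_shf is_open_UNIV[OF W] t])
  show "pull_section 2 E W t UNIV canon 0 u = c0 W t (u ^ 4)"
    "pull_section 2 E W t UNIV canon (Suc 0) u = c1 W t (u ^ 4)"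
    using frame_canon mero_ring_outside[OF coords_mero(1)[OF W t]] mero_ring_outside[OF coords_mero(2)[OF W t]]
    by (auto simp: pull_section_def res coeffs_cramer[OF fr t] h_res_canon[OF W] restr_apply)
qed

lemma pull_section_canon:
  "pull_section 2 E UNIV (canon l) W e i u = (if mero_frame 2 E W e \<and> i < 2
     then coeffs 2 E W e (res E UNIV W (canon l)) i (u ^ 4) else 0)"
proof (cases "mero_frame 2 E W e \<and> i < 2")
  case True
  then have e: "mero_frame 2 E W e" and i: "i < 2" by auto
  have W: "openin CP1 W" by (rule frame_open[OF e])
  have fr: "mero_frame 2 E W (\<lambda>j. res E W W (e j))"
    by (rule frame_restrict[OF E_shf e]) (use W in auto)
  have res: "res E W W (e j) = e j" if "j < 2" for j
    by (rule module_sheaf_res_self[OF E_shf is_open_UNIV[OF W] frame_in[OF e that]])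
  have "coeffs 2 E W (\<lambda>j. res E W W (e j)) (res E UNIV W (canon l)) i (u ^ 4) =
     coeffs 2 E W e (res E UNIV W (canon l)) i (u ^ 4)"
    using i unfolding less_2_cases_iff
    by (elim disjE) (simp_all add: coeffs_cramer[OF fr res_canon_in[OF W]] coeffs_cramer[OF e res_canon_in[OF W]] res)
  then show ?thesis using True by (simp add: pull_section_def)
qed (simp only: pull_section_def if_False cong: if_cong)

lemma canon_fil: "canon 0 \<in> fil E (-1/4) UNIV" "canon (Suc 0) \<in> fil E (1/4) UNIV"
  using canon_in const_mero_UNIV pole_order_le_const[of 0] pole_order_le_zero
  by (auto simp: fil_iff[OF is_open_UNIV[OF open_UNIV_CP1]] fil_big_bundle_iff h_canon)

text \<open>
  The pulled back canonical sections have orders \<open>4 * (- 1/4) = - 1\<close> and \<open>4 * (1/4) = 1\<close>. If \<open>g \<psi>\<^sup>*t\<close> is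
  one of the generators of step \<open>\<alpha>\<close>, with \<open>t\<close> in step \<open>\<beta>\<close>, then the coordinates of \<open>t\<close> have pole orders at
  most \<open>\<lfloor>\<beta> \<plusminus> 1/4\<rfloor>\<close>, and \<open>4 \<lfloor>\<beta> \<plusminus> 1/4\<rfloor> \<le> 4 \<beta> \<plusminus> 1\<close>. Conversely, the two canonical sections suffice as
  generators.
\<close>

lemma pull_fil_infinity_iff:
  assumes V: "openin CP1 V" "None \<in> V"
  shows "pull_ext f0 f1 \<in> pull_fil 2 E \<alpha> V \<longleftrightarrow> f0 \<in> carrier (mero_ring V) \<and> f1 \<in> carrier (mero_ring V) \<and>
    pole_order_le (\<lfloor>\<alpha>\<rfloor> + 1) f0 \<and> pole_order_le (\<lfloor>\<alpha>\<rfloor> - 1) f1" (is "?L \<longleftrightarrow> ?R")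
proof
  assume L: ?L
  then have in': "f0 \<in> carrier (mero_ring V)" "f1 \<in> carrier (mero_ring V)"
    by (auto simp: pull_fil_def pull_ext_in_iff)
  from L V(2) obtain V' W and m :: nat and \<beta> k g t where V': "is_open V V'" "None \<in> V'" and W: "openin CP1 W" "V' \<subseteq> \<psi> -` W"
    and l: "\<And>l. l < m \<Longrightarrow> 4 * \<beta> l + of_int (k l) \<le> \<alpha> \<and> t l \<in> fil E (\<beta> l) W \<and>
               g l \<in> carrier (mero_ring V') \<and> pole_order_le (k l) (g l)"
    and eq: "\<And>W' e i u. Some u \<in> V' \<Longrightarrow>
           pull_ext f0 f1 W' e i u = (\<Sum>l<m. g l u * pull_section 2 E W (t l) W' e i u)"
    unfolding pull_fil_def by blast
  have NW: "None \<in> W" using V'(2) W(2) by (auto simp: \<psi>_def)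
  have tl: "t l \<in> secs E W" "pole_order_le \<lfloor>\<beta> l + 1/4\<rfloor> (c0 W (t l))" "pole_order_le \<lfloor>\<beta> l - 1/4\<rfloor> (c1 W (t l))"
    if "l < m" for l
    using l[OF that] NW by (auto simp: fil_iff[OF is_open_UNIV[OF W(1)]] fil_big_bundle_iff)
  have fl: "k l + 4 * \<lfloor>\<beta> l + 1/4\<rfloor> \<le> \<lfloor>\<alpha>\<rfloor> + 1" "k l + 4 * \<lfloor>\<beta> l - 1/4\<rfloor> \<le> \<lfloor>\<alpha>\<rfloor> - 1" if "l < m" for l
  proof -
    have a: "4 * \<beta> l + of_int (k l) \<le> \<alpha>" using l[OF that] by blast
    have "of_int \<lfloor>\<beta> l + 1/4\<rfloor> \<le> \<beta> l + 1/4" "of_int \<lfloor>\<beta> l - 1/4\<rfloor> \<le> \<beta> l - 1/4"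
      by (rule of_int_floor_le)+
    then have "real_of_int (k l + 4 * \<lfloor>\<beta> l + 1/4\<rfloor> - 1) \<le> \<alpha>" "real_of_int (k l + 4 * \<lfloor>\<beta> l - 1/4\<rfloor> + 1) \<le> \<alpha>"
      using a unfolding of_int_add of_int_diff of_int_mult of_int_numeral of_int_1 by linarith+
    then show "k l + 4 * \<lfloor>\<beta> l + 1/4\<rfloor> \<le> \<lfloor>\<alpha>\<rfloor> + 1" "k l + 4 * \<lfloor>\<beta> l - 1/4\<rfloor> \<le> \<lfloor>\<alpha>\<rfloor> - 1"
      unfolding le_floor_iff[symmetric] by linarith+
  qed
  have ev: "\<forall>\<^sub>F u in at_infinity. Some u \<in> V'" using V' eventually_in_nhd_infinity by blast
  have "\<forall>\<^sub>F u in at_infinity. f0 u = (\<Sum>l<m. g l u * c0 W (t l) (u ^ 4))"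
    using ev
  proof eventually_elim
    case (elim u)
    have "f0 u = (\<Sum>l<m. g l u * pull_section 2 E W (t l) UNIV canon 0 u)"
      using eq[OF elim, of UNIV canon 0] by (simp add: pull_ext_UNIV)
    then show ?case using pull_section_UNIV_canon(1)[OF W(1) tl(1)] by simp
  qed
  moreover have "pole_order_le (\<lfloor>\<alpha>\<rfloor> + 1) (\<lambda>u. \<Sum>l<m. g l u * c0 W (t l) (u ^ 4))"
  proof (rule pole_order_le_sum)
    fix j assume "j \<in> {..<m}"
    then have j: "j < m" by simp
    show "pole_order_le (\<lfloor>\<alpha>\<rfloor> + 1) (\<lambda>u. g j u * c0 W (t j) (u ^ 4))"
      using l[OF j] by (intro pole_order_le_mult'[OF _ pole_order_le_power4[OF tl(2)[OF j]] fl(1)[OF j]]) blast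
  qed
  ultimately have 0: "pole_order_le (\<lfloor>\<alpha>\<rfloor> + 1) f0" by (rule iffD2[OF pole_order_le_cong])
  have "\<forall>\<^sub>F u in at_infinity. f1 u = (\<Sum>l<m. g l u * c1 W (t l) (u ^ 4))"
    using ev
  proof eventually_elim
    case (elim u)
    have "f1 u = (\<Sum>l<m. g l u * pull_section 2 E W (t l) UNIV canon (Suc 0) u)"
      using eq[OF elim, of UNIV canon "Suc 0"] by (simp add: pull_ext_UNIV)
    then show ?case using pull_section_UNIV_canon(2)[OF W(1) tl(1)] by simp
  qed
  moreover have "pole_order_le (\<lfloor>\<alpha>\<rfloor> - 1) (\<lambda>u. \<Sum>l<m. g l u * c1 W (t l) (u ^ 4))"
  proof (rule pole_order_le_sum)
    fix j assume "j \<in> {..<m}"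
    then have j: "j < m" by simp
    show "pole_order_le (\<lfloor>\<alpha>\<rfloor> - 1) (\<lambda>u. g j u * c1 W (t j) (u ^ 4))"
      using l[OF j] by (intro pole_order_le_mult'[OF _ pole_order_le_power4[OF tl(3)[OF j]] fl(2)[OF j]]) blast
  qed
  ultimately have 1: "pole_order_le (\<lfloor>\<alpha>\<rfloor> - 1) f1" by (rule iffD2[OF pole_order_le_cong])
  show ?R using in' 0 1 by blast
next
  assume R: ?R
  let ?\<beta> = "\<lambda>l :: nat. if l = 0 then - 1/4 else 1/4 :: real"
  let ?k = "\<lambda>l :: nat. if l = 0 then \<lfloor>\<alpha>\<rfloor> + 1 else \<lfloor>\<alpha>\<rfloor> - 1"
  let ?g = "\<lambda>l :: nat. if l = 0 then f0 else f1"
  have fl: "of_int \<lfloor>\<alpha>\<rfloor> \<le> \<alpha>" by linarith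
  show ?L
    unfolding pull_fil_def
  proof (intro CollectI conjI impI exI)
    show "pull_ext f0 f1 \<in> pull_sections 2 E V" using R by (simp add: pull_ext_in)
    show "\<forall>l<2. 4 * ?\<beta> l + of_int (?k l) \<le> \<alpha> \<and> canon l \<in> fil E (?\<beta> l) UNIV \<and>
               ?g l \<in> carrier (mero_ring V) \<and> pole_order_le (?k l) (?g l)"
      using R fl canon_fil by (auto simp: less_2_cases_iff)
    show "\<forall>W' e i u. Some u \<in> V \<longrightarrow>
           pull_ext f0 f1 W' e i u = (\<Sum>l<2. ?g l u * pull_section 2 E UNIV (canon l) W' e i u)"
      by (auto simp: sum_lessThan_2 pull_section_canon pull_ext_def)
  qed (use V open_UNIV_CP1 in auto)
qed

lemma pull_fil_affine: "None \<notin> V \<Longrightarrow> pull_fil 2 E \<alpha> V = pull_sections 2 E V"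
  by (auto simp: pull_fil_def)

lemma pull_fil_iff:
  assumes V: "openin CP1 V"
  shows "pull_ext f0 f1 \<in> pull_fil 2 E \<alpha> V \<longleftrightarrow> f0 \<in> carrier (mero_ring V) \<and> f1 \<in> carrier (mero_ring V) \<and>
    (None \<in> V \<longrightarrow> pole_order_le (\<lfloor>\<alpha>\<rfloor> + 1) f0 \<and> pole_order_le (\<lfloor>\<alpha>\<rfloor> - 1) f1)"
  using pull_fil_infinity_iff[OF V] pull_fil_affine pull_ext_in_iff by (cases "None \<in> V") auto

lemma pull_higgs_UNIV_canon:
  assumes "\<Phi> UNIV (canon 0) \<in> secs E UNIV" "\<Phi> UNIV (canon (Suc 0)) \<in> secs E UNIV"
  shows "pull_higgs 2 E \<Phi> (pull_ext f0 f1) UNIV canon 0 u = deriv (\<lambda>y. y powi (- 4)) (inverse u) *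
      (c0 UNIV (\<Phi> UNIV (canon 0)) (u ^ 4) * f0 u + c0 UNIV (\<Phi> UNIV (canon (Suc 0))) (u ^ 4) * f1 u)"
    "pull_higgs 2 E \<Phi> (pull_ext f0 f1) UNIV canon (Suc 0) u = deriv (\<lambda>y. y powi (- 4)) (inverse u) *
      (c1 UNIV (\<Phi> UNIV (canon 0)) (u ^ 4) * f0 u + c1 UNIV (\<Phi> UNIV (canon (Suc 0))) (u ^ 4) * f1 u)"
  using frame_canon by (simp_all add: pull_higgs_def pull_endo_def sum_lessThan_2 coeffs_canon assms pull_ext_UNIV)

text \<open>
  If \<open>x\<^sub>0\<close>, \<open>x\<^sub>1\<close> are the coefficients of a section in the frame \<open>e\<close>, then \<open>x\<^sub>0 e\<^sub>0 + x\<^sub>1 e\<^sub>1\<close> has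
  coordinates \<open>f\<^sub>0\<close>, \<open>f\<^sub>1\<close>; so the frame drops out, and the matrix of \<open>\<Phi>\<close> in the canonical sections acts,
  evaluated at \<open>z = u\<^sup>4\<close>.
\<close>

lemma pull_higgs_pull_ext:
  assumes "\<And>U s. openin CP1 U \<Longrightarrow> s \<in> secs E U \<Longrightarrow> \<Phi> U s \<in> secs E U \<and>
      h U (\<Phi> U s) = (\<lambda>z. a z * c0 U s z + b z * c1 U s z, \<lambda>z. c z * c0 U s z + d z * c1 U s z)"
  shows "pull_higgs 2 E \<Phi> (pull_ext f0 f1) =
     pull_ext (\<lambda>u. deriv (\<lambda>y. y powi (- 4)) (inverse u) * (a (u ^ 4) * f0 u + b (u ^ 4) * f1 u))
       (\<lambda>u. deriv (\<lambda>y. y powi (- 4)) (inverse u) * (c (u ^ 4) * f0 u + d (u ^ 4) * f1 u))"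
proof (intro ext)
  fix W and e :: "nat \<Rightarrow> 'a" and i :: nat and u :: complex
  let ?D = "deriv (\<lambda>y. y powi (- 4)) (inverse u)" and ?z = "u ^ 4"
  show "pull_higgs 2 E \<Phi> (pull_ext f0 f1) W e i u =
     pull_ext (\<lambda>u. deriv (\<lambda>y. y powi (- 4)) (inverse u) * (a (u ^ 4) * f0 u + b (u ^ 4) * f1 u))
       (\<lambda>u. deriv (\<lambda>y. y powi (- 4)) (inverse u) * (c (u ^ 4) * f0 u + d (u ^ 4) * f1 u)) W e i u"
  proof (cases "mero_frame 2 E W e \<and> i < 2")
    case False
    then show ?thesis by (simp add: pull_higgs_def pull_endo_def pull_ext_def if_not_P[OF False])
  next
    case True
    then have e: "mero_frame 2 E W e" and i: "i < 2" by auto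
    have W: "openin CP1 W" by (rule frame_open[OF e])
    have e01: "e 0 \<in> secs E W" "e (Suc 0) \<in> secs E W" using frame_in[OF e] by auto
    define C where "C j l = coeffs 2 E W e (res E UNIV W (canon l)) j ?z" for j l
    have ext: "pull_ext g0 g1 W e j u = C j 0 * g0 u + C j (Suc 0) * g1 u" if "j < 2" for g0 g1 j
      using e that by (simp add: pull_ext_def C_def)
    have ph: "coeffs 2 E W e (\<Phi> W s) i ?z =
        C i 0 * (a ?z * c0 W s ?z + b ?z * c1 W s ?z) + C i (Suc 0) * (c ?z * c0 W s ?z + d ?z * c1 W s ?z)"
      if "s \<in> secs E W" for s
      using coeffs_trans_canon[OF e conjunct1[OF assms[OF W that]] i, of ?z] conjunct2[OF assms[OF W that]]
      by (simp add: C_def)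
    show ?thesis
    proof (cases "Some ?z \<in> W")
      case False
      have "C i l = 0" for l
        unfolding C_def by (rule mero_ring_outside[OF coeffs_closed[OF e res_canon_in[OF W] i] False])
      then show ?thesis using True ext[OF i] ph[OF e01(1)] ph[OF e01(2)]
        by (simp add: pull_higgs_def pull_endo_def sum_lessThan_2)
    next
      case z: True
      have id: "1 = C 0 0 * c0 W (e 0) ?z + C (Suc 0) 0 * c0 W (e (Suc 0)) ?z"
        "0 = C 0 (Suc 0) * c0 W (e 0) ?z + C (Suc 0) (Suc 0) * c0 W (e (Suc 0)) ?z"
        "0 = C 0 0 * c1 W (e 0) ?z + C (Suc 0) 0 * c1 W (e (Suc 0)) ?z"
        "1 = C 0 (Suc 0) * c1 W (e 0) ?z + C (Suc 0) (Suc 0) * c1 W (e (Suc 0)) ?z"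
        using coeffs_eq[OF e res_canon_in[OF W, of 0], of ?z] coeffs_eq[OF e res_canon_in[OF W, of "Suc 0"], of ?z] z
        by (simp_all add: h_res_canon[OF W] restr_apply C_def)
      define p0 p1 q0 q1 x0 x1 where "p0 = c0 W (e 0) ?z" "p1 = c0 W (e (Suc 0)) ?z"
        "q0 = c1 W (e 0) ?z" "q1 = c1 W (e (Suc 0)) ?z"
        "x0 = C 0 0 * f0 u + C 0 (Suc 0) * f1 u" "x1 = C (Suc 0) 0 * f0 u + C (Suc 0) (Suc 0) * f1 u"
      note defs = this
      have "p0 * x0 + p1 * x1 = (C 0 0 * p0 + C (Suc 0) 0 * p1) * f0 u + (C 0 (Suc 0) * p0 + C (Suc 0) (Suc 0) * p1) * f1 u"
        unfolding defs(5,6) by (simp add: algebra_simps)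
      then have f0: "f0 u = p0 * x0 + p1 * x1" using id by (simp add: defs)
      have "q0 * x0 + q1 * x1 = (C 0 0 * q0 + C (Suc 0) 0 * q1) * f0 u + (C 0 (Suc 0) * q0 + C (Suc 0) (Suc 0) * q1) * f1 u"
        unfolding defs(5,6) by (simp add: algebra_simps)
      then have f1: "f1 u = q0 * x0 + q1 * x1" using id by (simp add: defs)
      have "pull_higgs 2 E \<Phi> (pull_ext f0 f1) W e i u =
        ?D * (coeffs 2 E W e (\<Phi> W (e 0)) i ?z * x0 + coeffs 2 E W e (\<Phi> W (e (Suc 0))) i ?z * x1)"
        using True by (simp add: pull_higgs_def pull_endo_def sum_lessThan_2 ext defs)
      also have "\<dots> = ?D * ((C i 0 * (a ?z * p0 + b ?z * q0) + C i (Suc 0) * (c ?z * p0 + d ?z * q0)) * x0 +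
          (C i 0 * (a ?z * p1 + b ?z * q1) + C i (Suc 0) * (c ?z * p1 + d ?z * q1)) * x1)"
        unfolding ph[OF e01(1)] ph[OF e01(2)] by (simp add: defs)
      also have "\<dots> = C i 0 * (?D * (a ?z * f0 u + b ?z * f1 u)) + C i (Suc 0) * (?D * (c ?z * f0 u + d ?z * f1 u))"
        unfolding f0 f1 by (simp add: algebra_simps)
      finally show ?thesis using ext[OF i] by simp
    qed
  qed
qed

end


section \<open>Irregular types from a frame of eigenvectors\<close>

lemma mero_ring_mult_disc:
  assumes f: "f \<in> carrier (mero_ring V)" and V: "V \<subseteq> disc R" and g: "g holomorphic_on {u. R < norm u}" "pole_order_le n g"
  shows "(\<lambda>u. f u * g u) \<in> carrier (mero_ring V)"
proof -
  have "{u. Some u \<in> V} \<subseteq> {u. R < norm u}" using V by (auto simp: disc_def)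
  then have "g holomorphic_on {u. Some u \<in> V}" using g(1) holomorphic_on_subset by blast
  moreover have "\<exists>n. pole_order_le n (\<lambda>u. f u * g u)" if "None \<in> V"
    using mero_ring_pole_order[OF f that] pole_order_le_mult[OF _ g(2)] by blast
  ultimately show ?thesis using f by (auto simp: mero_ring_iff intro!: holomorphic_intros)
qed

lemma sub_fbundle_simps [simp]:
  "secs (sub_fbundle E S) U = S U"
  "s \<oplus>\<^bsub>sec (sub_fbundle E S) U\<^esub> t = s \<oplus>\<^bsub>sec E U\<^esub> t"
  "f \<odot>\<^bsub>sec (sub_fbundle E S) U\<^esub> s = f \<odot>\<^bsub>sec E U\<^esub> s"
  "\<zero>\<^bsub>sec (sub_fbundle E S) U\<^esub> = \<zero>\<^bsub>sec E U\<^esub>"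
  "res (sub_fbundle E S) U V = res E U V"
  "fil (sub_fbundle E S) \<alpha> U = fil E \<alpha> U \<inter> S U"
  by (simp_all add: sub_fbundle_def)

lemma (in big_iso) pull_ext_diff_smult:
  "(\<lambda>W e i u. pull_ext f0 f1 W e i u - c u * pull_ext g0 g1 W e i u) =
     pull_ext (\<lambda>u. f0 u - c u * g0 u) (\<lambda>u. f1 u - c u * g1 u)"
  by (auto simp: pull_ext_def fun_eq_iff algebra_simps)

text \<open>
  A line in the pullback over a disc around infinity, spanned by \<open>p \<psi>\<^sup>*e\<^sub>0 + q \<psi>\<^sup>*e\<^sub>1\<close>. The orders of \<open>p\<close>
  and \<open>q\<close> place the spanning section in step \<open>0\<close>, and the order of \<open>1/q\<close> keeps it out of smaller steps.
  Hence its multiple by \<open>f\<close> lies in step \<open>\<alpha>\<close> iff \<open>f\<close> has pole order at most \<open>\<lfloor>\<alpha>\<rfloor>\<close>.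
\<close>

locale eigenline = big_iso E h for E :: "'a fbundle" and h +
  fixes R :: real and p q :: "complex \<Rightarrow> complex"
  assumes R: "R > 0"
    and hol: "p holomorphic_on {u. R < norm u}" "q holomorphic_on {u. R < norm u}"
    and q_nonzero: "\<And>u. R < norm u \<Longrightarrow> q u \<noteq> 0"
    and orders: "pole_order_le 1 p" "pole_order_le (-1) q" "pole_order_le 1 (\<lambda>u. inverse (q u))"
begin

definition emb :: "(complex \<Rightarrow> complex) \<Rightarrow> 'a pull" where
  "emb f = pull_ext (\<lambda>u. f u * p u) (\<lambda>u. f u * q u)"

definition line :: "complex option set \<Rightarrow> 'a pull set" where
  "line V = emb ` carrier (mero_ring V)"

text \<open>
  As \<open>q\<close> has no zeros on the disc, the second coordinate of a section recovers the factor in front of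
  the spanning section.
\<close>

definition coord :: "complex option set \<Rightarrow> 'a pull \<Rightarrow> complex \<Rightarrow> complex" where
  "coord V \<sigma> = (\<lambda>u. \<sigma> UNIV canon (Suc 0) u * inverse (q u))"

abbreviation Line where "Line \<equiv> sub_fbundle (pullback 2 E) line"

lemma norm_in_disc: "V \<subseteq> disc R \<Longrightarrow> Some u \<in> V \<Longrightarrow> R < norm u"
  by (auto simp: disc_def)

lemma coord_emb:
  assumes "f \<in> carrier (mero_ring V)" "V \<subseteq> disc R"
  shows "coord V (emb f) = f"
proof
  fix u
  show "coord V (emb f) u = f u"
    using q_nonzero[OF norm_in_disc[OF assms(2)], of u] mero_ring_outside[OF assms(1), of u]
    by (cases "Some u \<in> V") (auto simp: coord_def emb_def pull_ext_UNIV)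
qed

lemma emb_fil_iff:
  assumes f: "f \<in> carrier (mero_ring V)" and V: "is_open (disc R) V"
  shows "emb f \<in> pull_fil 2 E \<alpha> V \<longleftrightarrow> (None \<in> V \<longrightarrow> pole_order_le \<lfloor>\<alpha>\<rfloor> f)"
proof -
  have V': "openin CP1 V" "V \<subseteq> disc R" using V by auto
  have "pole_order_le (\<lfloor>\<alpha>\<rfloor> + 1) (\<lambda>u. f u * p u) \<and> pole_order_le (\<lfloor>\<alpha>\<rfloor> - 1) (\<lambda>u. f u * q u) \<longleftrightarrow>
     pole_order_le \<lfloor>\<alpha>\<rfloor> f" if N: "None \<in> V"
  proof safe
    assume "pole_order_le (\<lfloor>\<alpha>\<rfloor> - 1) (\<lambda>u. f u * q u)"
    then have "pole_order_le \<lfloor>\<alpha>\<rfloor> (\<lambda>u. f u * q u * inverse (q u))"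
      by (rule pole_order_le_mult'[OF _ orders(3)]) simp
    moreover have "\<forall>\<^sub>F u in at_infinity. f u * q u * inverse (q u) = f u"
      using eventually_in_nhd_infinity[OF V'(1) N]
      by eventually_elim (use q_nonzero norm_in_disc[OF V'(2)] in simp)
    ultimately show "pole_order_le \<lfloor>\<alpha>\<rfloor> f" by (rule iffD1[OF pole_order_le_cong, rotated])
  next
    assume "pole_order_le \<lfloor>\<alpha>\<rfloor> f"
    then show "pole_order_le (\<lfloor>\<alpha>\<rfloor> + 1) (\<lambda>u. f u * p u)" "pole_order_le (\<lfloor>\<alpha>\<rfloor> - 1) (\<lambda>u. f u * q u)"
      using pole_order_le_mult[OF _ orders(1)] pole_order_le_mult[OF _ orders(2), of "\<lfloor>\<alpha>\<rfloor>"] by simp_all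
  qed
  then show ?thesis
    unfolding emb_def pull_fil_iff[OF V'(1)]
    using mero_ring_mult_disc[OF f V'(2) hol(1) orders(1)] mero_ring_mult_disc[OF f V'(2) hol(2) orders(2)] by blast
qed

lemma emb_add: "(\<lambda>W e i u. emb f W e i u + emb g W e i u) = emb (\<lambda>u. f u + g u)"
  and emb_smult: "(\<lambda>W e i u. c u * emb f W e i u) = emb (\<lambda>u. c u * f u)"
  and emb_restr: "(\<lambda>W e i. restr V (emb f W e i)) = emb (restr V f)"
  and emb_zero: "(\<lambda>W e i u. 0) = emb (\<lambda>_. 0)"
proof -
  have [simp]: "restr V (\<lambda>u. f u * g u) = (\<lambda>u. restr V f u * g u)" for f g
    by (auto simp: restr_def)
  show "(\<lambda>W e i u. emb f W e i u + emb g W e i u) = emb (\<lambda>u. f u + g u)"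
    "(\<lambda>W e i u. c u * emb f W e i u) = emb (\<lambda>u. c u * f u)"
    "(\<lambda>W e i. restr V (emb f W e i)) = emb (restr V f)"
    "(\<lambda>W e i u. 0) = emb (\<lambda>_. 0)"
    by (simp_all add: emb_def pull_ext_add pull_ext_smult pull_ext_restr pull_ext_zero distrib_right mult.assoc)
qed

lemma fb_iso_map_Line: "fb_iso_map (disc R) Line (line_bundle 0) coord"
  unfolding fb_iso_map_def
proof (intro conjI allI impI ballI)
  fix V assume V: "is_open (disc R) V"
  then have V': "openin CP1 V" "V \<subseteq> disc R" by auto
  show "linear_map (mero_ring V) (sec Line V) (sec (line_bundle 0) V) (coord V)"
    unfolding linear_map_def
    by (auto simp: line_def emb_add emb_smult coord_emb V' mero_ring_add mero_ring_mult)
  have inj: "inj_on (coord V) (line V)"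
    unfolding line_def by (auto simp: inj_on_def coord_emb V')
  have im: "coord V ` emb ` A = A" if "A \<subseteq> carrier (mero_ring V)" for A
    unfolding image_image using that by (auto simp: coord_emb[OF _ V'(2)] image_iff subset_iff)
  show "bij_betw (coord V) (secs Line V) (secs (line_bundle 0) V)"
    unfolding bij_betw_def using inj im[OF subset_refl] by (simp add: line_def)
  fix \<alpha>
  have "fil Line \<alpha> V = emb ` fil (line_bundle 0) \<alpha> V"
    using emb_fil_iff[OF _ V] by (auto simp: line_def)
  then show "coord V ` fil Line \<alpha> V = fil (line_bundle 0) \<alpha> V" using im by auto
next
  fix U V s assume U: "is_open (disc R) U" and V: "is_open U V" and s: "s \<in> secs Line U"
  then obtain f where f: "f \<in> carrier (mero_ring U)" "s = emb f" by (auto simp: line_def)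
  have "restr V f \<in> carrier (mero_ring V)" by (rule restr_closed[OF f(1) V])
  then show "coord V (res Line U V s) = res (line_bundle 0) U V (coord U s)"
    using f U V by (auto simp: emb_restr coord_emb)
qed

text \<open>
  With its induced filtration the line is a copy of \<open>\<O>(0)\<close> on the disc.
\<close>

lemma Line_bundle_iso: "bundle_iso (disc R) Line (line_bundle 0) coord"
proof
  show "fb_iso_map (disc R) Line (line_bundle 0) coord" by (rule fb_iso_map_Line)
  show "module_sheaf (disc R) (line_bundle 0)" by (rule module_sheaf_line_bundle)
  fix U assume U: "is_open (disc R) U"
  then show "\<zero>\<^bsub>sec Line U\<^esub> \<in> secs Line U"
    using mero_ring_zero by (auto simp: emb_zero line_def)
  show "coord U \<zero>\<^bsub>sec Line U\<^esub> = \<zero>\<^bsub>sec (line_bundle 0) U\<^esub>" by (simp add: coord_def)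
  show "s \<oplus>\<^bsub>sec Line U\<^esub> t \<in> secs Line U" if "s \<in> secs Line U" "t \<in> secs Line U" for s t
    using that by (auto simp: line_def emb_add mero_ring_add)
  show "f \<odot>\<^bsub>sec Line U\<^esub> s \<in> secs Line U" if "f \<in> carrier (mero_ring U)" "s \<in> secs Line U" for f s
    using that by (auto simp: line_def emb_smult mero_ring_mult)
  show "res Line U V s \<in> secs Line V" if "is_open U V" "s \<in> secs Line U" for V s
    using that by (auto simp: line_def emb_restr intro!: imageI restr_closed)
  show "fil Line \<alpha> U \<subseteq> secs Line U" for \<alpha> by simp
qed

lemma filtered_Line: "filtered_bundle (disc R) 1 Line"
  using bundle_iso.filtered_bundle_transport[OF Line_bundle_iso filtered_line_bundle[OF open_disc]] .

lemma pole_order_filtration_Line: "pole_order_filtration (disc R) 1 Line"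
  unfolding pole_order_filtration_def
proof (intro exI[of _ "fil Line 0"] conjI allI impI)
  show "hol_submodule (disc R) Line (fil Line 0)" "locally_free hol_ring 1 (disc R) Line (fil Line 0)"
    by (rule filtered_bundleD(3,4)[OF filtered_Line])+
  show "fil Line 0 U = secs Line U" if "is_open (disc R) U" "None \<notin> U" for U
    by (rule filtered_bundleD(6)[OF filtered_Line that])
  fix \<alpha> :: real and U assume U: "is_open (disc R) U" and N: "None \<in> U" and "Some 0 \<notin> U"
  have nz: "u \<noteq> 0" if "Some u \<in> U" for u using that \<open>Some 0 \<notin> U\<close> by auto
  let ?y = "restr U (\<lambda>u. inverse u powi \<lfloor>\<alpha>\<rfloor>)"
  have po: "pole_order_le (- \<lfloor>\<alpha>\<rfloor>) (\<lambda>u. inverse u powi \<lfloor>\<alpha>\<rfloor>)"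
    using pole_order_le_powi[of "- \<lfloor>\<alpha>\<rfloor>"] by (simp add: power_int_inverse power_int_minus)
  have y: "?y \<in> carrier (mero_ring U)" "pole_order_le (- \<lfloor>\<alpha>\<rfloor>) ?y"
    using U po nz N by (auto intro!: restr_mero_ring holomorphic_intros simp: pole_order_le_restr)
  have "emb f \<in> pull_fil 2 E \<alpha> U \<longleftrightarrow> emb (\<lambda>u. ?y u * f u) \<in> pull_fil 2 E 0 U" if f: "f \<in> carrier (mero_ring U)" for f
  proof -
    have "pole_order_le \<lfloor>\<alpha>\<rfloor> f \<longleftrightarrow> pole_order_le 0 (\<lambda>u. ?y u * f u)"
    proof
      show "pole_order_le \<lfloor>\<alpha>\<rfloor> f \<Longrightarrow> pole_order_le 0 (\<lambda>u. ?y u * f u)"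
        by (rule pole_order_le_mult'[OF y(2)]) auto
      assume "pole_order_le 0 (\<lambda>u. ?y u * f u)"
      then have "pole_order_le \<lfloor>\<alpha>\<rfloor> (\<lambda>u. u powi \<lfloor>\<alpha>\<rfloor> * (?y u * f u))"
        by (rule pole_order_le_mult'[OF pole_order_le_powi]) simp
      moreover have "\<forall>\<^sub>F u in at_infinity. u powi \<lfloor>\<alpha>\<rfloor> * (?y u * f u) = f u"
        using eventually_in_nhd_infinity[OF conjunct1[OF U] N] eventually_nonzero_at_infinity
        by eventually_elim (simp add: restr_apply power_int_inverse)
      ultimately show "pole_order_le \<lfloor>\<alpha>\<rfloor> f" by (rule iffD1[OF pole_order_le_cong, rotated])
    qed
    then show ?thesis using emb_fil_iff[OF _ U] f mero_ring_mult[OF y(1) f] N by simp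
  qed
  then show "fil Line \<alpha> U = {s \<in> secs Line U. ?y \<odot>\<^bsub>sec Line U\<^esub> s \<in> fil Line 0 U}"
    using mero_ring_mult[OF y(1)] by (auto simp: line_def emb_smult)
qed

end

text \<open>
  Two lines whose generators have the same second coordinate. Their determinant is \<open>(p\<^sub>1 - p\<^sub>2) q\<close>. The
  bound for the inverse of \<open>p\<^sub>1 - p\<^sub>2\<close> says that this determinant has order exactly \<open>0\<close>, and so the two lines
  together span every step of the pullback.
\<close>

locale eigenlines = big_iso E h for E :: "'a fbundle" and h +
  fixes R :: real and p1 p2 q :: "complex \<Rightarrow> complex"
  assumes line1: "eigenline E h R p1 q" and line2: "eigenline E h R p2 q"
    and p_diff_nonzero: "\<And>u. R < norm u \<Longrightarrow> p1 u - p2 u \<noteq> 0"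
    and order_diff: "pole_order_le (-1) (\<lambda>u. inverse (p1 u - p2 u))"
begin

sublocale L1: eigenline E h R p1 q by (rule line1)
sublocale L2: eigenline E h R p2 q by (rule line2)

text \<open>
  Cramer's rule for the generators \<open>(p\<^sub>1, q)\<close> and \<open>(p\<^sub>2, q)\<close>.
\<close>

lemma decompose:
  assumes V: "is_open (disc R) V" and g: "g0 \<in> carrier (mero_ring V)" "g1 \<in> carrier (mero_ring V)"
  defines "f1 \<equiv> (\<lambda>u. (g0 u - g1 u * inverse (q u) * p2 u) * inverse (p1 u - p2 u))"
  defines "f2 \<equiv> (\<lambda>u. g1 u * inverse (q u) - f1 u)"
  shows "f1 \<in> carrier (mero_ring V)" "f2 \<in> carrier (mero_ring V)"
    "pull_ext g0 g1 = pull_ext (\<lambda>u. f1 u * p1 u + f2 u * p2 u) (\<lambda>u. f1 u * q u + f2 u * q u)"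
    "pole_order_le (n + 1) g0 \<Longrightarrow> pole_order_le (n - 1) g1 \<Longrightarrow> pole_order_le n f1 \<and> pole_order_le n f2"
proof -
  have V': "V \<subseteq> disc R" using V by auto
  have hi: "(\<lambda>u. inverse (q u)) holomorphic_on {u. R < norm u}"
    "(\<lambda>u. inverse (p1 u - p2 u)) holomorphic_on {u. R < norm u}"
    using L1.hol L2.hol L1.q_nonzero p_diff_nonzero by (auto intro!: holomorphic_intros)
  have gq: "(\<lambda>u. g1 u * inverse (q u)) \<in> carrier (mero_ring V)"
    by (rule mero_ring_mult_disc[OF g(2) V' hi(1) L1.orders(3)])
  show f1: "f1 \<in> carrier (mero_ring V)"
    unfolding f1_def
    by (intro mero_ring_mult_disc[OF _ V' hi(2) order_diff] mero_ring_diff g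
        mero_ring_mult_disc[OF _ V' L2.hol(1) L2.orders(1)] gq)
  show f2: "f2 \<in> carrier (mero_ring V)"
    unfolding f2_def by (intro mero_ring_diff gq f1)
  have sums: "f1 u * p1 u + f2 u * p2 u = g0 u \<and> f1 u * q u + f2 u * q u = g1 u" for u
  proof -
    consider "Some u \<notin> V" | "Some u \<in> V" "R < norm u" using L1.norm_in_disc[OF V'] by blast
    then show ?thesis
    proof cases
      case 1
      then show ?thesis
        using mero_ring_outside[OF f1] mero_ring_outside[OF f2] mero_ring_outside[OF g(1)] mero_ring_outside[OF g(2)]
        by simp_all
    next
      case 2
      have "f1 u * p1 u + f2 u * p2 u = f1 u * (p1 u - p2 u) + g1 u * inverse (q u) * p2 u"
        by (simp add: f2_def algebra_simps)
      also have "f1 u * (p1 u - p2 u) = g0 u - g1 u * inverse (q u) * p2 u"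
        using p_diff_nonzero[OF 2(2)] by (simp add: f1_def)
      finally have "f1 u * p1 u + f2 u * p2 u = g0 u" by simp
      moreover have "f1 u * q u + f2 u * q u = g1 u * inverse (q u) * q u" by (simp add: f2_def algebra_simps)
      then have "f1 u * q u + f2 u * q u = g1 u" using L1.q_nonzero[OF 2(2)] by simp
      ultimately show ?thesis ..
    qed
  qed
  show "pull_ext g0 g1 = pull_ext (\<lambda>u. f1 u * p1 u + f2 u * p2 u) (\<lambda>u. f1 u * q u + f2 u * q u)"
    by (simp only: sums)
  assume o: "pole_order_le (n + 1) g0" "pole_order_le (n - 1) g1"
  have gqo: "pole_order_le n (\<lambda>u. g1 u * inverse (q u))"
    by (rule pole_order_le_mult'[OF o(2) L1.orders(3)]) simp
  have f1o: "pole_order_le n f1"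
    unfolding f1_def
    by (rule pole_order_le_mult'[OF _ order_diff, of "n + 1"], rule pole_order_le_diff[OF o(1)],
        rule pole_order_le_mult'[OF gqo L2.orders(1)]) simp_all
  then show "pole_order_le n f1 \<and> pole_order_le n f2"
    unfolding f2_def using pole_order_le_diff[OF gqo] by blast
qed

lemma emb_sum:
  "(\<lambda>W e i u. L1.emb f1 W e i u + L2.emb f2 W e i u) =
     pull_ext (\<lambda>u. f1 u * p1 u + f2 u * p2 u) (\<lambda>u. f1 u * q u + f2 u * q u)"
  by (simp add: L1.emb_def L2.emb_def pull_ext_add)

lemma direct_sum_iso:
  "fb_iso_map (disc R) (direct_sum L1.Line L2.Line) (pullback 2 E) (\<lambda>V (\<sigma>, \<tau>). \<sigma> \<oplus>\<^bsub>sec (pullback 2 E) V\<^esub> \<tau>)"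
  unfolding fb_iso_map_def
proof (intro conjI allI impI ballI)
  fix V assume V: "is_open (disc R) V"
  then have V': "openin CP1 V" "V \<subseteq> disc R" by auto
  let ?h = "\<lambda>(\<sigma>, \<tau>). \<sigma> \<oplus>\<^bsub>sec (pullback 2 E) V\<^esub> \<tau>"
  have closed: "(\<lambda>W e i u. L1.emb f1 W e i u + L2.emb f2 W e i u) \<in> pull_sections 2 E V"
    if "f1 \<in> carrier (mero_ring V)" "f2 \<in> carrier (mero_ring V)" for f1 f2
    unfolding emb_sum
    by (intro pull_ext_in mero_ring_add mero_ring_mult_disc[OF that(1) V'(2) L1.hol(1) L1.orders(1)]
        mero_ring_mult_disc[OF that(2) V'(2) L2.hol(1) L2.orders(1)]
        mero_ring_mult_disc[OF that(1) V'(2) L2.hol(2) L2.orders(2)]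
        mero_ring_mult_disc[OF that(2) V'(2) L2.hol(2) L2.orders(2)])
  show "linear_map (mero_ring V) (sec (direct_sum L1.Line L2.Line) V) (sec (pullback 2 E) V) ?h"
    unfolding linear_map_def by (auto simp: L1.line_def L2.line_def closed algebra_simps fun_eq_iff)
  have inj: "inj_on ?h (secs (direct_sum L1.Line L2.Line) V)"
  proof (rule inj_onI)
    fix s t assume s: "s \<in> secs (direct_sum L1.Line L2.Line) V" and t: "t \<in> secs (direct_sum L1.Line L2.Line) V"
      and eq: "?h s = ?h t"
    obtain f1 f2 where f: "f1 \<in> carrier (mero_ring V)" "f2 \<in> carrier (mero_ring V)" "s = (L1.emb f1, L2.emb f2)"
      using s by (cases s) (auto simp: L1.line_def L2.line_def)
    obtain g1 g2 where g: "g1 \<in> carrier (mero_ring V)" "g2 \<in> carrier (mero_ring V)" "t = (L1.emb g1, L2.emb g2)"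
      using t by (cases t) (auto simp: L1.line_def L2.line_def)
    have e: "f1 u * p1 u + f2 u * p2 u = g1 u * p1 u + g2 u * p2 u" "f1 u * q u + f2 u * q u = g1 u * q u + g2 u * q u" for u
    proof -
      have "pull_ext (\<lambda>u. f1 u * p1 u + f2 u * p2 u) (\<lambda>u. f1 u * q u + f2 u * q u) =
        pull_ext (\<lambda>u. g1 u * p1 u + g2 u * p2 u) (\<lambda>u. g1 u * q u + g2 u * q u)"
        using eq unfolding f(3) g(3) by (simp only: prod.case pullback_simps emb_sum)
      then show "f1 u * p1 u + f2 u * p2 u = g1 u * p1 u + g2 u * p2 u" "f1 u * q u + f2 u * q u = g1 u * q u + g2 u * q u"
        unfolding pull_ext_inject by (metis, metis)
    qed
    have "f1 u = g1 u \<and> f2 u = g2 u" for u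
    proof (cases "Some u \<in> V")
      case True
      then have r: "R < norm u" by (rule L1.norm_in_disc[OF V'(2)])
      have "(f1 u + f2 u - g1 u - g2 u) * q u = 0" using e(2)[of u] by (simp add: algebra_simps)
      then have "f1 u + f2 u - g1 u - g2 u = 0" using L1.q_nonzero[OF r] unfolding mult_eq_0_iff by blast
      then have 1: "f2 u - g2 u = - (f1 u - g1 u)" by (simp add: algebra_simps)
      have "(f1 u - g1 u) * p1 u + (f2 u - g2 u) * p2 u = 0" using e(1)[of u] by (simp add: algebra_simps)
      then have "(f1 u - g1 u) * (p1 u - p2 u) = 0" unfolding 1 by (simp add: algebra_simps)
      then have "f1 u = g1 u" using p_diff_nonzero[OF r] unfolding mult_eq_0_iff by simp
      then show ?thesis using 1 by simp
    qed (simp add: mero_ring_outside[OF f(1)] mero_ring_outside[OF f(2)] mero_ring_outside[OF g(1)]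
        mero_ring_outside[OF g(2)])
    then have "f1 = g1" "f2 = g2" by auto
    then show "s = t" using f g by simp
  qed
  have surj: "\<sigma> \<in> ?h ` (L1.line V \<times> L2.line V)" if \<sigma>: "\<sigma> \<in> pull_sections 2 E V" for \<sigma>
  proof -
    obtain g0 g1 where g: "g0 \<in> carrier (mero_ring V)" "g1 \<in> carrier (mero_ring V)" "\<sigma> = pull_ext g0 g1"
      by (rule pull_ext_cases[OF \<sigma>])
    note d = decompose(1-3)[OF V g(1,2)]
    show ?thesis
      unfolding g(3) d(3) emb_sum[symmetric]
      using d(1,2) by (intro image_eqI[of _ _ "(_, _)"]) (auto simp: L1.line_def L2.line_def)
  qed
  show "bij_betw ?h (secs (direct_sum L1.Line L2.Line) V) (secs (pullback 2 E) V)"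
    unfolding bij_betw_def
  proof
    show "?h ` secs (direct_sum L1.Line L2.Line) V = secs (pullback 2 E) V"
      using surj closed by (auto simp: L1.line_def L2.line_def)
  qed (rule inj)
  fix \<alpha>
  show "?h ` fil (direct_sum L1.Line L2.Line) \<alpha> V = fil (pullback 2 E) \<alpha> V"
  proof (intro equalityI subsetI)
    fix \<sigma> assume "\<sigma> \<in> ?h ` fil (direct_sum L1.Line L2.Line) \<alpha> V"
    then obtain f1 f2 where f: "f1 \<in> carrier (mero_ring V)" "f2 \<in> carrier (mero_ring V)"
      "L1.emb f1 \<in> pull_fil 2 E \<alpha> V" "L2.emb f2 \<in> pull_fil 2 E \<alpha> V"
      "\<sigma> = (\<lambda>W e i u. L1.emb f1 W e i u + L2.emb f2 W e i u)"
      by (auto simp: L1.line_def L2.line_def)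
    have "\<sigma> \<in> pull_fil 2 E \<alpha> V"
      using f(3,4) unfolding f(5) L1.emb_def L2.emb_def pull_ext_add pull_fil_iff[OF V'(1)]
      by (auto intro: mero_ring_add pole_order_le_add)
    then show "\<sigma> \<in> fil (pullback 2 E) \<alpha> V" by simp
  next
    fix \<sigma> assume s: "\<sigma> \<in> fil (pullback 2 E) \<alpha> V"
    then have \<sigma>: "\<sigma> \<in> pull_sections 2 E V" by (simp add: pull_fil_def)
    obtain g0 g1 where g: "g0 \<in> carrier (mero_ring V)" "g1 \<in> carrier (mero_ring V)" "\<sigma> = pull_ext g0 g1"
      by (rule pull_ext_cases[OF \<sigma>])
    note d = decompose[OF V g(1,2)]
    have o: "None \<in> V \<longrightarrow> pole_order_le (\<lfloor>\<alpha>\<rfloor> + 1) g0 \<and> pole_order_le (\<lfloor>\<alpha>\<rfloor> - 1) g1"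
      using s unfolding g(3) by (simp add: pull_fil_iff[OF V'(1)])
    show "\<sigma> \<in> ?h ` fil (direct_sum L1.Line L2.Line) \<alpha> V"
      unfolding g(3) d(3) emb_sum[symmetric]
      using d(1,2) d(4)[of "\<lfloor>\<alpha>\<rfloor>"] o
      by (intro image_eqI[of _ _ "(_, _)"])
         (auto simp: L1.line_def L2.line_def L1.emb_fil_iff[OF _ V] L2.emb_fil_iff[OF _ V])
  qed
next
  fix U V s assume "is_open (disc R) U" "is_open U V" "s \<in> secs (direct_sum L1.Line L2.Line) U"
  show "(\<lambda>(\<sigma>, \<tau>). \<sigma> \<oplus>\<^bsub>sec (pullback 2 E) V\<^esub> \<tau>) (res (direct_sum L1.Line L2.Line) U V s) =
     res (pullback 2 E) U V ((\<lambda>(\<sigma>, \<tau>). \<sigma> \<oplus>\<^bsub>sec (pullback 2 E) U\<^esub> \<tau>) s)"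
    by (cases s) (simp add: restr_def fun_eq_iff)
qed

text \<open>
  If the generators are eigenvectors with eigenvalues \<open>l r\<close>, then \<open>\<phi>\<^sub>r - d\<aa>\<^sub>r\<close> multiplies by the
  difference of \<open>l r\<close> and the derivative of \<open>\<aa> r\<close>; a simple pole of this factor raises the filtration
  by at most \<open>1\<close>.
\<close>

lemma irregular_typeI:
  defines "p \<equiv> (\<lambda>r :: nat. if r = 1 then p1 else p2)"
  assumes act: "\<And>r f. r \<in> {1, 2} \<Longrightarrow> (\<And>u. \<not> R < norm u \<Longrightarrow> f u = 0) \<Longrightarrow>
       pull_higgs 2 E \<Phi> (pull_ext (\<lambda>u. f u * p r u) (\<lambda>u. f u * q u)) =
       pull_ext (\<lambda>u. f u * l r u * p r u) (\<lambda>u. f u * l r u * q u)"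
    and l: "\<And>r. r \<in> {1, 2} \<Longrightarrow> l r holomorphic_on {u. R < norm u}"
      "\<And>r. r \<in> {1, 2} \<Longrightarrow> \<exists>n. pole_order_le n (l r)"
      "\<And>r. r \<in> {1, 2} \<Longrightarrow> (\<lambda>u. deriv (\<aa> r) (inverse u)) holomorphic_on {u. R < norm u}"
      "\<And>r. r \<in> {1, 2} \<Longrightarrow> pole_order_le 1 (\<lambda>u. l r u - deriv (\<aa> r) (inverse u))"
  shows "irregular_type E \<Phi>"
proof -
  define S where "S r = eigenline.line E h (p r) q" for r :: nat
  have S12: "S 1 = L1.line" "S 2 = L2.line" by (simp_all add: S_def p_def)
  have lines: "eigenline E h R (p r) q" if "r \<in> {1, 2}" for r
    using that line1 line2 by (auto simp: p_def)
  have inv: "pull_higgs 2 E \<Phi> \<in> S r V \<rightarrow> S r V" and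
    step: "\<sigma> \<in> fil (sub_fbundle (pullback 2 E) (S r)) \<alpha> V \<Longrightarrow>
       (\<lambda>W e i u. pull_higgs 2 E \<Phi> \<sigma> W e i u - deriv (\<aa> r) (inverse u) * \<sigma> W e i u)
         \<in> fil (sub_fbundle (pullback 2 E) (S r)) (\<alpha> + 1) V"
    if r: "r \<in> {1, 2}" and V: "is_open (disc R) V" for r V \<alpha> \<sigma>
  proof -
    interpret L: eigenline E h R "p r" q by (rule lines[OF r])
    have V': "openin CP1 V" "V \<subseteq> disc R" using V by auto
    have Sr: "S r = L.line" by (simp add: S_def)
    have act': "pull_higgs 2 E \<Phi> (L.emb f) = L.emb (\<lambda>u. f u * l r u)" if "f \<in> carrier (mero_ring V)" for f
      unfolding L.emb_def using act[OF r, of f] mero_ring_outside[OF that] V' by (auto simp: disc_def)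
    have fl: "(\<lambda>u. f u * l r u) \<in> carrier (mero_ring V)" if "f \<in> carrier (mero_ring V)" for f
      using mero_ring_mult_disc[OF that V'(2) l(1)[OF r]] l(2)[OF r] by blast
    show "pull_higgs 2 E \<Phi> \<in> S r V \<rightarrow> S r V"
      unfolding Sr L.line_def using act' fl by auto
    assume "\<sigma> \<in> fil (sub_fbundle (pullback 2 E) (S r)) \<alpha> V"
    then obtain f where f: "f \<in> carrier (mero_ring V)" "\<sigma> = L.emb f" and fil: "L.emb f \<in> pull_fil 2 E \<alpha> V"
      unfolding Sr L.line_def by auto
    define d where "d = (\<lambda>u. f u * (l r u - deriv (\<aa> r) (inverse u)))"
    have "(\<lambda>W e i u. pull_higgs 2 E \<Phi> \<sigma> W e i u - deriv (\<aa> r) (inverse u) * \<sigma> W e i u) = L.emb d"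
      unfolding f(2) act'[OF f(1)] unfolding L.emb_def pull_ext_diff_smult
      by (rule arg_cong2[of _ _ _ _ pull_ext]) (auto simp: d_def algebra_simps)
    moreover have "d \<in> carrier (mero_ring V)"
      unfolding d_def by (rule mero_ring_mult_disc[OF f(1) V'(2) _ l(4)[OF r]]) (intro holomorphic_intros l(1,3) r)
    moreover have "None \<in> V \<longrightarrow> pole_order_le \<lfloor>\<alpha> + 1\<rfloor> d"
      using fil unfolding L.emb_fil_iff[OF f(1) V] d_def
      by (auto intro: pole_order_le_mult'[OF _ l(4)[OF r]])
    ultimately show "(\<lambda>W e i u. pull_higgs 2 E \<Phi> \<sigma> W e i u - deriv (\<aa> r) (inverse u) * \<sigma> W e i u)
         \<in> fil (sub_fbundle (pullback 2 E) (S r)) (\<alpha> + 1) V"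
      unfolding Sr using L.emb_fil_iff[OF _ V] by (auto simp: L.line_def)
  qed
  show ?thesis
    unfolding irregular_type_def Let_def
  proof (intro exI[of _ R] exI[of _ S] conjI ballI allI impI)
    show "R > 0" by (rule L1.R)
    fix r :: nat assume r: "r \<in> {1, 2}"
    interpret L: eigenline E h R "p r" q by (rule lines[OF r])
    have Sr: "S r = L.line" by (simp add: S_def)
    show "filtered_bundle (disc R) 1 (sub_fbundle (pullback 2 E) (S r))"
      "pole_order_filtration (disc R) 1 (sub_fbundle (pullback 2 E) (S r))"
      unfolding Sr by (rule L.filtered_Line L.pole_order_filtration_Line)+
    fix V assume V: "is_open (disc R) V"
    show "pull_higgs 2 E \<Phi> \<in> secs (sub_fbundle (pullback 2 E) (S r)) V \<rightarrow> secs (sub_fbundle (pullback 2 E) (S r)) V"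
      using inv[OF r V] by simp
    show "(\<lambda>W e i u. pull_higgs 2 E \<Phi> \<sigma> W e i u - deriv (\<aa> r) (inverse u) * \<sigma> W e i u)
         \<in> fil (sub_fbundle (pullback 2 E) (S r)) (\<alpha> + 1) V"
      if "\<sigma> \<in> fil (sub_fbundle (pullback 2 E) (S r)) \<alpha> V" for \<alpha> \<sigma>
      by (rule step[OF r V that])
  next
    show "fb_iso_map (disc R) (direct_sum (sub_fbundle (pullback 2 E) (S 1)) (sub_fbundle (pullback 2 E) (S 2)))
     (pullback 2 E) (\<lambda>V (\<sigma>, \<tau>). \<sigma> \<oplus>\<^bsub>sec (pullback 2 E) V\<^esub> \<tau>)"
      unfolding S12 by (rule direct_sum_iso)
  qed
qed

end


section \<open>The Higgs bundles of the two-parameter family\<close>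

lemma fb_iso_map_id: "fb_iso_map X E E (\<lambda>U s. s)"
  by (auto simp: fb_iso_map_def linear_map_def bij_betw_def inj_on_def)

lemma big_iso_id: "big_iso big_bundle (\<lambda>U s. s)"
proof
  show "module_sheaf UNIV big_bundle" by (rule filtered_bundleD(1)[OF filtered_big_bundle])
  show "fb_iso_map UNIV big_bundle big_bundle (\<lambda>U s. s)" by (rule fb_iso_map_id)
  show "fil big_bundle \<alpha> U \<subseteq> secs big_bundle U" if "openin CP1 U" for U \<alpha>
    using filtered_bundleD(9)[OF filtered_big_bundle] that by simp
qed

interpretation B: big_iso big_bundle "\<lambda>U s. s"
  by (rule big_iso_id)

lemma poly_quotient:
  "poly ((monom 1 3 - [:w ^ 3:]) div [:- w, 1:]) z = z\<^sup>2 + w * z + w\<^sup>2" for w z :: complex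
proof -
  have "monom 1 3 - [:w ^ 3:] = [:w\<^sup>2, w, 1:] * [:- w, 1:]"
    by (simp add: monom_altdef power2_eq_square power3_eq_cube numeral_3_eq_3)
  then have "(monom 1 3 - [:w ^ 3:]) div [:- w, 1:] = [:w\<^sup>2, w, 1:]"
    by (metis nonzero_mult_div_cancel_right one_neq_zero pCons_eq_0_iff)
  then show ?thesis by (simp add: algebra_simps power2_eq_square)
qed

lemma rep_higgs_apply:
  "rep_higgs w \<gamma> U p = (\<lambda>z. \<gamma> * fst p z + (z\<^sup>2 + w * z + w\<^sup>2) * snd p z, \<lambda>z. (z - w) * fst p z - \<gamma> * snd p z)"
  by (simp add: rep_higgs_def case_prod_unfold poly_quotient)

lemma pole_order_le_poly: "\<exists>n. pole_order_le n (poly p)"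
proof -
  have "pole_order_le (int (degree p)) (\<lambda>z. \<Sum>i\<le>degree p. coeff p i * z ^ i)"
    by (intro pole_order_le_sum pole_order_le_cmult pole_order_le_power') auto
  then show ?thesis unfolding poly_altdef by blast
qed

lemma mero_ring_poly_mult:
  assumes "f \<in> carrier (mero_ring U)"
  shows "(\<lambda>z. poly p z * f z) \<in> carrier (mero_ring U)"
  using assms pole_order_le_poly[of p]
  by (auto simp: mero_ring_iff intro!: holomorphic_intros dest: pole_order_le_mult)

lemma rep_higgs_closed:
  assumes "s \<in> secs big_bundle U" shows "rep_higgs w \<gamma> U s \<in> secs big_bundle U"
proof -
  have f: "fst s \<in> carrier (mero_ring U)" "snd s \<in> carrier (mero_ring U)" using assms by auto
  have "poly [:w\<^sup>2, w, 1:] z = z\<^sup>2 + w * z + w\<^sup>2" "poly [:- w, 1:] z = z - w" for z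
    by (simp_all add: algebra_simps power2_eq_square)
  note mult = mero_ring_poly_mult[OF f(2), of "[:w\<^sup>2, w, 1:]", unfolded this]
    mero_ring_poly_mult[OF f(1), of "[:- w, 1:]", unfolded this]
  show ?thesis
    unfolding rep_higgs_apply big_bundle_simps
    by (intro SigmaI mero_ring_add mero_ring_diff mult mero_ring_cmult f)
qed

lemma sl2_higgs_field_rep: "sl2_higgs_field big_bundle (rep_higgs w \<gamma>)"
  unfolding sl2_higgs_field_def
proof (intro conjI allI impI ballI)
  fix U assume "openin CP1 U"
  show "linear_map (mero_ring U) (sec big_bundle U) (sec big_bundle U) (rep_higgs w \<gamma> U)"
    unfolding linear_map_def
  proof (intro conjI ballI funcsetI)
    show "rep_higgs w \<gamma> U s \<in> secs big_bundle U" if "s \<in> secs big_bundle U" for s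
      by (rule rep_higgs_closed[OF that])
  qed (simp_all add: rep_higgs_apply algebra_simps)
next
  fix U V s
  show "rep_higgs w \<gamma> V (res big_bundle U V s) = res big_bundle U V (rep_higgs w \<gamma> U s)"
    by (auto simp: rep_higgs_apply restr_def)
next
  fix U and e :: "nat \<Rightarrow> (complex \<Rightarrow> complex) \<times> (complex \<Rightarrow> complex)" and z
  assume e: "mero_frame 2 big_bundle U e" and z: "Some z \<in> U"
  have e2: "e 0 \<in> secs big_bundle U" "e (Suc 0) \<in> secs big_bundle U" using B.frame_in[OF e] by auto
  note c = B.coeffs_cramer(1)[OF e rep_higgs_closed[OF e2(1)]] B.coeffs_cramer(2)[OF e rep_higgs_closed[OF e2(2)]]
  \<comment> \<open>The sum of the numerators in Cramer's rule is the trace of the matrix times the determinant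
    of the frame.\<close>
  have "(fst (rep_higgs w \<gamma> U (e 0)) z * snd (e 1) z - fst (e 1) z * snd (rep_higgs w \<gamma> U (e 0)) z) +
     (fst (e 0) z * snd (rep_higgs w \<gamma> U (e 1)) z - fst (rep_higgs w \<gamma> U (e 1)) z * snd (e 0) z) = 0"
    by (simp add: rep_higgs_apply algebra_simps)
  then show "(\<Sum>i<2. coeffs 2 big_bundle U e (rep_higgs w \<gamma> U (e i)) i z) = 0"
    by (simp add: sum_lessThan_2 c flip: add_divide_distrib)
qed

lemma B_canon: "B.canon 0 = (\<lambda>_. 1, \<lambda>_. 0)" "B.canon (Suc 0) = (\<lambda>_. 0, \<lambda>_. 1)"
  by (simp_all add: B.h_canon)

abbreviation "vol \<equiv> wedge big_bundle (B.canon 0) (B.canon (Suc 0))"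

lemma wedge_apply:
  "vol U e i j z =
     coeffs 2 big_bundle U e (res big_bundle UNIV U (B.canon 0)) i z * coeffs 2 big_bundle U e (res big_bundle UNIV U (B.canon (Suc 0))) j z -
     coeffs 2 big_bundle U e (res big_bundle UNIV U (B.canon (Suc 0))) i z * coeffs 2 big_bundle U e (res big_bundle UNIV U (B.canon 0)) j z"
  by (simp add: wedge_def)

lemma tensor_section_wedge: "tensor_section big_bundle vol"
  unfolding tensor_section_def
proof (intro conjI allI impI)
  fix U and e :: "nat \<Rightarrow> (complex \<Rightarrow> complex) \<times> (complex \<Rightarrow> complex)" and i j :: nat
  assume e: "mero_frame 2 big_bundle U e" and i: "i < 2" and j: "j < 2"
  have U: "openin CP1 U" by (rule B.frame_open[OF e])
  show "vol U e i j \<in> carrier (mero_ring U)"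
    unfolding wedge_def
    by (intro mero_ring_diff mero_ring_mult B.coeffs_closed[OF e B.res_canon_in[OF U]] i j)
next
  fix U V and e e' :: "nat \<Rightarrow> (complex \<Rightarrow> complex) \<times> (complex \<Rightarrow> complex)" and k l :: nat and z
  assume e: "mero_frame 2 big_bundle U e" and e': "mero_frame 2 big_bundle V e'" and VU: "V \<subseteq> U"
    and kl: "k < 2" "l < 2" and z: "Some z \<in> V"
  have U: "openin CP1 U" and V: "is_open U V" using B.frame_open[OF e] B.frame_open[OF e'] VU by auto
  have "res big_bundle UNIV V (B.canon j) = res big_bundle U V (res big_bundle UNIV U (B.canon j))" for j
    using module_sheaf_res(4)[OF B.E_shf B.is_open_UNIV[OF open_UNIV_CP1] _ B.canon_in V] U by simp
  then have t: "coeffs 2 big_bundle V e' (res big_bundle UNIV V (B.canon j)) m z =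
     (\<Sum>i<2. coeffs 2 big_bundle V e' (res big_bundle U V (e i)) m z * coeffs 2 big_bundle U e (res big_bundle UNIV U (B.canon j)) i z)"
    if "m < 2" for j m
    using B.coeffs_trans[OF e e' VU B.res_canon_in[OF U] that z] by simp
  show "vol V e' k l z = (\<Sum>i<2. \<Sum>j<2. coeffs 2 big_bundle V e' (res big_bundle U V (e i)) k z *
                           coeffs 2 big_bundle V e' (res big_bundle U V (e j)) l z * vol U e i j z)"
    unfolding wedge_apply[of U e] wedge_apply[of V e'] t[OF kl(1)] t[OF kl(2)] sum_lessThan_2
    by (simp del: big_bundle_simps add: algebra_simps)
qed

lemma wedge_fil: "tensor_fil_inf big_bundle 0 vol"
proof -
  \<comment> \<open>The form is \<open>e\<^sub>0 \<otimes> e\<^sub>1 + (- e\<^sub>1) \<otimes> e\<^sub>0\<close>, a sum of two tensors whose factors have opposite orders.\<close>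
  define s where "s l = (if l = 0 then B.canon 0 else (\<lambda>_. 0, \<lambda>_. - 1))" for l :: nat
  define t where "t l = (if l = 0 then B.canon (Suc 0) else B.canon 0)" for l :: nat
  define \<beta> where "\<beta> l = (if l = 0 then - 1/4 else 1/4 :: real)" for l :: nat
  show ?thesis
    unfolding tensor_fil_inf_def
  proof (intro exI conjI allI impI)
    show "openin CP1 UNIV" by (rule open_UNIV_CP1)
    show "None \<in> (UNIV :: complex option set)" by simp
    show "\<beta> l + - \<beta> l = 0" for l by simp
    have n: "(\<lambda>_. 0, \<lambda>_. - 1) \<in> fil big_bundle (1/4) UNIV"
      using B.const_mero_UNIV by (auto simp: fil_big_bundle_iff intro: pole_order_le_zero pole_order_le_const)
    show "s l \<in> fil big_bundle (\<beta> l) UNIV" "t l \<in> fil big_bundle (- \<beta> l) UNIV" for l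
      using B.canon_fil n by (auto simp: s_def t_def \<beta>_def simp del: One_nat_def)
    fix U and e :: "nat \<Rightarrow> (complex \<Rightarrow> complex) \<times> (complex \<Rightarrow> complex)" and i j :: nat and z
    assume e: "mero_frame 2 big_bundle U e" and ij: "i < 2" "j < 2" and z: "Some z \<in> U"
    have U: "openin CP1 U" by (rule B.frame_open[OF e])
    have in': "res big_bundle UNIV U (\<lambda>_. 0, \<lambda>_. - 1) \<in> secs big_bundle U"
      using restr_one_closed[OF U] by simp
    have "coeffs 2 big_bundle U e (res big_bundle UNIV U (\<lambda>_. 0, \<lambda>_. - 1)) 0 z =
       - coeffs 2 big_bundle U e (res big_bundle UNIV U (B.canon (Suc 0))) 0 z"
      unfolding B.coeffs_cramer(1)[OF e in'] B.coeffs_cramer(1)[OF e B.res_canon_in[OF U]]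
      using z by (simp add: B_canon restr_apply)
    moreover have "coeffs 2 big_bundle U e (res big_bundle UNIV U (\<lambda>_. 0, \<lambda>_. - 1)) (Suc 0) z =
       - coeffs 2 big_bundle U e (res big_bundle UNIV U (B.canon (Suc 0))) (Suc 0) z"
      unfolding B.coeffs_cramer(2)[OF e in'] B.coeffs_cramer(2)[OF e B.res_canon_in[OF U]]
      using z by (simp add: B_canon restr_apply)
    ultimately have "coeffs 2 big_bundle U e (res big_bundle UNIV U (\<lambda>_. 0, \<lambda>_. - 1)) m z =
       - coeffs 2 big_bundle U e (res big_bundle UNIV U (B.canon (Suc 0))) m z" if "m < 2" for m
      using that by (auto simp: less_2_cases_iff simp del: big_bundle_simps)
    then show "vol U e i j z = (\<Sum>l<2. coeffs 2 big_bundle U e (res big_bundle UNIV U (s l)) i z *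
                                 coeffs 2 big_bundle U e (res big_bundle UNIV U (t l)) j z)"
      unfolding wedge_apply[of U e] sum_lessThan_2 using ij by (simp add: s_def t_def del: big_bundle_simps)
  qed
qed

text \<open>
  If the form were in a step \<open>\<alpha> < 0\<close>, its coefficient at \<open>e\<^sub>0 \<otimes> e\<^sub>1\<close> would be a sum of products of pole
  orders at most \<open>\<lfloor>\<beta> + 1/4\<rfloor> + \<lfloor>\<gamma> - 1/4\<rfloor> \<le> \<lfloor>\<alpha>\<rfloor> < 0\<close> and would tend to \<open>0\<close> at infinity. But this coefficient
  is the constant \<open>1\<close>.
\<close>

lemma wedge_fil_nonneg:
  assumes "tensor_fil_inf big_bundle \<alpha> vol"
  shows "0 \<le> \<alpha>"
proof (rule ccontr)
  assume neg: "\<not> 0 \<le> \<alpha>"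
  obtain V and m :: nat and \<beta> \<gamma> s t where V: "openin CP1 V" "None \<in> V"
    and l': "\<forall>l<m. \<beta> l + \<gamma> l = \<alpha> \<and> s l \<in> fil big_bundle (\<beta> l) V \<and> t l \<in> fil big_bundle (\<gamma> l) V"
    and eq': "\<forall>U e. mero_frame 2 big_bundle U e \<longrightarrow> U \<subseteq> V \<longrightarrow> (\<forall>i<2. \<forall>j<2. \<forall>z. Some z \<in> U \<longrightarrow>
           vol U e i j z = (\<Sum>l<m. coeffs 2 big_bundle U e (res big_bundle V U (s l)) i z *
                                 coeffs 2 big_bundle U e (res big_bundle V U (t l)) j z))"
    using assms unfolding tensor_fil_inf_def by (elim exE conjE) (rule that)
  note l = l'[rule_format] and eq = eq'[rule_format]
  define e where "e i = res big_bundle UNIV V (B.canon i)" for i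
  have e: "mero_frame 2 big_bundle V e"
    unfolding e_def by (rule frame_restrict[OF B.E_shf B.frame_canon]) (use V in simp)
  have he: "e i = (restr V (\<lambda>_. if i = 0 then 1 else 0), restr V (\<lambda>_. if i = 0 then 0 else 1))" for i
    unfolding e_def using B.h_res_canon[OF V(1)] .
  have cf: "coeffs 2 big_bundle V e (res big_bundle V V p) 0 z = fst p z"
    "coeffs 2 big_bundle V e (res big_bundle V V p) (Suc 0) z = snd p z"
    if "p \<in> secs big_bundle V" "Some z \<in> V" for p z
  proof -
    have "res big_bundle V V p = p" by (rule module_sheaf_res_self[OF B.E_shf B.is_open_UNIV[OF V(1)] that(1)])
    then show "coeffs 2 big_bundle V e (res big_bundle V V p) 0 z = fst p z"
      "coeffs 2 big_bundle V e (res big_bundle V V p) (Suc 0) z = snd p z"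
      using that(2) by (simp_all add: B.coeffs_cramer[OF e that(1)] he restr_apply del: big_bundle_simps)
  qed
  have st: "s l \<in> secs big_bundle V" "t l \<in> secs big_bundle V"
     "pole_order_le \<lfloor>\<beta> l + 1/4\<rfloor> (fst (s l))" "pole_order_le \<lfloor>\<gamma> l - 1/4\<rfloor> (snd (t l))" if "l < m" for l
    using l[OF that] V(2) by (auto simp: fil_big_bundle_iff)
  have "\<forall>\<^sub>F z in at_infinity. 1 = (\<Sum>l<m. fst (s l) z * snd (t l) z)"
    using eventually_in_nhd_infinity[OF V]
  proof eventually_elim
    case (elim z)
    have *: "coeffs 2 big_bundle V e (res big_bundle UNIV V (B.canon i)) 0 z = (if i = 0 then 1 else 0)"
      "coeffs 2 big_bundle V e (res big_bundle UNIV V (B.canon i)) (Suc 0) z = (if i = 0 then 0 else 1)" for i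
      unfolding B.coeffs_cramer[OF e B.res_canon_in[OF V(1)]]
      unfolding B.h_res_canon[OF V(1)] he using elim by (simp_all add: restr_apply)
    have "vol V e 0 (Suc 0) z = 1" unfolding wedge_apply[of V e] * by simp
    moreover have "vol V e 0 (Suc 0) z = (\<Sum>l<m. fst (s l) z * snd (t l) z)"
      using eq[OF e subset_refl, of 0 "Suc 0" z] elim cf st by (simp del: big_bundle_simps)
    ultimately show ?case by simp
  qed
  moreover have "((\<lambda>z. \<Sum>l<m. fst (s l) z * snd (t l) z) \<longlongrightarrow> 0) at_infinity"
  proof (rule pole_order_le_negative_tendsto[of "- 1"])
    show "pole_order_le (- 1) (\<lambda>z. \<Sum>l<m. fst (s l) z * snd (t l) z)"
    proof (rule pole_order_le_sum)
      fix j assume "j \<in> {..<m}"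
      then have j: "j < m" by simp
      have "\<beta> j + \<gamma> j < 0" using l[OF j] neg by linarith
      then have "\<lfloor>\<beta> j + 1/4\<rfloor> + \<lfloor>\<gamma> j - 1/4\<rfloor> < 0" by linarith
      then have "\<lfloor>\<beta> j + 1/4\<rfloor> + \<lfloor>\<gamma> j - 1/4\<rfloor> \<le> - 1" by simp
      then show "pole_order_le (- 1) (\<lambda>z. fst (s j) z * snd (t j) z)"
        by (rule pole_order_le_mult'[OF st(3,4)[OF j]])
    qed
  qed simp
  ultimately have "((\<lambda>z :: complex. 1 :: complex) \<longlongrightarrow> 0) at_infinity"
    by (rule iffD2[OF filterlim_cong[OF refl refl]])
  then show False
    using tendsto_unique[OF trivial_limit_at_infinity tendsto_const] by fastforce
qed

lemma sl2_form_wedge: "sl2_form big_bundle vol"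
  unfolding sl2_form_def
proof (intro conjI allI impI)
  show "tensor_section big_bundle vol" by (rule tensor_section_wedge)
  show "vol U e i j z = - vol U e j i z" for U e i j z
    by (simp add: wedge_def)
  show "vol U e 0 1 z \<noteq> 0" if e: "mero_frame 2 big_bundle U e" and z: "Some z \<in> U" for U e z
  proof -
    have U: "openin CP1 U" by (rule B.frame_open[OF e])
    have D: "B.det U e z \<noteq> 0" by (rule B.det_nonzero[OF e z])
    \<comment> \<open>The coefficients of the canonical sections form the inverse of the matrix of the frame.\<close>
    have "vol U e 0 (Suc 0) z = B.det U e z / (B.det U e z * B.det U e z)"
      unfolding wedge_apply[of U e] B.coeffs_cramer[OF e B.res_canon_in[OF U]]
      unfolding B.h_res_canon[OF U] using z by (simp add: restr_apply diff_divide_distrib mult.commute)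
    then show ?thesis using D by simp
  qed
  have "tensor_fil_inf big_bundle \<alpha> vol \<Longrightarrow> 0 \<le> ereal \<alpha>" for \<alpha> using wedge_fil_nonneg by simp
  then show "tensor_order_inf big_bundle vol = 0"
    unfolding tensor_order_inf_def using wedge_fil
    by (intro antisym INF_greatest INF_lower2[of 0]) auto
qed

lemma None_in_disc: "None \<in> disc R"
  by (simp add: disc_def)

lemma deriv_powi:
  fixes x :: complex
  assumes "x \<noteq> 0" shows "deriv (\<lambda>y. y powi n) x = of_int n * x powi (n - 1)"
  using assms by (intro DERIV_imp_deriv) (auto intro!: derivative_eq_intros)

lemma deriv_pullback_coordinate: "u \<noteq> 0 \<Longrightarrow> deriv (\<lambda>y. y powi (- 4)) (inverse u) = - 4 * u ^ 5" for u :: complex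
  by (subst deriv_powi) (simp_all add: power_int_inverse power_int_minus power_inverse)

lemma deriv_\<aa>: "u \<noteq> 0 \<Longrightarrow> deriv (\<aa> r) (inverse u) = - 4 * (- 1) ^ r * u ^ 11"
proof -
  assume u: "u \<noteq> 0"
  have "(\<aa> r has_field_derivative (2 / 5 * (- 1) ^ r * (of_int (- 10) * inverse u powi (- 10 - 1)))) (at (inverse u))"
    unfolding \<aa>_def[abs_def] using u by (auto intro!: derivative_eq_intros)
  then show ?thesis
    by (subst DERIV_imp_deriv) (auto simp: power_int_inverse power_int_minus power_inverse mult.assoc)
qed

text \<open>
  The determinant at \<open>z = u\<^sup>4\<close> is \<open>- (u\<^sup>1\<^sup>2 + C)\<close> with \<open>C = \<gamma>\<^sup>2 - w\<^sup>3\<close>, so for large \<open>u\<close> the eigenvalues are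
  \<open>\<mu>\<^sub>r = (-1)\<^sup>r u\<^sup>6 (1 + C/u\<^sup>1\<^sup>2)\<^sup>1\<^sup>/\<^sup>2\<close>, and \<open>(\<gamma> + \<mu>\<^sub>r, z - w)\<close> is an eigenvector. The factor \<open>u\<^sup>-\<^sup>5\<close> turns its
  coordinates, of orders \<open>6\<close> and \<open>4\<close>, into functions of orders \<open>1\<close> and \<open>-1\<close>.
\<close>

lemma irregular_type_rep: "irregular_type big_bundle (rep_higgs w \<gamma>)"
proof -
  define C where "C = \<gamma>\<^sup>2 - w ^ 3"
  \<comment> \<open>For \<open>|u| > R \<ge> 1\<close> both \<open>C/u\<^sup>1\<^sup>2\<close> and \<open>w/u\<^sup>4\<close> have norm less than \<open>1\<close>: the square root is
    holomorphic there, and \<open>q\<close> has no zeros.\<close>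
  define R where "R = 1 + norm C + norm w"
  define sq where "sq x = csqrt (1 + C * x ^ 12)" for x :: complex
  define sg where "sg r = (- 1 :: complex) ^ r" for r :: nat
  define p where "p r u = \<gamma> * inverse u ^ 5 + sg r * (u * sq (inverse u))" for r :: nat and u :: complex
  define q where "q u = inverse u * (1 - w * inverse u ^ 4)" for u :: complex
  \<comment> \<open>The eigenvalue times \<open>-4 u\<^sup>5\<close>, which comes from \<open>dz = -4 u\<^sup>5 dy\<close>.\<close>
  define l where "l r u = - 4 * sg r * u ^ 11 * sq (inverse u)" for r :: nat and u :: complex
  have R1: "R \<ge> 1" by (simp add: R_def)
  have nz: "u \<noteq> 0" if "R < norm u" for u :: complex using that R1 by auto
  have small: "norm (c * inverse u ^ k) < 1" if "R < norm u" "norm c \<le> R" "k \<noteq> 0" for u c :: complex and k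
  proof -
    have u: "norm u > 1" using that R1 by linarith
    have "norm u \<le> norm u ^ k" using u that(3) by (intro self_le_power) auto
    then have "norm c < norm u ^ k" using that by linarith
    moreover have "0 < norm u ^ k" using u by (intro zero_less_power) linarith
    ultimately have "norm c / norm u ^ k < 1" by (simp only: divide_less_eq_1_pos)
    then show ?thesis by (simp add: norm_mult norm_power norm_inverse power_inverse divide_inverse)
  qed
  have slit: "1 + t \<notin> \<real>\<^sub>\<le>\<^sub>0" if "norm t < 1" for t :: complex
  proof
    assume "1 + t \<in> \<real>\<^sub>\<le>\<^sub>0"
    then have "Re (1 + t) \<le> 0" by (auto simp: complex_nonpos_Reals_iff)
    then show False using that abs_Re_le_cmod[of t] by simp
  qed
  have C_R: "norm C \<le> R" "norm w \<le> R" by (auto simp: R_def)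
  have sq_slit: "1 + C * inverse u ^ 12 \<notin> \<real>\<^sub>\<le>\<^sub>0" if "R < norm u" for u
    by (rule slit[OF small]) (use that C_R in auto)
  have sq_nz: "sq (inverse u) \<noteq> 0" if "R < norm u" for u using sq_slit[OF that] by (auto simp: sq_def)
  have sq_hol: "(\<lambda>u. sq (inverse u)) holomorphic_on {u. R < norm u}"
    unfolding sq_def using sq_slit nz by (auto intro!: holomorphic_intros)
  have sq_an: "sq analytic_on {0}"
    unfolding sq_def using slit[of 0] by (auto intro!: analytic_intros)
  have sq2: "sq x * sq x = 1 + C * x ^ 12" for x
    unfolding sq_def by (metis power2_csqrt power2_eq_square)
  have q_an: "(\<lambda>x. 1 - w * x ^ 4) analytic_on {0}" "(\<lambda>x. inverse (1 - w * x ^ 4)) analytic_on {0}"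
    by (auto intro!: analytic_intros)
  have q1_nz: "1 - w * inverse u ^ 4 \<noteq> 0" if "R < norm u" for u
    using small[OF that C_R(2), of 4] by auto
  have sg2: "sg r * sg r = 1" for r by (simp add: sg_def flip: power_mult_distrib)
  have po_id: "pole_order_le 1 (\<lambda>u. u)" using pole_order_le_power[of 1] by simp
  have po_sq: "pole_order_le 0 (\<lambda>u. sq (inverse u))" by (rule pole_order_le_inverse_argument[OF sq_an])
  have holp: "p r holomorphic_on {u. R < norm u}" for r
    unfolding p_def using nz by (intro holomorphic_intros sq_hol) auto
  have holq: "q holomorphic_on {u. R < norm u}"
    unfolding q_def using nz by (intro holomorphic_intros) auto
  have q_nz: "q u \<noteq> 0" if "R < norm u" for u using nz[OF that] q1_nz[OF that] by (simp add: q_def)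
  have op: "pole_order_le 1 (p r)" for r
  proof -
    have "(\<lambda>x. \<gamma> * x ^ 5) analytic_on {0}" by (intro analytic_intros)
    then have "pole_order_le 0 (\<lambda>u. \<gamma> * inverse u ^ 5)" by (rule pole_order_le_inverse_argument)
    then have "pole_order_le 1 (\<lambda>u. \<gamma> * inverse u ^ 5)" by (rule pole_order_le_mono) simp
    moreover have "pole_order_le 1 (\<lambda>u. sg r * (u * sq (inverse u)))"
      by (intro pole_order_le_cmult pole_order_le_mult'[OF po_id po_sq]) simp
    ultimately show ?thesis unfolding p_def by (rule pole_order_le_add)
  qed
  have oq: "pole_order_le (-1) q"
    unfolding q_def by (rule pole_order_le_mult'[OF pole_order_le_inverse pole_order_le_inverse_argument[OF q_an(1)]]) simp
  have oqi: "pole_order_le 1 (\<lambda>u. inverse (q u))"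
    unfolding q_def inverse_mult_distrib inverse_inverse_eq
    by (rule pole_order_le_mult'[OF po_id pole_order_le_inverse_argument[OF q_an(2)]]) simp
  have line: "eigenline big_bundle (\<lambda>U s. s) R (p r) q" for r
  proof (intro eigenline.intro big_iso_id eigenline_axioms.intro)
    show "R > 0" using R1 by simp
  qed (rule holp holq q_nz op oq oqi; assumption?)+
  have diff: "p 1 u - p 2 u = - 2 * (u * sq (inverse u))" for u by (simp add: p_def sg_def)
  have lines: "eigenlines big_bundle (\<lambda>U s. s) R (p 1) (p 2) q"
  proof (intro eigenlines.intro big_iso_id eigenlines_axioms.intro line)
    show "p 1 u - p 2 u \<noteq> 0" if "R < norm u" for u unfolding diff using nz[OF that] sq_nz[OF that] by simp
    have s0: "sq 0 \<noteq> 0" by (simp add: sq_def)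
    have "(\<lambda>x. - 1/2 * inverse (sq x)) analytic_on {0}"
      by (intro analytic_intros sq_an) (use s0 in auto)
    then have "pole_order_le (-1) (\<lambda>u. inverse u * (- 1/2 * inverse (sq (inverse u))))"
      by (intro pole_order_le_mult'[OF pole_order_le_inverse pole_order_le_inverse_argument]) auto
    moreover have "inverse (p 1 u - p 2 u) = inverse u * (- 1/2 * inverse (sq (inverse u)))" for u
      unfolding diff by (simp add: inverse_mult_distrib)
    ultimately show "pole_order_le (-1) (\<lambda>u. inverse (p 1 u - p 2 u))" by (simp only:)
  qed
  interpret L: eigenlines big_bundle "\<lambda>U s. s" R "p 1" "p 2" q by (rule lines)
  have pr: "(if r = 1 then p 1 else p 2) = p r" if "r \<in> {1, 2}" for r :: nat using that by auto
  have eigen: "\<gamma> * p r u + ((u ^ 4)\<^sup>2 + w * u ^ 4 + w\<^sup>2) * q u = sg r * u ^ 6 * sq (inverse u) * p r u"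
      "(u ^ 4 - w) * p r u - \<gamma> * q u = sg r * u ^ 6 * sq (inverse u) * q u" if u: "R < norm u" for r u
  proof -
    define t where "t = inverse u ^ 5"
    define \<mu> where "\<mu> = sg r * u ^ 6 * sq (inverse u)"
    have pt: "p r u = t * (\<gamma> + \<mu>)"
    proof -
      have "t * u ^ 6 = u" using nz[OF u] by (simp add: t_def field_simps power_numeral_reduce)
      then have "t * \<mu> = sg r * (u * sq (inverse u))" unfolding \<mu>_def by (metis mult.assoc mult.commute)
      then show ?thesis unfolding p_def t_def[symmetric] distrib_left by (simp only: mult.commute[of \<gamma> t])
    qed
    have qt: "q u = t * (u ^ 4 - w)"
      using nz[OF u] by (simp add: q_def t_def field_simps power_numeral_reduce)
    have "\<mu> * \<mu> = (sg r * sg r) * u ^ 12 * (sq (inverse u) * sq (inverse u))"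
      by (simp add: \<mu>_def power_numeral_reduce mult_ac)
    also have "\<dots> = u ^ 12 + C" using nz[OF u] by (simp add: sq2 sg2 field_simps)
    also have "\<dots> = \<gamma> * \<gamma> + ((u ^ 4)\<^sup>2 + w * u ^ 4 + w\<^sup>2) * (u ^ 4 - w)"
      by (simp add: C_def algebra_simps power_numeral_reduce)
    finally have \<mu>2: "\<mu> * \<mu> = \<gamma> * \<gamma> + ((u ^ 4)\<^sup>2 + w * u ^ 4 + w\<^sup>2) * (u ^ 4 - w)" .
    have "\<gamma> * p r u + ((u ^ 4)\<^sup>2 + w * u ^ 4 + w\<^sup>2) * q u =
        t * (\<gamma> * \<mu> + (\<gamma> * \<gamma> + ((u ^ 4)\<^sup>2 + w * u ^ 4 + w\<^sup>2) * (u ^ 4 - w)))"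
      unfolding pt qt by (simp only: distrib_left distrib_right mult_ac add_ac)
    also have "\<dots> = \<mu> * p r u" unfolding \<mu>2[symmetric] pt by (simp only: distrib_left mult_ac)
    finally show "\<gamma> * p r u + ((u ^ 4)\<^sup>2 + w * u ^ 4 + w\<^sup>2) * q u = sg r * u ^ 6 * sq (inverse u) * p r u"
      unfolding \<mu>_def .
    have "(u ^ 4 - w) * p r u - \<gamma> * q u = \<mu> * q u" unfolding pt qt by (simp add: algebra_simps)
    then show "(u ^ 4 - w) * p r u - \<gamma> * q u = sg r * u ^ 6 * sq (inverse u) * q u" unfolding \<mu>_def .
  qed
  have higgs: "pull_higgs 2 big_bundle (rep_higgs w \<gamma>) (B.pull_ext f0 f1) =
     B.pull_ext (\<lambda>u. deriv (\<lambda>y. y powi (- 4)) (inverse u) * (\<gamma> * f0 u + ((u ^ 4)\<^sup>2 + w * u ^ 4 + w\<^sup>2) * f1 u))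
       (\<lambda>u. deriv (\<lambda>y. y powi (- 4)) (inverse u) * ((u ^ 4 - w) * f0 u + (- \<gamma>) * f1 u))" for f0 f1
    by (rule B.pull_higgs_pull_ext) (use rep_higgs_closed in \<open>auto simp: rep_higgs_apply\<close>)
  show ?thesis
  proof (rule L.irregular_typeI[of _ l], unfold pr)
    fix r :: nat and f :: "complex \<Rightarrow> complex" assume "r \<in> {1, 2}" and f: "\<And>u. \<not> R < norm u \<Longrightarrow> f u = 0"
    have D: "deriv (\<lambda>y. y powi (- 4)) (inverse u) = - 4 * u ^ 5" if "R < norm u" for u :: complex
      using deriv_pullback_coordinate nz[OF that] by blast
    have u5: "u ^ 5 * u ^ 6 = u ^ 11" for u :: complex by (simp flip: power_add)
    have 1: "deriv (\<lambda>y. y powi (- 4)) (inverse u) * (\<gamma> * (f u * p r u) + ((u ^ 4)\<^sup>2 + w * u ^ 4 + w\<^sup>2) * (f u * q u)) =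
        f u * l r u * p r u" for u
    proof (cases "R < norm u")
      case True
      have "deriv (\<lambda>y. y powi (- 4)) (inverse u) * (\<gamma> * (f u * p r u) + ((u ^ 4)\<^sup>2 + w * u ^ 4 + w\<^sup>2) * (f u * q u)) =
        - 4 * u ^ 5 * f u * (\<gamma> * p r u + ((u ^ 4)\<^sup>2 + w * u ^ 4 + w\<^sup>2) * q u)"
        unfolding D[OF True] by (simp only: distrib_left mult_ac)
      also have "\<dots> = f u * (- 4 * sg r * (u ^ 5 * u ^ 6) * sq (inverse u)) * p r u"
        unfolding eigen(1)[OF True] by (simp only: mult_ac)
      finally show ?thesis unfolding u5 l_def .
    qed (simp add: f)
    have 2: "deriv (\<lambda>y. y powi (- 4)) (inverse u) * ((u ^ 4 - w) * (f u * p r u) + - \<gamma> * (f u * q u)) =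
        f u * l r u * q u" for u
    proof (cases "R < norm u")
      case True
      have "deriv (\<lambda>y. y powi (- 4)) (inverse u) * ((u ^ 4 - w) * (f u * p r u) + - \<gamma> * (f u * q u)) =
        - 4 * u ^ 5 * f u * ((u ^ 4 - w) * p r u - \<gamma> * q u)"
        unfolding D[OF True] by (simp add: algebra_simps)
      also have "\<dots> = f u * (- 4 * sg r * (u ^ 5 * u ^ 6) * sq (inverse u)) * q u"
        unfolding eigen(2)[OF True] by (simp only: mult_ac)
      finally show ?thesis unfolding u5 l_def .
    qed (simp add: f)
    show "pull_higgs 2 big_bundle (rep_higgs w \<gamma>) (B.pull_ext (\<lambda>u. f u * p r u) (\<lambda>u. f u * q u)) =
       B.pull_ext (\<lambda>u. f u * l r u * p r u) (\<lambda>u. f u * l r u * q u)"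
      unfolding higgs 1 2 ..
  next
    fix r :: nat assume "r \<in> {1, 2}"
    show hl: "l r holomorphic_on {u. R < norm u}"
      unfolding l_def by (intro holomorphic_intros sq_hol)
    have o11: "pole_order_le 11 (\<lambda>u. - 4 * sg r * u ^ 11)"
      by (intro pole_order_le_cmult pole_order_le_power') simp
    show "\<exists>n. pole_order_le n (l r)"
      unfolding l_def using pole_order_le_mult[OF o11 po_sq] by blast
    have "(\<lambda>u. - 4 * (- 1) ^ r * u ^ 11) holomorphic_on {u :: complex. R < norm u}" by (intro holomorphic_intros)
    then show "(\<lambda>u. deriv (\<aa> r) (inverse u)) holomorphic_on {u. R < norm u}"
      by (rule holomorphic_transform) (use nz deriv_\<aa> in auto)
    \<comment> \<open>Rationalizing \<open>sq - 1 = C x\<^sup>1\<^sup>2 / (sq + 1)\<close>, with \<open>x = 1/u\<close>, shows that the error has order \<open>-1\<close>.\<close>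
    define g where "g x = - 4 * sg r * C * inverse (sq x + 1)" for x
    have s0: "sq 0 + 1 \<noteq> 0" by (simp add: sq_def)
    have "g analytic_on {0}" unfolding g_def by (intro analytic_intros sq_an) (use s0 in auto)
    then have "pole_order_le (- 1) (\<lambda>u. inverse u * g (inverse u))"
      by (intro pole_order_le_mult'[OF pole_order_le_inverse pole_order_le_inverse_argument]) auto
    then have "pole_order_le 1 (\<lambda>u. inverse u * g (inverse u))" by (rule pole_order_le_mono) simp
    moreover have "\<forall>\<^sub>F u in at_infinity. l r u - deriv (\<aa> r) (inverse u) = inverse u * g (inverse u)"
      using eventually_in_nhd_infinity[OF open_disc None_in_disc, of R]
    proof eventually_elim
      case (elim u)
      then have u: "R < norm u" by (auto simp: disc_def)
      have "Re (sq (inverse u)) \<ge> 0" unfolding sq_def by (rule Re_csqrt)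
      then have n: "sq (inverse u) + 1 \<noteq> 0" by (auto simp: complex_eq_iff)
      have "(sq (inverse u) - 1) * (sq (inverse u) + 1) = C * inverse u ^ 12" by (simp add: algebra_simps sq2)
      then have s: "sq (inverse u) - 1 = C * inverse u ^ 12 * inverse (sq (inverse u) + 1)"
        by (metis n mult.assoc mult.right_neutral right_inverse)
      have "l r u - deriv (\<aa> r) (inverse u) = - 4 * sg r * u ^ 11 * (sq (inverse u) - 1)"
        using nz[OF u] by (simp add: deriv_\<aa> l_def sg_def algebra_simps)
      also have "\<dots> = - 4 * sg r * (u ^ 11 * inverse u ^ 12) * C * inverse (sq (inverse u) + 1)"
        unfolding s by (simp only: mult_ac)
      also have "u ^ 11 * inverse u ^ 12 = inverse u"
        using nz[OF u] by (simp add: field_simps power_numeral_reduce)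
      finally show ?case unfolding g_def by (simp only: mult_ac)
    qed
    ultimately show "pole_order_le 1 (\<lambda>u. l r u - deriv (\<aa> r) (inverse u))" by (rule iffD2[OF pole_order_le_cong, rotated])
  qed
qed

lemma rep_in_C23: "rep w \<gamma> \<in> C23"
  unfolding C23_def rep_def
  using filtered_big_bundle sl2_form_wedge sl2_higgs_field_rep irregular_type_rep by (simp add: B_canon)


section \<open>The matrix of a Higgs field of the given irregular type\<close>

lemma opposite_halves: "X = Y - Z \<Longrightarrow> X = - Y - Z \<Longrightarrow> X = - Z" for X Y Z :: complex
  by (auto simp: complex_eq_iff)

text \<open>
  The unit vectors are split as \<open>s + t\<close> and \<open>s' + t'\<close> into eigenvectors for \<open>m\<^sub>1\<close> and \<open>m\<^sub>2\<close>. On both unit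
  vectors the matrix \<open>M\<close> satisfies \<open>M\<^sup>2 = (m\<^sub>1 + m\<^sub>2) M - m\<^sub>1 m\<^sub>2\<close>. If \<open>M\<close> is traceless, then \<open>M\<^sup>2\<close> is the
  scalar \<open>a\<^sup>2 + b c\<close>, and adding the two diagonal entries of the equation yields the determinant.
\<close>

lemma matrix_from_eigenvectors:
  fixes a b c d :: complex
  assumes "s0 + t0 = 1" "s1 + t1 = 0" "s0' + t0' = 0" "s1' + t1' = 1"
    and "a * s0 + b * s1 = m1 * s0" "c * s0 + d * s1 = m1 * s1"
    and "a * t0 + b * t1 = m2 * t0" "c * t0 + d * t1 = m2 * t1"
    and "a * s0' + b * s1' = m1 * s0'" "c * s0' + d * s1' = m1 * s1'"
    and "a * t0' + b * t1' = m2 * t0'" "c * t0' + d * t1' = m2 * t1'"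
  shows "a = m1 * s0 + m2 * t0" "c = m1 * s1 + m2 * t1" "b = m1 * s0' + m2 * t0'" "d = m1 * s1' + m2 * t1'"
    "a + d = 0 \<Longrightarrow> a * a + b * c = - (m1 * m2)"
proof -
  have "a = a * (s0 + t0) + b * (s1 + t1)" by (simp add: assms)
  also have "\<dots> = m1 * s0 + m2 * t0" unfolding assms(5,7)[symmetric] by (simp add: algebra_simps)
  finally show a: "a = m1 * s0 + m2 * t0" .
  have "c = c * (s0 + t0) + d * (s1 + t1)" by (simp add: assms)
  also have "\<dots> = m1 * s1 + m2 * t1" unfolding assms(6,8)[symmetric] by (simp add: algebra_simps)
  finally show c: "c = m1 * s1 + m2 * t1" .
  have "b = a * (s0' + t0') + b * (s1' + t1')" by (simp add: assms)
  also have "\<dots> = m1 * s0' + m2 * t0'" unfolding assms(9,11)[symmetric] by (simp add: algebra_simps)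
  finally show b: "b = m1 * s0' + m2 * t0'" .
  have "d = c * (s0' + t0') + d * (s1' + t1')" by (simp add: assms)
  also have "\<dots> = m1 * s1' + m2 * t1'" unfolding assms(10,12)[symmetric] by (simp add: algebra_simps)
  finally show d: "d = m1 * s1' + m2 * t1'" .
  assume tr: "a + d = 0"
  have "a * a + b * c = a * (m1 * s0 + m2 * t0) + b * (m1 * s1 + m2 * t1)" using a c by simp
  also have "\<dots> = m1 * (a * s0 + b * s1) + m2 * (a * t0 + b * t1)" by (simp add: algebra_simps)
  also have "\<dots> = (m1 + m2) * (m1 * s0 + m2 * t0) - m1 * m2 * (s0 + t0)"
    unfolding assms(5,7) by (simp add: algebra_simps)
  also have "\<dots> = (m1 + m2) * a - m1 * m2" by (simp add: assms(1) flip: a)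
  finally have 1: "a * a + b * c = (m1 + m2) * a - m1 * m2" .
  have "c * b + d * d = c * (m1 * s0' + m2 * t0') + d * (m1 * s1' + m2 * t1')" using b d by simp
  also have "\<dots> = m1 * (c * s0' + d * s1') + m2 * (c * t0' + d * t1')" by (simp add: algebra_simps)
  also have "\<dots> = (m1 + m2) * (m1 * s1' + m2 * t1') - m1 * m2 * (s1' + t1')"
    unfolding assms(10,12) by (simp add: algebra_simps)
  also have "\<dots> = (m1 + m2) * d - m1 * m2" by (simp add: assms(4) flip: d)
  finally have 2: "c * b + d * d = (m1 + m2) * d - m1 * m2" .
  have d': "d = - a" using tr by (simp add: add_eq_0_iff)
  have "a * a + b * c = - ((m1 + m2) * a) - m1 * m2" using 2 unfolding d' by (simp add: algebra_simps)
  with 1 show "a * a + b * c = - (m1 * m2)" by (rule opposite_halves)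
qed

lemma sl2_higgs_fieldD:
  assumes "sl2_higgs_field E \<Phi>"
  shows "openin CP1 U \<Longrightarrow> linear_map (mero_ring U) (sec E U) (sec E U) (\<Phi> U)"
    "openin CP1 U \<Longrightarrow> is_open U V \<Longrightarrow> s \<in> secs E U \<Longrightarrow> \<Phi> V (res E U V s) = res E U V (\<Phi> U s)"
    "mero_frame 2 E U e \<Longrightarrow> Some z \<in> U \<Longrightarrow> (\<Sum>i<2. coeffs 2 E U e (\<Phi> U (e i)) i z) = 0"
proof -
  note D = assms[unfolded sl2_higgs_field_def]
  show "openin CP1 U \<Longrightarrow> linear_map (mero_ring U) (sec E U) (sec E U) (\<Phi> U)"
    by (rule conjunct1[OF D, rule_format])
  show "openin CP1 U \<Longrightarrow> is_open U V \<Longrightarrow> s \<in> secs E U \<Longrightarrow> \<Phi> V (res E U V s) = res E U V (\<Phi> U s)"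
    by (rule conjunct1[OF conjunct2[OF D], rule_format])
  show "mero_frame 2 E U e \<Longrightarrow> Some z \<in> U \<Longrightarrow> (\<Sum>i<2. coeffs 2 E U e (\<Phi> U (e i)) i z) = 0"
    by (rule conjunct2[OF conjunct2[OF D], rule_format])
qed

context big_iso
begin

text \<open>
  The section \<open>(p, q)\<close> generates, near infinity, the ordinary line bundle that defines the filtration.
\<close>

lemma line_generator:
  fixes S and D :: "complex option set"
  defines "L \<equiv> sub_fbundle (pullback 2 E) S"
  assumes D: "openin CP1 D" "None \<in> D" "Some 0 \<notin> D" and fb: "filtered_bundle D 1 L" and po: "pole_order_filtration D 1 L"
    and sub: "\<And>V. is_open D V \<Longrightarrow> S V \<subseteq> pull_sections 2 E V"
  shows "\<exists>V p q. is_open D V \<and> None \<in> V \<and> pull_ext p q \<in> fil L 0 V \<and>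
    (\<forall>W \<alpha> s0 s1. is_open V W \<longrightarrow> None \<in> W \<longrightarrow> pull_ext s0 s1 \<in> fil L \<alpha> W \<longrightarrow>
       (\<exists>c\<in>carrier (hol_ring W). \<forall>u. Some u \<in> W \<longrightarrow>
          s0 u = c u * u powi \<lfloor>\<alpha>\<rfloor> * p u \<and> s1 u = c u * u powi \<lfloor>\<alpha>\<rfloor> * q u))"
proof -
  obtain K where K: "hol_submodule D L K" "locally_free hol_ring 1 D L K"
      "\<forall>\<alpha> U. is_open D U \<longrightarrow> None \<in> U \<longrightarrow> Some 0 \<notin> U \<longrightarrow>
           fil L \<alpha> U = {s \<in> secs L U. restr U (\<lambda>u. inverse u powi \<lfloor>\<alpha>\<rfloor>) \<odot>\<^bsub>sec L U\<^esub> s \<in> K U}"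
    using po unfolding pole_order_filtration_def by (elim exE conjE) (rule that, (assumption | rule conjI)+)
  have filL: "fil L \<alpha> U = {s \<in> S U. (\<lambda>W' e i u. restr U (\<lambda>u. inverse u powi \<lfloor>\<alpha>\<rfloor>) u * s W' e i u) \<in> K U}"
    if "is_open D U" "None \<in> U" for \<alpha> U
    using K(3)[rule_format, OF that, of \<alpha>] D(3) that by (auto simp: L_def)
  obtain V e where V: "is_open D V" "None \<in> V" and e: "frame hol_ring 1 L K V e"
    using bspec[OF K(2)[unfolded locally_free_def] D(2)] by (elim exE conjE) (rule that; simp)
  have shf: "module_sheaf D L" by (rule filtered_bundleD(1)[OF fb])
  have sm: "submodule (K W) (hol_ring W) (sec L W)" if "is_open D W" for W
    using K(1) that by (simp add: hol_submodule_def)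
  have ag: "abelian_group (sec L W)" if "is_open D W" for W
    by (rule module_abelian_group[OF module_sheaf_module[OF shf that]])
  have KS: "K W \<subseteq> S W" if "is_open D W" for W
    using submodule_facts(1)[OF sm[OF that] ag[OF that]] by (simp add: L_def)
  have eK: "e 0 \<in> K V" using e by (simp add: frame_def)
  have "e 0 \<in> pull_sections 2 E V" using eK KS[OF V(1)] sub[OF V(1)] by blast
  then obtain p q where pq: "p \<in> carrier (mero_ring V)" "q \<in> carrier (mero_ring V)" "e 0 = pull_ext p q"
    by (rule pull_ext_cases)
  have one: "(\<lambda>u. restr V (\<lambda>u. inverse u powi \<lfloor>0 :: real\<rfloor>) u * f u) = f" if "f \<in> carrier (mero_ring V)" for f
    using mero_ring_outside[OF that] by (auto simp: restr_def)
  show ?thesis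
  proof (intro exI conjI allI impI)
    show "pull_ext p q \<in> fil L 0 V"
    proof -
      have "(\<lambda>W' e i u. restr V (\<lambda>u. inverse u powi \<lfloor>0 :: real\<rfloor>) u * pull_ext p q W' e i u) = pull_ext p q"
        by (simp only: pull_ext_smult one[OF pq(1)] one[OF pq(2)])
      moreover have "pull_ext p q \<in> K V" using eK by (simp only: pq(3))
      moreover have "pull_ext p q \<in> S V" using KS[OF V(1)] \<open>pull_ext p q \<in> K V\<close> by (rule subsetD)
      ultimately show ?thesis by (simp only: filL[OF V] mem_Collect_eq)
    qed
    fix W \<alpha> s0 s1 assume W: "is_open V W" and N: "None \<in> W" and s: "pull_ext s0 s1 \<in> fil L \<alpha> W"
    have DW: "is_open D W" using W V by auto
    have "(\<lambda>W' e i u. restr W (\<lambda>u. inverse u powi \<lfloor>\<alpha>\<rfloor>) u * pull_ext s0 s1 W' e i u) \<in> K W" (is "?s \<in> _")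
      using s unfolding filL[OF DW N] by blast
    note ex = bspec[OF mp[OF spec[OF conjunct2[OF conjunct2[OF e[unfolded frame_def]]]] W] this]
    obtain c where c: "c \<in> {..<1::nat} \<rightarrow>\<^sub>E carrier (hol_ring W)"
      "?s = finsum (sec L W) (\<lambda>i. c i \<odot>\<^bsub>sec L W\<^esub> res L V W (e i)) {..<1}"
      using ex1_implies_ex[OF ex] by (elim exE conjE) (rule that, (assumption | rule conjI)+)
    have c0: "c 0 \<in> carrier (hol_ring W)" by (rule PiE_mem[OF c(1)]) simp
    have "res L V W (e 0) \<in> K W" using K(1) V(1) W eK unfolding hol_submodule_def by blast
    then have "c 0 \<odot>\<^bsub>sec L W\<^esub> res L V W (e 0) \<in> secs L W"
      using submodule_facts(1,5)[OF sm[OF DW] ag[OF DW]] c0 by blast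
    then have "?s = c 0 \<odot>\<^bsub>sec L W\<^esub> res L V W (e 0)"
      unfolding c(2) by (rule finsum_lessThan(1)[OF abelian_group.axioms(1)[OF ag[OF DW]]])
    then have eq: "pull_ext (\<lambda>u. restr W (\<lambda>u. inverse u powi \<lfloor>\<alpha>\<rfloor>) u * s0 u) (\<lambda>u. restr W (\<lambda>u. inverse u powi \<lfloor>\<alpha>\<rfloor>) u * s1 u) =
       pull_ext (\<lambda>u. c 0 u * restr W p u) (\<lambda>u. c 0 u * restr W q u)"
      unfolding pq(3) by (simp add: L_def pull_ext_restr pull_ext_smult)
    show "\<exists>c\<in>carrier (hol_ring W). \<forall>u. Some u \<in> W \<longrightarrow>
          s0 u = c u * u powi \<lfloor>\<alpha>\<rfloor> * p u \<and> s1 u = c u * u powi \<lfloor>\<alpha>\<rfloor> * q u"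
    proof (intro bexI[OF _ c0] allI impI)
      fix u assume u: "Some u \<in> W"
      then have "u \<noteq> 0" using DW D(3) by auto
      have e: "inverse u powi \<lfloor>\<alpha>\<rfloor> * s0 u = c 0 u * p u" "inverse u powi \<lfloor>\<alpha>\<rfloor> * s1 u = c 0 u * q u"
        using eq u unfolding pull_ext_inject by (auto simp: restr_def fun_eq_iff split: if_splits)
      have y: "u powi \<lfloor>\<alpha>\<rfloor> * inverse u powi \<lfloor>\<alpha>\<rfloor> = 1" using \<open>u \<noteq> 0\<close> by (simp add: power_int_inverse)
      have "x = u powi \<lfloor>\<alpha>\<rfloor> * (inverse u powi \<lfloor>\<alpha>\<rfloor> * x)" for x
        unfolding mult.assoc[symmetric] y by simp
      then show "s0 u = c 0 u * u powi \<lfloor>\<alpha>\<rfloor> * p u \<and> s1 u = c 0 u * u powi \<lfloor>\<alpha>\<rfloor> * q u"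
        using e by (metis mult.assoc mult.commute)
    qed
  qed (use V in auto)
qed

definition eigen_at :: "'a endo \<Rightarrow> complex \<Rightarrow> complex \<Rightarrow> complex \<Rightarrow> complex \<Rightarrow> bool" where
  "eigen_at \<Phi> z \<mu> s0 s1 \<longleftrightarrow>
     c0 UNIV (\<Phi> UNIV (canon 0)) z * s0 + c0 UNIV (\<Phi> UNIV (canon (Suc 0))) z * s1 = \<mu> * s0 \<and>
     c1 UNIV (\<Phi> UNIV (canon 0)) z * s0 + c1 UNIV (\<Phi> UNIV (canon (Suc 0))) z * s1 = \<mu> * s1"

lemma eigen_at_scale: "eigen_at \<Phi> z \<mu> s0 s1 \<Longrightarrow> eigen_at \<Phi> z \<mu> (x * s0) (x * s1)"
proof -
  assume e: "eigen_at \<Phi> z \<mu> s0 s1"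
  have d: "A * (x * s0) + B * (x * s1) = x * (A * s0 + B * s1)" for A B :: complex by (simp add: algebra_simps)
  show ?thesis using e unfolding eigen_at_def d by (simp add: mult.left_commute)
qed

text \<open>
  The generator of step \<open>0\<close> is mapped by \<open>\<phi>\<^sub>r - d\<aa>\<^sub>r\<close> into step \<open>1\<close>, that is, to its multiple by \<open>c u\<close>
  with \<open>c\<close> holomorphic. So it is an eigenvector, and dividing by the factor \<open>-4 u\<^sup>5\<close> of \<open>dz\<close> gives the
  eigenvalue of the matrix of \<open>\<Phi>\<close>.
\<close>

lemma eigenvalue_at_infinity:
  fixes S and D :: "complex option set" and r :: nat
  defines "L \<equiv> sub_fbundle (pullback 2 E) S"
  assumes D: "openin CP1 D" "None \<in> D" "Some 0 \<notin> D" and fb: "filtered_bundle D 1 L" and po: "pole_order_filtration D 1 L"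
    and sub: "\<And>V. is_open D V \<Longrightarrow> S V \<subseteq> pull_sections 2 E V"
    and \<Phi>: "\<Phi> UNIV (canon 0) \<in> secs E UNIV" "\<Phi> UNIV (canon (Suc 0)) \<in> secs E UNIV"
    and step: "\<And>V \<alpha> \<sigma>. is_open D V \<Longrightarrow> \<sigma> \<in> fil L \<alpha> V \<Longrightarrow>
      (\<lambda>W e i u. pull_higgs 2 E \<Phi> \<sigma> W e i u - deriv (\<aa> r) (inverse u) * \<sigma> W e i u) \<in> fil L (\<alpha> + 1) V"
  shows "\<exists>V c. is_open D V \<and> None \<in> V \<and> c \<in> carrier (hol_ring V) \<and>
    (\<forall>W \<alpha> s0 s1 u. is_open V W \<longrightarrow> None \<in> W \<longrightarrow> pull_ext s0 s1 \<in> fil L \<alpha> W \<longrightarrow> Some u \<in> W \<longrightarrow>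
       eigen_at \<Phi> (u ^ 4) ((- 1) ^ r * u ^ 6 - c u * inverse u ^ 4 / 4) (s0 u) (s1 u))"
proof -
  have "\<exists>V p q. is_open D V \<and> None \<in> V \<and> pull_ext p q \<in> fil L 0 V \<and>
    (\<forall>W \<alpha> s0 s1. is_open V W \<longrightarrow> None \<in> W \<longrightarrow> pull_ext s0 s1 \<in> fil L \<alpha> W \<longrightarrow>
       (\<exists>c\<in>carrier (hol_ring W). \<forall>u. Some u \<in> W \<longrightarrow>
          s0 u = c u * u powi \<lfloor>\<alpha>\<rfloor> * p u \<and> s1 u = c u * u powi \<lfloor>\<alpha>\<rfloor> * q u))"
    unfolding L_def by (rule line_generator[OF D fb[unfolded L_def] po[unfolded L_def] sub])
  then obtain V p q where V: "is_open D V" "None \<in> V" and pq: "pull_ext p q \<in> fil L 0 V"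
    and gen: "\<forall>W \<alpha> s0 s1. is_open V W \<longrightarrow> None \<in> W \<longrightarrow> pull_ext s0 s1 \<in> fil L \<alpha> W \<longrightarrow>
       (\<exists>c\<in>carrier (hol_ring W). \<forall>u. Some u \<in> W \<longrightarrow>
          s0 u = c u * u powi \<lfloor>\<alpha>\<rfloor> * p u \<and> s1 u = c u * u powi \<lfloor>\<alpha>\<rfloor> * q u)"
    by (elim exE conjE) (rule that, (assumption | rule conjI)+)
  define \<sigma> where "\<sigma> = (\<lambda>W e i u. pull_higgs 2 E \<Phi> (pull_ext p q) W e i u - deriv (\<aa> r) (inverse u) * pull_ext p q W e i u)"
  have \<sigma>1: "\<sigma> \<in> fil L (0 + 1) V" unfolding \<sigma>_def by (rule step[OF V(1) pq])
  then have "\<sigma> \<in> pull_sections 2 E V" using sub[OF V(1)] by (auto simp: L_def)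
  then have \<sigma>2: "\<sigma> = pull_ext (\<sigma> UNIV canon 0) (\<sigma> UNIV canon (Suc 0))" by (rule pull_sections_eq_pull_ext)
  have VV: "is_open V V" using V by simp
  have \<sigma>3: "pull_ext (\<sigma> UNIV canon 0) (\<sigma> UNIV canon (Suc 0)) \<in> fil L (0 + 1) V"
    by (rule subst[OF \<sigma>2, of "\<lambda>x. x \<in> fil L (0 + 1) V", OF \<sigma>1])
  have fl: "\<lfloor>0 + 1 :: real\<rfloor> = 1" by simp
  have "\<exists>c\<in>carrier (hol_ring V). \<forall>u. Some u \<in> V \<longrightarrow>
      \<sigma> UNIV canon 0 u = c u * u powi 1 * p u \<and> \<sigma> UNIV canon (Suc 0) u = c u * u powi 1 * q u"
    using gen[rule_format, OF VV V(2) \<sigma>3] unfolding fl .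
  then obtain c where c: "c \<in> carrier (hol_ring V)" and cu: "\<And>u. Some u \<in> V \<Longrightarrow>
      \<sigma> UNIV canon 0 u = c u * u powi 1 * p u \<and> \<sigma> UNIV canon (Suc 0) u = c u * u powi 1 * q u"
    by blast
  have eig: "eigen_at \<Phi> (u ^ 4) ((- 1) ^ r * u ^ 6 - c u * inverse u ^ 4 / 4) (p u) (q u)" if u: "Some u \<in> V" for u
  proof -
    have nz: "u \<noteq> 0" using u V D(3) by auto
    have key: "X = ((- 1) ^ r * u ^ 6 - c u * inverse u ^ 4 / 4) * x"
      if "deriv (\<lambda>y. y powi (- 4)) (inverse u) * X - deriv (\<aa> r) (inverse u) * x = c u * u powi 1 * x" for X x
    proof -
      have "- 4 * u ^ 5 * X = (- 4 * (- 1) ^ r * u ^ 11 + c u * u) * x"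
        using that unfolding deriv_pullback_coordinate[OF nz] deriv_\<aa>[OF nz] by (simp add: algebra_simps)
      also have "\<dots> = - 4 * u ^ 5 * (((- 1) ^ r * u ^ 6 - c u * inverse u ^ 4 / 4) * x)"
        using nz by (simp add: field_simps power_numeral_reduce)
      finally show ?thesis using nz by simp
    qed
    show ?thesis
      unfolding eigen_at_def
      using cu[OF u] unfolding \<sigma>_def pull_higgs_UNIV_canon[of \<Phi>, OF \<Phi>] pull_ext_UNIV by (intro conjI key) blast+
  qed
  show ?thesis
  proof (intro exI conjI allI impI)
    fix W \<alpha> s0 s1 u assume W: "is_open V W" "None \<in> W" "pull_ext s0 s1 \<in> fil L \<alpha> W" and u: "Some u \<in> W"
    obtain c' where "s0 u = c' u * u powi \<lfloor>\<alpha>\<rfloor> * p u \<and> s1 u = c' u * u powi \<lfloor>\<alpha>\<rfloor> * q u"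
      using gen[rule_format, OF W] u by blast
    then show "eigen_at \<Phi> (u ^ 4) ((- 1) ^ r * u ^ 6 - c u * inverse u ^ 4 / 4) (s0 u) (s1 u)"
      using eigen_at_scale[OF eig, of u] u W(1) by auto
  qed (use V c in auto)
qed

lemma mero_UNIV_polynomial:
  assumes f: "f \<in> carrier (mero_ring UNIV)" and o: "pole_order_le (int n) (\<lambda>u. f (u ^ 4))"
  shows "\<exists>p. 4 * degree p \<le> n \<and> f = poly p"
proof -
  obtain m where m: "pole_order_le m f" using mero_ring_pole_order[OF f] by blast
  have hol: "f holomorphic_on UNIV" using f by (simp add: mero_ring_iff)
  have "pole_order_le (int (nat m)) f" by (rule pole_order_le_mono[OF m]) simp
  then obtain p where p: "f = poly p" using entire_pole_order_polynomial[OF hol] by blast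
  then show ?thesis using degree_le_from_power4[of n p] o by blast
qed

text \<open>
  The pulled back canonical sections are split along \<open>\<psi>\<^sup>*E = L\<^sub>1 \<oplus> L\<^sub>2\<close>. Their parts are eigenvectors of
  known pole order, and their eigenvalues \<open>m\<^sub>1\<close>, \<open>m\<^sub>2\<close> are known up to \<open>O(u\<^sup>-\<^sup>4)\<close>. Thus
  \<open>matrix_from_eigenvectors\<close> yields the growth of the entries and of the determinant.
\<close>

lemma big_higgs_matrix:
  assumes higgs: "sl2_higgs_field E \<Phi>" and irr: "irregular_type E \<Phi>"
  shows "\<exists>pa pb pc C. degree pa \<le> 1 \<and> degree pb \<le> 2 \<and> degree pc \<le> 1 \<and>
    pa * pa + pb * pc = monom 1 3 + [:C:] \<and>
    h UNIV (\<Phi> UNIV (canon 0)) = (poly pa, poly pc) \<and> h UNIV (\<Phi> UNIV (canon (Suc 0))) = (poly pb, poly (- pa))"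
proof -
  have lin: "linear_map (mero_ring UNIV) (sec E UNIV) (sec E UNIV) (\<Phi> UNIV)"
    using sl2_higgs_fieldD(1)[OF higgs open_UNIV_CP1] .
  then have \<Phi>: "\<Phi> UNIV (canon j) \<in> secs E UNIV" for j using canon_in by (auto simp: linear_map_def)
  define a b c d where "a = c0 UNIV (\<Phi> UNIV (canon 0))" "b = c0 UNIV (\<Phi> UNIV (canon (Suc 0)))"
    "c = c1 UNIV (\<Phi> UNIV (canon 0))" "d = c1 UNIV (\<Phi> UNIV (canon (Suc 0)))"
  note abcd = this
  have mero: "a \<in> carrier (mero_ring UNIV)" "b \<in> carrier (mero_ring UNIV)" "c \<in> carrier (mero_ring UNIV)"
    using coords_mero[OF open_UNIV_CP1 \<Phi>] by (auto simp: abcd)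
  have "(\<Sum>i<2. coeffs 2 E UNIV canon (\<Phi> UNIV (canon i)) i z) = 0" for z
    by (rule sl2_higgs_fieldD(3)[OF higgs frame_canon]) simp
  then have tr: "a z + d z = 0" for z by (simp add: sum_lessThan_2 coeffs_canon[OF \<Phi>] abcd)
  obtain R S where R: "R > (0 :: real)" and irr': "let D = disc R; F = pullback 2 E; L = (\<lambda>r :: nat. sub_fbundle F (S r)) in
        (\<forall>r\<in>{1, 2}. filtered_bundle D 1 (L r) \<and> pole_order_filtration D 1 (L r)) \<and>
        fb_iso_map D (direct_sum (L 1) (L 2)) F (\<lambda>V (\<sigma>, \<tau>). \<sigma> \<oplus>\<^bsub>sec F V\<^esub> \<tau>) \<and>
        (\<forall>r\<in>{1, 2}. \<forall>V. is_open D V \<longrightarrow>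
           pull_higgs 2 E \<Phi> \<in> secs (L r) V \<rightarrow> secs (L r) V \<and>
           (\<forall>\<alpha>. \<forall>\<sigma>\<in>fil (L r) \<alpha> V.
              (\<lambda>W e i u. pull_higgs 2 E \<Phi> \<sigma> W e i u - deriv (\<aa> r) (inverse u) * \<sigma> W e i u)
                \<in> fil (L r) (\<alpha> + 1) V))"
    using irr unfolding irregular_type_def by (elim exE conjE) (rule that, (assumption | rule conjI)+)
  define L where "L r = sub_fbundle (pullback 2 E) (S r)" for r
  note irr'' = irr'[unfolded Let_def, folded L_def]
  have fb: "filtered_bundle (disc R) 1 (L r)" and po: "pole_order_filtration (disc R) 1 (L r)" if "r \<in> {1, 2}" for r
    using conjunct1[OF irr''] that by blast+
  have iso: "fb_iso_map (disc R) (direct_sum (L 1) (L 2)) (pullback 2 E) (\<lambda>V (\<sigma>, \<tau>). \<sigma> \<oplus>\<^bsub>sec (pullback 2 E) V\<^esub> \<tau>)"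
    by (rule conjunct1[OF conjunct2[OF irr'']])
  have step: "(\<lambda>W e i u. pull_higgs 2 E \<Phi> \<sigma> W e i u - deriv (\<aa> r) (inverse u) * \<sigma> W e i u) \<in> fil (L r) (\<alpha> + 1) V"
    if "r \<in> {1, 2}" "is_open (disc R) V" "\<sigma> \<in> fil (L r) \<alpha> V" for r V \<alpha> \<sigma>
    using bspec[OF conjunct2[OF conjunct2[OF irr'']] that(1)] that(2,3) by blast
  have D: "openin CP1 (disc R)" "None \<in> disc R" "Some 0 \<notin> disc R" using open_disc R by (auto simp: disc_def)
  have zero: "(\<lambda>W e i u. 0) \<in> S r V" if "r \<in> {1, 2}" "is_open (disc R) V" for r V
  proof -
    interpret M: Module.module "mero_ring V" "sec (L r) V"
      by (rule module_sheaf_module[OF filtered_bundleD(1)[OF fb[OF that(1)]] that(2)])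
    show ?thesis using M.zero_closed by (simp add: L_def)
  qed
  have sum_in: "(\<lambda>W e i u. \<sigma> W e i u + \<tau> W e i u) \<in> pull_sections 2 E V"
    if "is_open (disc R) V" "\<sigma> \<in> S 1 V" "\<tau> \<in> S 2 V" for V \<sigma> \<tau>
  proof -
    have "bij_betw (\<lambda>(\<sigma>, \<tau>). \<sigma> \<oplus>\<^bsub>sec (pullback 2 E) V\<^esub> \<tau>) (secs (direct_sum (L 1) (L 2)) V) (secs (pullback 2 E) V)"
      by (rule fb_iso_mapD(2)[OF iso that(1)])
    then have "(\<lambda>(\<sigma>, \<tau>). \<sigma> \<oplus>\<^bsub>sec (pullback 2 E) V\<^esub> \<tau>) (\<sigma>, \<tau>) \<in> secs (pullback 2 E) V"
      by (rule bij_betw_apply) (use that in \<open>simp add: L_def del: One_nat_def\<close>)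
    then show ?thesis by simp
  qed
  have sub: "S r V \<subseteq> pull_sections 2 E V" if "r \<in> {1, 2}" "is_open (disc R) V" for r V
  proof
    fix \<sigma> assume "\<sigma> \<in> S r V"
    then show "\<sigma> \<in> pull_sections 2 E V"
      using sum_in[OF that(2), of \<sigma> "\<lambda>W e i u. 0"] sum_in[OF that(2), of "\<lambda>W e i u. 0" \<sigma>] zero[OF _ that(2)] that(1)
      by auto
  qed
  have ev: "\<exists>V c. is_open (disc R) V \<and> None \<in> V \<and> c \<in> carrier (hol_ring V) \<and>
    (\<forall>W \<alpha> s0 s1 u. is_open V W \<longrightarrow> None \<in> W \<longrightarrow> pull_ext s0 s1 \<in> fil (L r) \<alpha> W \<longrightarrow> Some u \<in> W \<longrightarrow>
       eigen_at \<Phi> (u ^ 4) ((- 1) ^ r * u ^ 6 - c u * inverse u ^ 4 / 4) (s0 u) (s1 u))" if "r \<in> {1, 2}" for r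
    unfolding L_def
    by (rule eigenvalue_at_infinity[OF D fb[OF that, unfolded L_def] po[OF that, unfolded L_def] sub[OF that] \<Phi> \<Phi>
        step[OF that, unfolded L_def]])
  obtain V1 x1 where V1: "is_open (disc R) V1" "None \<in> V1" "x1 \<in> carrier (hol_ring V1)"
    and ev1: "\<forall>W \<alpha> s0 s1 u. is_open V1 W \<longrightarrow> None \<in> W \<longrightarrow> pull_ext s0 s1 \<in> fil (L 1) \<alpha> W \<longrightarrow> Some u \<in> W \<longrightarrow>
       eigen_at \<Phi> (u ^ 4) ((- 1) ^ 1 * u ^ 6 - x1 u * inverse u ^ 4 / 4) (s0 u) (s1 u)"
    using ev[OF insertI1] by (elim exE conjE) (rule that, (assumption | rule conjI)+)
  have "2 \<in> {1, 2 :: nat}" by simp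
  obtain V2 x2 where V2: "is_open (disc R) V2" "None \<in> V2" "x2 \<in> carrier (hol_ring V2)"
    and ev2: "\<forall>W \<alpha> s0 s1 u. is_open V2 W \<longrightarrow> None \<in> W \<longrightarrow> pull_ext s0 s1 \<in> fil (L 2) \<alpha> W \<longrightarrow> Some u \<in> W \<longrightarrow>
       eigen_at \<Phi> (u ^ 4) ((- 1) ^ 2 * u ^ 6 - x2 u * inverse u ^ 4 / 4) (s0 u) (s1 u)"
    using ev[OF \<open>2 \<in> {1, 2}\<close>] by (elim exE conjE) (rule that, (assumption | rule conjI)+)
  define V where "V = V1 \<inter> V2"
  have V: "is_open (disc R) V" "None \<in> V" "is_open V1 V" "is_open V2 V" "openin CP1 V"
    using V1 V2 by (auto simp: V_def)
  define m1 m2 where "m1 u = - (u ^ 6) - x1 u * inverse u ^ 4 / 4" "m2 u = u ^ 6 - x2 u * inverse u ^ 4 / 4" for u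
  have split: "\<exists>s0 s1 t0 t1. (\<forall>u. Some u \<in> V \<longrightarrow> s0 u + t0 u = g0 u \<and> s1 u + t1 u = g1 u \<and>
       eigen_at \<Phi> (u ^ 4) (m1 u) (s0 u) (s1 u) \<and> eigen_at \<Phi> (u ^ 4) (m2 u) (t0 u) (t1 u)) \<and>
       pole_order_le (\<lfloor>\<alpha>\<rfloor> + 1) s0 \<and> pole_order_le (\<lfloor>\<alpha>\<rfloor> - 1) s1 \<and>
       pole_order_le (\<lfloor>\<alpha>\<rfloor> + 1) t0 \<and> pole_order_le (\<lfloor>\<alpha>\<rfloor> - 1) t1"
    if g: "pull_ext g0 g1 \<in> pull_fil 2 E \<alpha> V" for g0 g1 \<alpha>
  proof -
    have "(\<lambda>(\<sigma>, \<tau>). \<sigma> \<oplus>\<^bsub>sec (pullback 2 E) V\<^esub> \<tau>) ` fil (direct_sum (L 1) (L 2)) \<alpha> V = fil (pullback 2 E) \<alpha> V"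
      by (rule fb_iso_mapD(3)[OF iso V(1)])
    then have "pull_ext g0 g1 \<in> (\<lambda>(\<sigma>, \<tau>). \<sigma> \<oplus>\<^bsub>sec (pullback 2 E) V\<^esub> \<tau>) ` (fil (L 1) \<alpha> V \<times> fil (L 2) \<alpha> V)"
      using g by simp
    then obtain \<sigma> \<tau> where st: "\<sigma> \<in> fil (L 1) \<alpha> V" "\<tau> \<in> fil (L 2) \<alpha> V"
      "pull_ext g0 g1 = (\<lambda>W e i u. \<sigma> W e i u + \<tau> W e i u)" by auto
    have st': "\<sigma> \<in> pull_fil 2 E \<alpha> V" "\<tau> \<in> pull_fil 2 E \<alpha> V" using st by (auto simp: L_def)
    then have "\<sigma> \<in> pull_sections 2 E V" "\<tau> \<in> pull_sections 2 E V" by (auto simp: pull_fil_def)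
    then obtain s0 s1 t0 t1 where ext: "\<sigma> = pull_ext s0 s1" "\<tau> = pull_ext t0 t1" by (metis pull_ext_cases)
    have sum: "g0 = (\<lambda>u. s0 u + t0 u)" "g1 = (\<lambda>u. s1 u + t1 u)"
      using st(3) unfolding ext pull_ext_add pull_ext_inject by auto
    show ?thesis
    proof (intro exI conjI allI impI)
      fix u assume u: "Some u \<in> V"
      show "s0 u + t0 u = g0 u" "s1 u + t1 u = g1 u" by (simp_all add: sum)
      show "eigen_at \<Phi> (u ^ 4) (m1 u) (s0 u) (s1 u)"
        using ev1[rule_format, OF V(3,2) st(1)[unfolded ext] u] by (simp add: m1_m2_def)
      show "eigen_at \<Phi> (u ^ 4) (m2 u) (t0 u) (t1 u)"
        using ev2[rule_format, OF V(4,2) st(2)[unfolded ext] u] by (simp add: m1_m2_def)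
    qed (use st'[unfolded ext pull_fil_infinity_iff[OF V(5,2)]] in blast)+
  qed
  have fl: "\<lfloor>- 1 :: real\<rfloor> = - 1" using floor_of_int[of "- 1"] by simp
  have one: "restr V (\<lambda>_. 1) \<in> carrier (mero_ring V)" by (rule restr_one_closed[OF V(5)])
  \<comment> \<open>The pullbacks of \<open>e\<^sub>0\<close> and \<open>e\<^sub>1\<close> have orders \<open>-1\<close> and \<open>1\<close>. Splitting them in steps \<open>-1\<close> and \<open>1\<close>
    gives the sharpest bounds for the parts.\<close>
  have "pull_ext (restr V (\<lambda>_. 1)) (\<lambda>_. 0) \<in> pull_fil 2 E (- 1) V"
    unfolding pull_fil_infinity_iff[OF V(5,2)] pole_order_le_restr[OF V(5,2)]
    using one by (simp add: fl mero_ring_zero pole_order_le_zero pole_order_le_const)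
  from split[OF this] obtain s0 s1 t0 t1 where S0: "\<And>u. Some u \<in> V \<Longrightarrow> s0 u + t0 u = 1 \<and> s1 u + t1 u = 0 \<and>
       eigen_at \<Phi> (u ^ 4) (m1 u) (s0 u) (s1 u) \<and> eigen_at \<Phi> (u ^ 4) (m2 u) (t0 u) (t1 u)"
    and o0: "pole_order_le 0 s0" "pole_order_le (- 2) s1" "pole_order_le 0 t0" "pole_order_le (- 2) t1"
    by (auto simp: restr_def fl)
  have "pull_ext (\<lambda>_. 0) (restr V (\<lambda>_. 1)) \<in> pull_fil 2 E 1 V"
    unfolding pull_fil_infinity_iff[OF V(5,2)] pole_order_le_restr[OF V(5,2)]
    using one by (simp add: fl mero_ring_zero pole_order_le_zero pole_order_le_const)
  from split[OF this] obtain s0' s1' t0' t1' where S1: "\<And>u. Some u \<in> V \<Longrightarrow> s0' u + t0' u = 0 \<and> s1' u + t1' u = 1 \<and>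
       eigen_at \<Phi> (u ^ 4) (m1 u) (s0' u) (s1' u) \<and> eigen_at \<Phi> (u ^ 4) (m2 u) (t0' u) (t1' u)"
    and o1: "pole_order_le 2 s0'" "pole_order_le 0 s1'" "pole_order_le 2 t0'" "pole_order_le 0 t1'"
    by (auto simp: restr_def fl)
  have id: "a (u ^ 4) = m1 u * s0 u + m2 u * t0 u \<and> c (u ^ 4) = m1 u * s1 u + m2 u * t1 u \<and>
      b (u ^ 4) = m1 u * s0' u + m2 u * t0' u \<and>
      a (u ^ 4) * a (u ^ 4) + b (u ^ 4) * c (u ^ 4) = - (m1 u * m2 u)" if "Some u \<in> V" for u
  proof -
    note A = S0[OF that] and B = S1[OF that]
    note eA = conjunct1[OF conjunct2[OF conjunct2[OF A]]] conjunct2[OF conjunct2[OF conjunct2[OF A]]]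
    note eB = conjunct1[OF conjunct2[OF conjunct2[OF B]]] conjunct2[OF conjunct2[OF conjunct2[OF B]]]
    note e = eA[unfolded eigen_at_def, folded abcd] eB[unfolded eigen_at_def, folded abcd]
    note L = matrix_from_eigenvectors[OF conjunct1[OF A] conjunct1[OF conjunct2[OF A]] conjunct1[OF B]
        conjunct1[OF conjunct2[OF B]] conjunct1[OF e(1)] conjunct2[OF e(1)] conjunct1[OF e(2)] conjunct2[OF e(2)]
        conjunct1[OF e(3)] conjunct2[OF e(3)] conjunct1[OF e(4)] conjunct2[OF e(4)]]
    show ?thesis by (intro conjI L(1-3) L(5)[OF tr])
  qed
  have Vev: "\<forall>\<^sub>F u in at_infinity. Some u \<in> V" by (rule eventually_in_nhd_infinity[OF V(5,2)])
  have x: "pole_order_le 0 x1" "pole_order_le 0 x2" using V1 V2 by (auto simp: hol_ring_iff)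
  have i4: "pole_order_le (- 4) (\<lambda>u. inverse u ^ 4 / 4)"
    using pole_order_le_cmult[OF pole_order_le_powi[of "- 4"], of "1/4"] by (simp add: power_int_minus power_inverse)
  have xi: "pole_order_le (- 4) (\<lambda>u. x1 u * inverse u ^ 4 / 4)" "pole_order_le (- 4) (\<lambda>u. x2 u * inverse u ^ 4 / 4)"
    using pole_order_le_mult[OF x(1) i4] pole_order_le_mult[OF x(2) i4] by simp_all
  have p6: "pole_order_le 6 (\<lambda>u. u ^ 6)" by (rule pole_order_le_power') simp
  have m: "pole_order_le 6 m1" "pole_order_le 6 m2"
    unfolding m1_m2_def
    by (intro pole_order_le_diff pole_order_le_uminus p6 pole_order_le_mono[OF xi(1)] pole_order_le_mono[OF xi(2)]; simp)+
  have lin: "pole_order_le k f" if "\<And>u. Some u \<in> V \<Longrightarrow> f u = m1 u * s u + m2 u * t u" "pole_order_le (k - 6) s" "pole_order_le (k - 6) t"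
    for f s t k
  proof -
    have "pole_order_le k (\<lambda>u. m1 u * s u + m2 u * t u)"
      using pole_order_le_add[OF pole_order_le_mult[OF m(1) that(2)] pole_order_le_mult[OF m(2) that(3)]] by simp
    moreover have "\<forall>\<^sub>F u in at_infinity. f u = m1 u * s u + m2 u * t u" using Vev by eventually_elim (rule that(1))
    ultimately show ?thesis by (rule iffD2[OF pole_order_le_cong, rotated])
  qed
  have "pole_order_le (int 6) (\<lambda>u. a (u ^ 4))" by (rule lin[of _ s0 t0]) (use id o0 in auto)
  then obtain pa where pa: "4 * degree pa \<le> 6" "a = poly pa" using mero_UNIV_polynomial[OF mero(1)] by blast
  have "pole_order_le (int 8) (\<lambda>u. b (u ^ 4))" by (rule lin[of _ s0' t0']) (use id o1 in auto)
  then obtain pb where pb: "4 * degree pb \<le> 8" "b = poly pb" using mero_UNIV_polynomial[OF mero(2)] by blast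
  have "pole_order_le (int 4) (\<lambda>u. c (u ^ 4))" by (rule lin[of _ s1 t1]) (use id o0 in auto)
  then obtain pc where pc: "4 * degree pc \<le> 4" "c = poly pc" using mero_UNIV_polynomial[OF mero(3)] by blast
  \<comment> \<open>A polynomial in \<open>z\<close> that is \<open>O(u\<^sup>2) = O(z\<^sup>1\<^sup>/\<^sup>2)\<close> is constant.\<close>
  define P where "P = pa * pa + pb * pc - monom 1 3"
  have "pole_order_le (int 2) (\<lambda>u. poly P (u ^ 4))"
  proof -
    define y1 y2 where "y1 u = x1 u * inverse u ^ 4 / 4" "y2 u = x2 u * inverse u ^ 4 / 4" for u
    have y: "pole_order_le (- 4) y1" "pole_order_le (- 4) y2" using xi by (simp_all add: y1_y2_def[abs_def])
    have "pole_order_le 2 (\<lambda>u. u ^ 6 * (y1 u - y2 u) - y1 u * y2 u)"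
      by (intro pole_order_le_diff pole_order_le_mult'[OF p6 pole_order_le_diff[OF y]] pole_order_le_mult'[OF y]) simp_all
    moreover have "\<forall>\<^sub>F u in at_infinity. poly P (u ^ 4) = u ^ 6 * (y1 u - y2 u) - y1 u * y2 u"
      using Vev
    proof eventually_elim
      case (elim u)
      have "poly P (u ^ 4) = (a (u ^ 4) * a (u ^ 4) + b (u ^ 4) * c (u ^ 4)) - (u ^ 4) ^ 3"
        by (simp add: P_def poly_monom pa(2) pb(2) pc(2))
      also have "\<dots> = - (m1 u * m2 u) - (u ^ 4) ^ 3"
        by (simp only: conjunct2[OF conjunct2[OF conjunct2[OF id[OF elim]]]])
      also have "\<dots> = (u ^ 6 + y1 u) * (u ^ 6 - y2 u) - u ^ 6 * u ^ 6"
        by (simp add: m1_m2_def y1_y2_def algebra_simps flip: power_mult power_add)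
      also have "\<dots> = u ^ 6 * (y1 u - y2 u) - y1 u * y2 u" by (simp add: algebra_simps)
      finally show ?case .
    qed
    ultimately have "pole_order_le 2 (\<lambda>u. poly P (u ^ 4))" by (rule iffD2[OF pole_order_le_cong, rotated])
    then show ?thesis by simp
  qed
  then have "4 * degree P \<le> 2" by (rule degree_le_from_power4)
  then have "degree P = 0" by simp
  then obtain C where C: "P = [:C:]" by (rule degree_eq_zeroE)
  have "pa * pa + pb * pc = P + monom 1 3" by (simp add: P_def)
  moreover have "d = poly (- pa)" using tr by (auto simp: fun_eq_iff pa(2) add_eq_0_iff minus_equation_iff)
  moreover have "h UNIV (\<Phi> UNIV (canon 0)) = (a, c)" "h UNIV (\<Phi> UNIV (canon (Suc 0))) = (b, d)" by (simp_all add: abcd)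
  ultimately show ?thesis using pa pb pc C by (intro exI[of _ pa] exI[of _ pb] exI[of _ pc] exI[of _ C]) auto
qed

end


section \<open>Normal forms and their uniqueness\<close>

lemma degree_le_explicit:
  "degree p \<le> 1 \<Longrightarrow> p = [:coeff p 0, coeff p 1:]"
  "degree p \<le> 2 \<Longrightarrow> p = [:coeff p 0, coeff p 1, coeff p 2:]"
  by (rule poly_eqI; auto simp: coeff_pCons numeral_2_eq_2 split: nat.split intro: coeff_eq_0)+

text \<open>
  The numbers \<open>\<alpha>\<close>, \<open>\<beta>\<close> are the entries of the upper triangular matrix, with lower right entry \<open>1\<close>, that
  conjugates the given matrix to normal form. The three equations are entries of the conjugation
  equation; its upper left entry follows from the first two.
\<close>

lemma normal_form_polynomials:
  fixes pa pb pc :: "complex poly"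
  assumes deg: "degree pa \<le> 1" "degree pb \<le> 2" "degree pc \<le> 1"
    and eq: "pa * pa + pb * pc = monom 1 3 + [:C:]"
  shows "\<exists>\<alpha> \<beta> w \<gamma>. \<alpha> \<noteq> 0 \<and> (\<forall>z. poly pc z = \<alpha> * (z - w) \<and> poly pa z = \<gamma> - \<beta> * (z - w) \<and>
     \<alpha> * poly pb z - \<beta> * poly pa z = \<gamma> * \<beta> + (z\<^sup>2 + w * z + w\<^sup>2))"
proof -
  obtain a0 a1 where a: "pa = [:a0, a1:]" using degree_le_explicit(1)[OF deg(1)] by blast
  obtain b0 b1 b2 where b: "pb = [:b0, b1, b2:]" using degree_le_explicit(2)[OF deg(2)] by blast
  obtain k0 \<alpha> where c: "pc = [:k0, \<alpha>:]" using degree_le_explicit(1)[OF deg(3)] by blast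
  have "coeff (pa * pa + pb * pc) 3 = 1" unfolding eq by (simp add: coeff_pCons numeral_3_eq_3)
  then have "b2 * \<alpha> = 1" unfolding a b c by (simp add: numeral_3_eq_3 mult.commute)
  then have \<alpha>: "\<alpha> \<noteq> 0" by auto
  define w where "w = - k0 / \<alpha>"
  define \<gamma> where "\<gamma> = a0 + a1 * w"
  define \<beta> where "\<beta> = - a1"
  have pc: "poly pc z = \<alpha> * (z - w)" for z using \<alpha> by (simp add: c w_def field_simps)
  have pa: "poly pa z = \<gamma> - \<beta> * (z - w)" for z by (simp add: a \<gamma>_def \<beta>_def algebra_simps)
  have ev: "poly pa z * poly pa z + poly pb z * poly pc z = z ^ 3 + C" for z
    using arg_cong[OF eq, of "\<lambda>p. poly p z"] by (simp add: poly_monom)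
  have C: "C = \<gamma> * \<gamma> - w ^ 3" using ev[of w] by (simp add: pa pc)
  define P where "P = Polynomial.smult \<alpha> pb - Polynomial.smult \<beta> pa - [:\<gamma> * \<beta>:]"
  \<comment> \<open>At a fixed \<open>z \<noteq> w\<close> the equation for the determinant determines the upper right entry; cancelling
    the polynomial \<open>z - w\<close> includes \<open>z = w\<close>.\<close>
  have "poly ([:- w, 1:] * P) z = poly ([:- w, 1:] * [:w\<^sup>2, w, 1:]) z" for z
  proof -
    have "(z - w) * (\<alpha> * poly pb z - \<beta> * poly pa z - \<gamma> * \<beta>) =
        poly pb z * (\<alpha> * (z - w)) - \<beta> * (z - w) * (poly pa z + \<gamma>)" by (simp add: algebra_simps)
    also have "\<beta> * (z - w) = \<gamma> - poly pa z" by (simp add: pa)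
    also have "poly pb z * (\<alpha> * (z - w)) - (\<gamma> - poly pa z) * (poly pa z + \<gamma>) =
        (poly pa z * poly pa z + poly pb z * poly pc z) - \<gamma> * \<gamma>" unfolding pc by (simp add: algebra_simps)
    also have "\<dots> = (z - w) * (z\<^sup>2 + w * z + w\<^sup>2)"
      unfolding ev C by (simp add: algebra_simps power2_eq_square power3_eq_cube)
    finally show ?thesis by (simp add: P_def algebra_simps power2_eq_square)
  qed
  then have "[:- w, 1:] * P = [:- w, 1:] * [:w\<^sup>2, w, 1:]" using poly_eq_poly_eq_iff by blast
  then have "P = [:w\<^sup>2, w, 1:]" by (simp del: mult_pCons_left mult_pCons_right)
  then have "poly P z = z\<^sup>2 + w * z + w\<^sup>2" for z by (simp add: algebra_simps power2_eq_square)
  then have "\<alpha> * poly pb z - \<beta> * poly pa z = \<gamma> * \<beta> + (z\<^sup>2 + w * z + w\<^sup>2)" for z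
    unfolding P_def by (metis (no_types) add.commute diff_eq_eq poly_diff poly_pCons poly_smult mult_zero_right add.right_neutral poly_0)
  then show ?thesis using \<alpha> pa pc by blast
qed

lemma fb_iso_map_comp:
  assumes h: "fb_iso_map X E F h" and g: "fb_iso_map X F G g"
  shows "fb_iso_map X E G (\<lambda>U s. g U (h U s))"
  unfolding fb_iso_map_def
proof (intro conjI allI impI ballI)
  fix U assume U: "is_open X U"
  note H = fb_iso_mapD[OF h U] and G = fb_iso_mapD[OF g U]
  show "linear_map (mero_ring U) (sec E U) (sec G U) (\<lambda>s. g U (h U s))"
    using H(1) G(1) unfolding linear_map_def by (auto simp: Pi_iff)
  show "bij_betw (\<lambda>s. g U (h U s)) (secs E U) (secs G U)"
    using bij_betw_trans[OF H(2) G(2)] by (simp add: o_def)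
  show "(\<lambda>s. g U (h U s)) ` fil E \<alpha> U = fil G \<alpha> U" for \<alpha>
    using H(3) G(3) by (metis image_image)
next
  fix U V s assume U: "is_open X U" and V: "is_open U V" and s: "s \<in> secs E U"
  have "h U s \<in> secs F U" using fb_iso_mapD(2)[OF h U] s by (rule bij_betw_apply)
  then have "g V (res F U V (h U s)) = res G U V (g U (h U s))"
    using conjunct2[OF g[unfolded fb_iso_map_def]] U V by blast
  moreover have "h V (res E U V s) = res F U V (h U s)"
    using conjunct2[OF h[unfolded fb_iso_map_def]] U V s by blast
  ultimately show "g V (h V (res E U V s)) = res G U V (g U (h U s))" by simp
qed

text \<open>
  A constant maps \<open>\<O>(-1/4)\<close> into \<open>\<O>(1/4)\<close> compatibly with the filtrations because
  \<open>\<lfloor>x - 1/4\<rfloor> \<le> \<lfloor>x + 1/4\<rfloor>\<close>.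
\<close>

lemma fb_iso_map_upper_triangular:
  assumes \<alpha>: "\<alpha> \<noteq> 0"
  shows "fb_iso_map UNIV big_bundle big_bundle (\<lambda>U p. (\<lambda>z. \<alpha> * fst p z + \<beta> * snd p z, snd p))"
  unfolding fb_iso_map_def
proof (intro conjI allI impI ballI)
  fix U assume U: "is_open UNIV U"
  let ?g = "\<lambda>p :: (complex \<Rightarrow> complex) \<times> (complex \<Rightarrow> complex). (\<lambda>z. \<alpha> * fst p z + \<beta> * snd p z, snd p)"
  let ?k = "\<lambda>p :: (complex \<Rightarrow> complex) \<times> (complex \<Rightarrow> complex). (\<lambda>z. inverse \<alpha> * (fst p z - \<beta> * snd p z), snd p)"
  have gk: "?g (?k p) = p" "?k (?g p) = p" for p using \<alpha> by (auto simp: prod_eq_iff fun_eq_iff field_simps)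
  have g_in: "?g p \<in> secs big_bundle U" and hinv_in: "?k p \<in> secs big_bundle U" if "p \<in> secs big_bundle U" for p
    using that by (auto intro!: mero_ring_add mero_ring_diff mero_ring_cmult)
  show "linear_map (mero_ring U) (sec big_bundle U) (sec big_bundle U) ?g"
    unfolding linear_map_def using g_in by (auto simp: algebra_simps)
  show "bij_betw ?g (secs big_bundle U) (secs big_bundle U)"
    by (rule bij_betw_byWitness[of _ ?k]) (use gk g_in hinv_in in blast)+
  fix x :: real
  have fl: "\<lfloor>x - 1/4\<rfloor> \<le> \<lfloor>x + 1/4\<rfloor>" by (rule floor_mono) simp
  have g_fil: "?g p \<in> fil big_bundle x U" and k_fil: "?k p \<in> fil big_bundle x U" if p: "p \<in> fil big_bundle x U" for p
  proof -
    have *: "pole_order_le \<lfloor>x + 1/4\<rfloor> (fst p)" "pole_order_le \<lfloor>x + 1/4\<rfloor> (snd p)" "pole_order_le \<lfloor>x - 1/4\<rfloor> (snd p)"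
      if "None \<in> U" using p that pole_order_le_mono[OF _ fl] by (auto simp: fil_big_bundle_iff)
    have "p \<in> secs big_bundle U" using p by (simp add: fil_big_bundle_iff)
    note g_in[OF this] hinv_in[OF this]
    then show "?g p \<in> fil big_bundle x U" "?k p \<in> fil big_bundle x U"
      unfolding fil_big_bundle_iff using *
      by (auto intro!: pole_order_le_add pole_order_le_diff pole_order_le_cmult)
  qed
  show "?g ` fil big_bundle x U = fil big_bundle x U"
  proof (intro equalityI subsetI)
    fix p assume "p \<in> fil big_bundle x U"
    then have "?k p \<in> fil big_bundle x U" by (rule k_fil)
    then have "?g (?k p) \<in> ?g ` fil big_bundle x U" by (rule imageI)
    then show "p \<in> ?g ` fil big_bundle x U" by (simp only: gk(1))
  qed (use g_fil in blast)
next
  fix U V and p :: "(complex \<Rightarrow> complex) \<times> (complex \<Rightarrow> complex)"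
  show "(\<lambda>z. \<alpha> * fst (res big_bundle U V p) z + \<beta> * snd (res big_bundle U V p) z, snd (res big_bundle U V p)) =
     res big_bundle U V (\<lambda>z. \<alpha> * fst p z + \<beta> * snd p z, snd p)"
    by (auto simp: restr_def)
qed

context big_iso
begin

text \<open>
  A Higgs field is linear over the functions, hence determined by its values on the canonical sections.
\<close>

lemma higgs_matrix_action:
  assumes higgs: "sl2_higgs_field E \<Phi>" and ab: "h UNIV (\<Phi> UNIV (canon 0)) = (a, c)" "h UNIV (\<Phi> UNIV (canon (Suc 0))) = (b, d)"
    and U: "openin CP1 U" and s: "s \<in> secs E U"
  shows "h U (\<Phi> U s) = (\<lambda>z. a z * c0 U s z + b z * c1 U s z, \<lambda>z. c z * c0 U s z + d z * c1 U s z)"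
proof -
  note U' = is_open_UNIV[OF U]
  have UU: "is_open UNIV UNIV" using open_UNIV_CP1 by simp
  have \<Phi>lin: "linear_map (mero_ring U) (sec E U) (sec E U) (\<Phi> U)" by (rule sl2_higgs_fieldD(1)[OF higgs U])
  have "linear_map (mero_ring UNIV) (sec E UNIV) (sec E UNIV) (\<Phi> UNIV)"
    by (rule sl2_higgs_fieldD(1)[OF higgs open_UNIV_CP1])
  then have \<Phi>canon: "\<Phi> UNIV (canon i) \<in> secs E UNIV" for i using canon_in by (auto simp: linear_map_def)
  define r where "r i = res E UNIV U (canon i)" for i
  have r: "r i \<in> secs E U" for i unfolding r_def by (rule res_canon_in[OF U])
  note f = coords_mero[OF U s]
  have fr: "c0 U s \<odot>\<^bsub>sec E U\<^esub> r 0 \<in> secs E U" "c1 U s \<odot>\<^bsub>sec E U\<^esub> r (Suc 0) \<in> secs E U"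
    using smult_in[OF U' f(1) r] smult_in[OF U' f(2) r] by auto
  let ?t = "c0 U s \<odot>\<^bsub>sec E U\<^esub> r 0 \<oplus>\<^bsub>sec E U\<^esub> c1 U s \<odot>\<^bsub>sec E U\<^esub> r (Suc 0)"
  have out: "c0 U s z = 0" "c1 U s z = 0" if "Some z \<notin> U" for z using f that mero_ring_outside by blast+
  have "h U ?t = (\<lambda>z. c0 U s z * restr U (\<lambda>_. 1) z + c1 U s z * restr U (\<lambda>_. 0) z,
      \<lambda>z. c0 U s z * restr U (\<lambda>_. 0) z + c1 U s z * restr U (\<lambda>_. 1) z)"
    unfolding h_add[OF U' fr] h_smult[OF U' f(1) r] h_smult[OF U' f(2) r]
    unfolding r_def h_res_canon[OF U] by simp
  also have "\<dots> = h U s" using out by (auto simp: prod_eq_iff restr_def fun_eq_iff)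
  finally have "?t = s" using h_inj[OF U' add_in[OF U' fr] s] by simp
  then have "\<Phi> U s = \<Phi> U ?t" by simp
  also have "\<dots> = c0 U s \<odot>\<^bsub>sec E U\<^esub> \<Phi> U (r 0) \<oplus>\<^bsub>sec E U\<^esub> c1 U s \<odot>\<^bsub>sec E U\<^esub> \<Phi> U (r (Suc 0))"
    using \<Phi>lin fr f r unfolding linear_map_def by simp
  finally have eq: "\<Phi> U s = \<dots>" .
  have \<Phi>r: "\<Phi> U (r i) = res E UNIV U (\<Phi> UNIV (canon i))" for i
    unfolding r_def by (rule sl2_higgs_fieldD(2)[OF higgs open_UNIV_CP1 _ canon_in]) (use U in simp)
  have r\<Phi>: "res E UNIV U (\<Phi> UNIV (canon i)) \<in> secs E U" for i
    by (rule res_in[OF UU _ \<Phi>canon]) (use U in simp)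
  have h\<Phi>: "h U (res E UNIV U (\<Phi> UNIV (canon i))) = res big_bundle UNIV U (h UNIV (\<Phi> UNIV (canon i)))" for i
    by (rule h_res[OF UU _ \<Phi>canon]) (use U in simp)
  have "h U (\<Phi> U s) = (\<lambda>z. c0 U s z * restr U a z + c1 U s z * restr U b z, \<lambda>z. c0 U s z * restr U c z + c1 U s z * restr U d z)"
    unfolding eq \<Phi>r h_add[OF U' smult_in[OF U' f(1) r\<Phi>] smult_in[OF U' f(2) r\<Phi>]] h_smult[OF U' f(1) r\<Phi>] h_smult[OF U' f(2) r\<Phi>]
      h\<Phi> ab by simp
  also have "\<dots> = (\<lambda>z. a z * c0 U s z + b z * c1 U s z, \<lambda>z. c z * c0 U s z + d z * c1 U s z)"
    using out by (auto simp: restr_def fun_eq_iff)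
  finally show ?thesis .
qed

lemma higgs_normal_form:
  assumes higgs: "sl2_higgs_field E \<Phi>" and irr: "irregular_type E \<Phi>"
  shows "\<exists>w \<gamma> g. fb_iso_map UNIV E big_bundle g \<and>
    (\<forall>U. openin CP1 U \<longrightarrow> (\<forall>s\<in>secs E U. g U (\<Phi> U s) = rep_higgs w \<gamma> U (g U s)))"
proof -
  obtain pa pb pc C where deg: "degree pa \<le> 1" "degree pb \<le> 2" "degree pc \<le> 1"
    and eq: "pa * pa + pb * pc = monom 1 3 + [:C:]"
    and M: "h UNIV (\<Phi> UNIV (canon 0)) = (poly pa, poly pc)" "h UNIV (\<Phi> UNIV (canon (Suc 0))) = (poly pb, poly (- pa))"
    using big_higgs_matrix[OF higgs irr] by (elim exE conjE) (rule that)
  obtain \<alpha> \<beta> w \<gamma> where \<alpha>: "\<alpha> \<noteq> 0" and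
    nf: "\<forall>z. poly pc z = \<alpha> * (z - w) \<and> poly pa z = \<gamma> - \<beta> * (z - w) \<and>
     \<alpha> * poly pb z - \<beta> * poly pa z = \<gamma> * \<beta> + (z\<^sup>2 + w * z + w\<^sup>2)"
    using normal_form_polynomials[OF deg eq] by (elim exE conjE) (rule that)
  have pc: "poly pc z = \<alpha> * (z - w)" and pa: "poly pa z = \<gamma> - \<beta> * (z - w)"
    and pb: "\<alpha> * poly pb z - \<beta> * poly pa z = \<gamma> * \<beta> + (z\<^sup>2 + w * z + w\<^sup>2)" for z
    using nf by blast+
  define g where "g U s = (\<lambda>z. \<alpha> * c0 U s z + \<beta> * c1 U s z, c1 U s)" for U s
  have "fb_iso_map UNIV E big_bundle g"
    unfolding g_def by (rule fb_iso_map_comp[OF h_iso fb_iso_map_upper_triangular[OF \<alpha>]])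
  moreover have "g U (\<Phi> U s) = rep_higgs w \<gamma> U (g U s)" if U: "openin CP1 U" and s: "s \<in> secs E U" for U s
  proof -
    have 1: "\<alpha> * (poly pa z * x + poly pb z * y) + \<beta> * (poly pc z * x + poly (- pa) z * y) =
        \<gamma> * (\<alpha> * x + \<beta> * y) + (z\<^sup>2 + w * z + w\<^sup>2) * y" for x y z
    proof -
      have "\<alpha> * (poly pa z * x + poly pb z * y) + \<beta> * (poly pc z * x + poly (- pa) z * y) =
         (\<alpha> * poly pa z + \<beta> * poly pc z) * x + (\<alpha> * poly pb z - \<beta> * poly pa z) * y" by (simp add: algebra_simps)
      also have "\<alpha> * poly pa z + \<beta> * poly pc z = \<gamma> * \<alpha>" unfolding pa pc by (simp add: algebra_simps)
      finally show ?thesis unfolding pb by (simp add: algebra_simps)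
    qed
    have 2: "poly pc z * x + poly (- pa) z * y = (z - w) * (\<alpha> * x + \<beta> * y) - \<gamma> * y" for x y z
      unfolding poly_minus pa pc by (simp add: algebra_simps)
    show ?thesis
      unfolding g_def higgs_matrix_action[OF higgs M U s] rep_higgs_apply fst_conv snd_conv
      by (rule arg_cong2[of _ _ _ _ Pair], rule ext, rule 1, rule ext, rule 2)
  qed
  ultimately show ?thesis by blast
qed

end

lemma big_isoI:
  assumes "filtered_bundle UNIV 2 E" "fb_iso_map UNIV E big_bundle h"
  shows "big_iso E h"
  using filtered_bundleD(1)[OF assms(1)] assms(2) filtered_bundleD(9)[OF assms(1)]
  by unfold_locales auto

lemma higgs_iso_to_rep:
  assumes "(E, \<omega>, \<Phi>) \<in> C23" "fb_iso UNIV E big_bundle"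
  shows "\<exists>w \<gamma>. higgs_iso (E, \<omega>, \<Phi>) (rep w \<gamma>)"
proof -
  have E: "filtered_bundle UNIV 2 E" "sl2_higgs_field E \<Phi>" "irregular_type E \<Phi>" using assms(1) by (auto simp: C23_def)
  obtain h where "fb_iso_map UNIV E big_bundle h" using assms(2) by (auto simp: fb_iso_def)
  then interpret big_iso E h by (rule big_isoI[OF E(1)])
  show ?thesis using higgs_normal_form[OF E(2,3)] unfolding higgs_iso_def rep_def by auto
qed

lemma (in bundle_iso) fb_iso_map_inverse:
  assumes fil: "\<And>U \<alpha>. is_open X U \<Longrightarrow> fil F \<alpha> U \<subseteq> secs F U"
  shows "fb_iso_map X F E hinv"
  unfolding fb_iso_map_def
proof (intro conjI allI impI ballI)
  fix U assume U: "is_open X U"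
  interpret F: Module.module "mero_ring U" "sec F U" by (rule F_module[OF U])
  show "linear_map (mero_ring U) (sec F U) (sec E U) (hinv U)"
    unfolding linear_map_def
  proof (intro conjI ballI funcsetI)
    fix s assume s: "s \<in> secs F U"
    show "hinv U s \<in> secs E U" by (rule hinv_in[OF U s])
    show "hinv U (s \<oplus>\<^bsub>sec F U\<^esub> t) = hinv U s \<oplus>\<^bsub>sec E U\<^esub> hinv U t" if t: "t \<in> secs F U" for t
    proof -
      note st = hinv_in[OF U s] hinv_in[OF U t]
      have "h U (hinv U s \<oplus>\<^bsub>sec E U\<^esub> hinv U t) = s \<oplus>\<^bsub>sec F U\<^esub> t"
        unfolding h_add[OF U st] h_hinv[OF U s] h_hinv[OF U t] ..
      then show ?thesis using hinv_h[OF U add_in[OF U st]] by simp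
    qed
    show "hinv U (f \<odot>\<^bsub>sec F U\<^esub> s) = f \<odot>\<^bsub>sec E U\<^esub> hinv U s" if f: "f \<in> carrier (mero_ring U)" for f
    proof -
      have "h U (f \<odot>\<^bsub>sec E U\<^esub> hinv U s) = f \<odot>\<^bsub>sec F U\<^esub> s"
        unfolding h_smult[OF U f hinv_in[OF U s]] h_hinv[OF U s] ..
      then show ?thesis using hinv_h[OF U smult_in[OF U f hinv_in[OF U s]]] by simp
    qed
  qed
  show "bij_betw (hinv U) (secs F U) (secs E U)" by (rule bij_betw_inv_into[OF h_bij[OF U]])
  show "hinv U ` fil F \<alpha> U = fil E \<alpha> U" for \<alpha>
  proof (intro equalityI subsetI)
    fix s assume "s \<in> hinv U ` fil F \<alpha> U"
    then obtain t where t: "t \<in> fil F \<alpha> U" "s = hinv U t" by blast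
    have "t \<in> secs F U" using fil[OF U] t(1) by blast
    then show "s \<in> fil E \<alpha> U" using t by (simp add: fil_iff[OF U] hinv_in[OF U] h_hinv[OF U])
  next
    fix s assume "s \<in> fil E \<alpha> U"
    then have s: "s \<in> secs E U" "h U s \<in> fil F \<alpha> U" using fil_iff[OF U] by blast+
    show "s \<in> hinv U ` fil F \<alpha> U" using hinv_h[OF U s(1)] s(2) by (intro image_eqI[of _ _ "h U s"]) simp_all
  qed
next
  fix U V t assume U: "is_open X U" and V: "is_open U V" and t: "t \<in> secs F U"
  then have XV: "is_open X V" by auto
  note s = hinv_in[OF U t]
  have "h V (res E U V (hinv U t)) = res F U V t" unfolding h_res[OF U V s] h_hinv[OF U t] ..
  then show "hinv V (res F U V t) = res E U V (hinv U t)" using hinv_h[OF XV res_in[OF U V s]] by simp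
qed

lemma higgs_iso_refl: "higgs_iso X X"
  unfolding higgs_iso_def using fb_iso_map_id by (cases X) (auto intro!: exI[of _ "\<lambda>U s. s"])

lemma higgs_iso_trans:
  assumes "higgs_iso X Y" "higgs_iso Y Z"
  shows "higgs_iso X Z"
proof -
  obtain E \<omega> \<Phi> F \<omega>' \<Psi> G \<omega>'' \<Theta> where X: "X = (E, \<omega>, \<Phi>)" "Y = (F, \<omega>', \<Psi>)" "Z = (G, \<omega>'', \<Theta>)"
    by (metis prod_cases3)
  obtain h where h: "fb_iso_map UNIV E F h" "\<forall>U. openin CP1 U \<longrightarrow> (\<forall>s\<in>secs E U. h U (\<Phi> U s) = \<Psi> U (h U s))"
    using assms(1) unfolding X higgs_iso_def by auto
  obtain g where g: "fb_iso_map UNIV F G g" "\<forall>U. openin CP1 U \<longrightarrow> (\<forall>s\<in>secs F U. g U (\<Psi> U s) = \<Theta> U (g U s))"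
    using assms(2) unfolding X higgs_iso_def by auto
  have "g U (h U (\<Phi> U s)) = \<Theta> U (g U (h U s))" if U: "openin CP1 U" and s: "s \<in> secs E U" for U s
  proof -
    have "bij_betw (h U) (secs E U) (secs F U)" by (rule fb_iso_mapD(2)[OF h(1)]) (use U in simp)
    then have "h U s \<in> secs F U" using s by (rule bij_betw_apply)
    then show ?thesis using h(2) g(2) U s by simp
  qed
  then show ?thesis unfolding X higgs_iso_def using fb_iso_map_comp[OF h(1) g(1)] by auto
qed

lemma higgs_iso_sym:
  assumes XY: "higgs_iso X Y" and X: "X \<in> C23" and Y: "Y \<in> C23"
  shows "higgs_iso Y X"
proof -
  obtain E \<omega> \<Phi> F \<omega>' \<Psi> where e: "X = (E, \<omega>, \<Phi>)" "Y = (F, \<omega>', \<Psi>)" by (metis prod_cases3)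
  obtain h where h: "fb_iso_map UNIV E F h" "\<forall>U. openin CP1 U \<longrightarrow> (\<forall>s\<in>secs E U. h U (\<Phi> U s) = \<Psi> U (h U s))"
    using XY unfolding e higgs_iso_def by auto
  have E: "filtered_bundle UNIV 2 E" "sl2_higgs_field E \<Phi>" and F: "filtered_bundle UNIV 2 F" using X Y by (auto simp: e C23_def)
  interpret bundle_iso UNIV E F h by (rule bundle_isoI[OF filtered_bundleD(1)[OF E(1)] filtered_bundleD(1)[OF F] h(1) filtered_bundleD(9)[OF E(1)]])
  have "hinv U (\<Psi> U t) = \<Phi> U (hinv U t)" if U: "openin CP1 U" and t: "t \<in> secs F U" for U t
  proof -
    have U': "is_open UNIV U" using U by simp
    have "linear_map (mero_ring U) (sec E U) (sec E U) (\<Phi> U)" by (rule sl2_higgs_fieldD(1)[OF E(2) U])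
    then have in': "\<Phi> U (hinv U t) \<in> secs E U" using hinv_in[OF U' t] by (auto simp: linear_map_def)
    have "h U (\<Phi> U (hinv U t)) = \<Psi> U t" using h(2) U hinv_in[OF U' t] h_hinv[OF U' t] by simp
    then show ?thesis using hinv_h[OF U' in'] by simp
  qed
  moreover have "fb_iso_map UNIV F E hinv" by (rule fb_iso_map_inverse[OF filtered_bundleD(9)[OF F]])
  ultimately show ?thesis unfolding e higgs_iso_def by auto
qed

text \<open>
  An isomorphism maps \<open>e\<^sub>0\<close> to a multiple \<open>\<alpha> e\<^sub>0\<close>: the second coordinate of the image has pole order at
  most \<open>\<lfloor>- 1/2\<rfloor> < 0\<close> and is entire, so it vanishes. It maps \<open>e\<^sub>1\<close> to a combination \<open>\<beta> e\<^sub>0 + \<delta> e\<^sub>1\<close> with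
  constants \<open>\<beta>\<close>, \<open>\<delta>\<close>. Applying it to \<open>\<Phi> e\<^sub>0\<close> then gives \<open>\<gamma> \<alpha> + (z - w) \<beta> = \<gamma>' \<alpha>\<close> and
  \<open>(z - w) \<delta> = (z - w') \<alpha>\<close>.
\<close>

lemma higgs_iso_rep_unique:
  assumes "higgs_iso (rep w \<gamma>) (rep w' \<gamma>')"
  shows "w = w' \<and> \<gamma> = \<gamma>'"
proof -
  obtain g where g: "fb_iso_map UNIV big_bundle big_bundle g"
    and comm: "\<forall>U. openin CP1 U \<longrightarrow> (\<forall>s\<in>secs big_bundle U. g U (rep_higgs w \<gamma> U s) = rep_higgs w' \<gamma>' U (g U s))"
    using assms unfolding rep_def higgs_iso_def by auto
  interpret bundle_iso UNIV big_bundle big_bundle g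
    by (rule bundle_isoI[OF filtered_bundleD(1)[OF filtered_big_bundle] filtered_bundleD(1)[OF filtered_big_bundle] g
        filtered_bundleD(9)[OF filtered_big_bundle]])
  have U: "is_open UNIV UNIV" using open_UNIV_CP1 by simp
  have const: "\<exists>c. f = (\<lambda>_. c)" if f: "f \<in> carrier (mero_ring UNIV)" "pole_order_le 0 f" for f
  proof -
    have "f holomorphic_on UNIV" using f(1) by (simp add: mero_ring_iff)
    then obtain p where "degree p \<le> 0" "f = poly p" using entire_pole_order_polynomial[of f 0] f(2) by auto
    then show ?thesis by (auto elim!: degree_eq_zeroE simp: fun_eq_iff)
  qed
  let ?e0 = "(\<lambda>_. 1, \<lambda>_. 0) :: (complex \<Rightarrow> complex) \<times> (complex \<Rightarrow> complex)"
  let ?e1 = "(\<lambda>_. 0, \<lambda>_. 1) :: (complex \<Rightarrow> complex) \<times> (complex \<Rightarrow> complex)"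
  have e: "?e0 \<in> fil big_bundle (- 1/4) UNIV" "?e1 \<in> fil big_bundle (1/4) UNIV"
    using B.canon_fil by (simp_all add: B_canon)
  have e': "?e0 \<in> secs big_bundle UNIV" "?e1 \<in> secs big_bundle UNIV"
    using e by (simp_all add: fil_big_bundle_iff)
  have ge0: "g UNIV ?e0 \<in> fil big_bundle (- 1/4) UNIV" and ge1: "g UNIV ?e1 \<in> fil big_bundle (1/4) UNIV"
    using e fil_iff[OF U] by blast+
  have s0: "fst (g UNIV ?e0) \<in> carrier (mero_ring UNIV)" "snd (g UNIV ?e0) \<in> carrier (mero_ring UNIV)"
    and o0: "pole_order_le 0 (fst (g UNIV ?e0))" "pole_order_le (- 1) (snd (g UNIV ?e0))"
    using ge0 by (auto simp: fil_big_bundle_iff floor_eq_iff)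
  have s1: "fst (g UNIV ?e1) \<in> carrier (mero_ring UNIV)" "snd (g UNIV ?e1) \<in> carrier (mero_ring UNIV)"
    and o1: "pole_order_le 0 (fst (g UNIV ?e1))" "pole_order_le 0 (snd (g UNIV ?e1))"
    using ge1 by (auto simp: fil_big_bundle_iff)
  obtain \<alpha> where \<alpha>: "fst (g UNIV ?e0) = (\<lambda>_. \<alpha>)" using const[OF s0(1) o0(1)] by blast
  obtain \<beta> where \<beta>: "fst (g UNIV ?e1) = (\<lambda>_. \<beta>)" using const[OF s1(1) o1(1)] by blast
  obtain \<delta> where \<delta>: "snd (g UNIV ?e1) = (\<lambda>_. \<delta>)" using const[OF s1(2) o1(2)] by blast
  obtain \<epsilon> where \<epsilon>: "snd (g UNIV ?e0) = (\<lambda>_. \<epsilon>)"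
    using const[OF s0(2) pole_order_le_mono[OF o0(2)]] by auto
  have "((\<lambda>_. \<epsilon>) \<longlongrightarrow> 0) (at_infinity :: complex filter)"
    using pole_order_le_negative_tendsto[OF o0(2)] unfolding \<epsilon> by simp
  then have "\<epsilon> = 0" using tendsto_unique[OF trivial_limit_at_infinity tendsto_const] by metis
  then have g0: "g UNIV ?e0 = (\<lambda>_. \<alpha>, \<lambda>_. 0)" and g1: "g UNIV ?e1 = (\<lambda>_. \<beta>, \<lambda>_. \<delta>)"
    using \<alpha> \<beta> \<delta> \<epsilon> by (simp_all add: prod_eq_iff)
  have "\<alpha> \<noteq> 0"
  proof
    assume "\<alpha> = 0"
    then have "g UNIV ?e0 = g UNIV (\<zero>\<^bsub>sec big_bundle UNIV\<^esub>)" using h_zero[OF U] by (simp add: g0)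
    then have "?e0 = \<zero>\<^bsub>sec big_bundle UNIV\<^esub>" using h_inj[OF U e'(1) zero_in[OF U]] by blast
    then show False by (auto simp: fun_eq_iff)
  qed
  define f0 f1 where "f0 = (\<lambda>_ :: complex. \<gamma>)" "f1 = (\<lambda>z. z - w)"
  have f: "f0 \<in> carrier (mero_ring UNIV)" "f1 \<in> carrier (mero_ring UNIV)"
    using rep_higgs_closed[OF e'(1), of w \<gamma>] by (simp_all add: rep_higgs_apply f0_f1_def)
  have "rep_higgs w \<gamma> UNIV ?e0 = f0 \<odot>\<^bsub>sec big_bundle UNIV\<^esub> ?e0 \<oplus>\<^bsub>sec big_bundle UNIV\<^esub> f1 \<odot>\<^bsub>sec big_bundle UNIV\<^esub> ?e1"
    by (simp add: rep_higgs_apply f0_f1_def)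
  then have "g UNIV (rep_higgs w \<gamma> UNIV ?e0) =
      f0 \<odot>\<^bsub>sec big_bundle UNIV\<^esub> g UNIV ?e0 \<oplus>\<^bsub>sec big_bundle UNIV\<^esub> f1 \<odot>\<^bsub>sec big_bundle UNIV\<^esub> g UNIV ?e1"
    by (simp only: h_add[OF U smult_in[OF U f(1) e'(1)] smult_in[OF U f(2) e'(2)]] h_smult[OF U f(1) e'(1)] h_smult[OF U f(2) e'(2)])
  moreover have "g UNIV (rep_higgs w \<gamma> UNIV ?e0) = rep_higgs w' \<gamma>' UNIV (g UNIV ?e0)"
    using comm open_UNIV_CP1 e'(1) by blast
  ultimately have eq: "\<gamma> * \<alpha> + (z - w) * \<beta> = \<gamma>' * \<alpha>" "(z - w) * \<delta> = (z - w') * \<alpha>" for z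
    unfolding g0 g1 by (simp_all add: rep_higgs_apply f0_f1_def fun_eq_iff)
  have "\<gamma> = \<gamma>'" using eq(1)[of w] \<open>\<alpha> \<noteq> 0\<close> by simp
  moreover have "w = w'" using eq(2)[of w] \<open>\<alpha> \<noteq> 0\<close> by simp
  ultimately show ?thesis by simp
qed

lemma equiv_iso_rel: "equiv C23 iso_rel"
  by (intro equivI refl_onI symI transI)
     (auto simp: iso_rel_def higgs_iso_refl intro: higgs_iso_sym higgs_iso_trans)

theorem proposition6p3:
  shows "(\<forall>w \<gamma>. rep w \<gamma> \<in> C23) \<and>
    bij_betw (\<lambda>(w, \<gamma>). iso_rel `` {rep w \<gamma>}) (UNIV :: (complex \<times> complex) set) M23_big \<and>
    (\<forall>(E, \<omega>, \<Phi>) \<in> (C23 :: 'a higgs_bundle set). fb_iso UNIV E big_bundle \<longrightarrow>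
       (\<exists>!(w, \<gamma>). higgs_iso (E, \<omega>, \<Phi>) (rep w \<gamma>)))"
proof (intro conjI allI)
  show "rep w \<gamma> \<in> C23" for w \<gamma> by (rule rep_in_C23)
  have class_eq: "iso_rel `` {X} = iso_rel `` {Y} \<longleftrightarrow> higgs_iso X Y" if "X \<in> C23" "Y \<in> C23"
    for X Y :: "((complex \<Rightarrow> complex) \<times> (complex \<Rightarrow> complex)) higgs_bundle"
    using eq_equiv_class_iff[OF equiv_iso_rel that] that by (auto simp: iso_rel_def)
  show "bij_betw (\<lambda>(w, \<gamma>). iso_rel `` {rep w \<gamma>}) UNIV M23_big"
    unfolding bij_betw_def
  proof
    show "inj (\<lambda>(w, \<gamma>). iso_rel `` {rep w \<gamma>})"
      by (rule injI) (auto simp: class_eq rep_in_C23 dest: higgs_iso_rep_unique)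
    show "range (\<lambda>(w, \<gamma>). iso_rel `` {rep w \<gamma>}) = M23_big"
    proof (intro equalityI subsetI)
      fix c assume "c \<in> range (\<lambda>(w, \<gamma>). iso_rel `` {rep w \<gamma>})"
      then obtain w \<gamma> where c: "c = iso_rel `` {rep w \<gamma>}" by auto
      have "c \<in> M23" unfolding c M23_def by (rule quotientI[OF rep_in_C23])
      moreover have "rep w \<gamma> \<in> c" unfolding c by (rule equiv_class_self[OF equiv_iso_rel rep_in_C23])
      moreover have "fb_iso UNIV big_bundle big_bundle" using fb_iso_map_id by (auto simp: fb_iso_def)
      ultimately show "c \<in> M23_big" unfolding M23_big_def rep_def by blast
    next
      fix c :: "((complex \<Rightarrow> complex) \<times> (complex \<Rightarrow> complex)) higgs_bundle set"
      assume "c \<in> M23_big"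
      then obtain E \<omega> \<Phi> where c: "c \<in> M23" "(E, \<omega>, \<Phi>) \<in> c" "fb_iso UNIV E big_bundle"
        by (auto simp: M23_big_def)
      obtain X where X: "X \<in> C23" "c = iso_rel `` {X}" using c(1) unfolding M23_def by (rule quotientE)
      have E: "(E, \<omega>, \<Phi>) \<in> C23" "higgs_iso X (E, \<omega>, \<Phi>)" using c(2) unfolding X(2) by (auto simp: iso_rel_def)
      obtain w \<gamma> where "higgs_iso (E, \<omega>, \<Phi>) (rep w \<gamma>)" using higgs_iso_to_rep[OF E(1) c(3)] by blast
      then have "c = iso_rel `` {rep w \<gamma>}"
        unfolding X(2) using class_eq[OF X(1) rep_in_C23] higgs_iso_trans[OF E(2)] by blast
      then show "c \<in> range (\<lambda>(w, \<gamma>). iso_rel `` {rep w \<gamma>})" by auto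
    qed
  qed
  show "\<forall>(E, \<omega>, \<Phi>) \<in> (C23 :: 'a higgs_bundle set). fb_iso UNIV E big_bundle \<longrightarrow>
       (\<exists>!(w, \<gamma>). higgs_iso (E, \<omega>, \<Phi>) (rep w \<gamma>))"
  proof clarify
    fix E :: "'a fbundle" and \<omega> \<Phi> assume E: "(E, \<omega>, \<Phi>) \<in> C23" and "fb_iso UNIV E big_bundle"
    then obtain w \<gamma> where w: "higgs_iso (E, \<omega>, \<Phi>) (rep w \<gamma>)" using higgs_iso_to_rep by blast
    have uniq: "w' = w \<and> \<gamma>' = \<gamma>" if "higgs_iso (E, \<omega>, \<Phi>) (rep w' \<gamma>')" for w' \<gamma>'
      by (rule higgs_iso_rep_unique[OF higgs_iso_trans[OF higgs_iso_sym[OF that E rep_in_C23] w]])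
    show "\<exists>!(w, \<gamma>). higgs_iso (E, \<omega>, \<Phi>) (rep w \<gamma>)"
    proof (rule ex1I)
      show "case (w, \<gamma>) of (w, \<gamma>) \<Rightarrow> higgs_iso (E, \<omega>, \<Phi>) (rep w \<gamma>)" by (simp only: prod.case w)
      fix x assume "case x of (w, \<gamma>) \<Rightarrow> higgs_iso (E, \<omega>, \<Phi>) (rep w \<gamma>)"
      then have "higgs_iso (E, \<omega>, \<Phi>) (rep (fst x) (snd x))" by (simp only: case_prod_unfold)
      then show "x = (w, \<gamma>)" using uniq by (simp add: prod_eq_iff)
    qed
  qed
qed

end
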